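(* Let $n\ge 1$, let $\beta>0$, and let $h(x)=e^{-\beta|x|^2}$ be the Gaussian function on $\mathbb{R}^n$. Let $b_0>0$ be given. Put $\rho=\frac{\sqrt3}{e}$ and define the positive constants $$c=\frac{b_0}{8\gamma_n},\qquad C=\left(3^{3/4}\, e\,\sqrt{2\rho\beta}\,\sqrt n\, e^{2n\gamma_n}\right)^4 b_0^{3}\,\gamma_n,$$ $$\delta_0=\min\left\{\frac{1}{\left(3^{3/4}\, e\,\sqrt{2\rho\beta}\,\sqrt n\, e^{2n\gamma_n}\right)^4 b_0^{3}\,\gamma_n},\ \delta_n\right\},$$ where $$\delta_n=\begin{cases}\dfrac{b_0}{2\gamma_n} & \text{if } n=1 \text{ or } n=2,\\[2mm] \dfrac{b_0}{2\gamma_n(n-1)} & \text{if } n \text{ is odd and } n>1,\\[2mm] \dfrac{b_0}{2\gamma_n(n-2)} & \text{if } n \text{ is even and } n>2,\end{cases}$$ and $$\triangle''=\begin{cases}\pi^{\frac{n-1}{4}}(n\alpha_n)^{\frac12}\,2^{\frac{n+1}{4}}\left(\frac{\sqrt3}{e}\right)^{\frac{n-2}{4}} & \text{if } n \text{ is even},\\[2mm] \pi^{\frac{n-1}{4}}(n\alpha_n)^{\frac12}\left(2+\frac1e\right)^{\frac12}2^{\frac n4}\left(\frac{\sqrt3}{e}\right)^{\frac{n-1}{4}} & \text{if } n \text{ is odd}.\end{cases}$$ Then the following is true. If $f\in\mathcal{C}_{h,0}$ and $s$ is the $h$ spline that interpolates $f$ on a subset $X$ of $\mathbb{R}^n$,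 then $$|f(x)-s(x)|\le \triangle''\,(C\delta)^{\frac{c}{\delta}}\,\|f\|_h$$ holds for all $x$ in a cube $E\subset\mathbb{R}^n$ provided that (i) $E$ has side $b$ and $b\ge b_0$, (ii) $0<\delta\le\delta_0$, and (iii) every subcube of $E$ of side $\delta$ contains a point of $X$.
   Context: The numbers $\gamma_n$ are defined by $\gamma_1=2$ and $\gamma_n=2n(1+\gamma_{n-1})$ for $n>1$. The number $\alpha_n$ is the volume of the unit ball in $\mathbb{R}^n$. $\mathcal{D}$ denotes the space of complex-valued compactly supported infinitely differentiable functions on $\mathbb{R}^n$. The Gaussian $h$ is conditionally positive definite of order $m=0$ (i.e. positive definite). The space $\mathcal{C}_{h,0}$ is the class of continuous functions $f$ on $\mathbb{R}^n$ for which there is a constant $c(f)$ such that $$\left|\int f(x)\phi(x)\,dx\right|\le c(f)\left\{\iint h(x-y)\phi(x)\overline{\phi(y)}\,dx\,dy\right\}^{1/2}\quad\text{for all }\phi\in\mathcal{D}.$$ For $f\in\mathcal{C}_{h,0}$, $\|f\|_h$ denotes the smallest such constant $c(f)$; with this norm $\mathcal{C}_{h,0}$ is a Hilbert space. Given $f\in\mathcal{C}_{h,0}$ and a subset $X\subset\mathbb{R}^n$, the $h$ spline $s$ that interpolates $f$ on $X$ is the element of $\mathcal{C}_{h,0}$ of minimal norm $\|\cdot\|_h$ that equals $f$ on $X$. When $X=\{x_1,\dots,x_N\}$ is finite, this is the function $s(x)=\sum_{j=1}^N c_j h(x-x_j)$ whose coefficients are determined by $s(x_i)=f(x_i)$,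 $i=1,\dots,N$. *)

theory Defs
  imports "HOL-Analysis.Analysis"
begin

text \<open>The value at index 0 is a dummy.\<close>

fun gam :: "nat \<Rightarrow> real" where
  "gam 0 = 0"
| "gam (Suc 0) = 2"
| "gam (Suc (Suc k)) = 2 * real (Suc (Suc k)) * (1 + gam (Suc k))"

text \<open>In finite dimension, f is of class C^(k+1) iff it is differentiable and every directional
  derivative is of class C^k.\<close>

primrec C_class :: "nat \<Rightarrow> (real^'n \<Rightarrow> complex) \<Rightarrow> bool" where
  "C_class 0 f \<longleftrightarrow> continuous_on UNIV f"
| "C_class (Suc k) f \<longleftrightarrow>
     f differentiable_on UNIV \<and> (\<forall>v. C_class k (\<lambda>x. frechet_derivative f (at x) v))"

definition test_functions :: "(real^'n \<Rightarrow> complex) set" where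
  "test_functions = {\<phi>. (\<forall>k. C_class k \<phi>) \<and> compact (closure {x. \<phi> x \<noteq> 0})}"

definition gaussian :: "real \<Rightarrow> real^'n \<Rightarrow> real" where
  "gaussian \<beta> x = exp (- \<beta> * (norm x)\<^sup>2)"

text \<open>The quadratic form is complex-valued by its type; for positive definite h its value is a
  nonnegative real, so passing to the real part below loses nothing.\<close>

definition quad_form :: "(real^'n \<Rightarrow> real) \<Rightarrow> (real^'n \<Rightarrow> complex) \<Rightarrow> complex" where
  "quad_form h \<phi> =
     (LINT y|lborel. (LINT x|lborel. complex_of_real (h (x - y)) * \<phi> x * cnj (\<phi> y)))"

definition native_bound :: "(real^'n \<Rightarrow> real) \<Rightarrow> (real^'n \<Rightarrow> complex) \<Rightarrow> real \<Rightarrow> bool" where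
  "native_bound h f c \<longleftrightarrow>
     (\<forall>\<phi>\<in>test_functions. cmod (LINT x|lborel. f x * \<phi> x) \<le> c * sqrt (Re (quad_form h \<phi>)))"

definition native_space :: "(real^'n \<Rightarrow> real) \<Rightarrow> (real^'n \<Rightarrow> complex) set" where
  "native_space h = {f. continuous_on UNIV f \<and> (\<exists>c. native_bound h f c)}"

definition native_norm :: "(real^'n \<Rightarrow> real) \<Rightarrow> (real^'n \<Rightarrow> complex) \<Rightarrow> real" where
  "native_norm h f = (LEAST c. native_bound h f c)"

definition is_spline_interpolant ::
  "(real^'n \<Rightarrow> real) \<Rightarrow> (real^'n) set \<Rightarrow> (real^'n \<Rightarrow> complex) \<Rightarrow> (real^'n \<Rightarrow> complex) \<Rightarrow> bool" where
  "is_spline_interpolant h X f s \<longleftrightarrow>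
     s \<in> native_space h \<and> (\<forall>x\<in>X. s x = f x) \<and>
     (\<forall>g\<in>native_space h. (\<forall>x\<in>X. g x = f x) \<longrightarrow> native_norm h s \<le> native_norm h g)"

text \<open>The closed cube of side b with corner p whose edges point along the images of the
  coordinate axes under the orthogonal map T. Cubes with the same T are parallel; the axis-parallel
  ones are those with T the identity.\<close>

definition cube :: "(real^'n \<Rightarrow> real^'n) \<Rightarrow> real^'n \<Rightarrow> real \<Rightarrow> (real^'n) set" where
  "cube T p b = (\<lambda>y. p + T y) ` {y. \<forall>i. 0 \<le> y $ i \<and> y $ i \<le> b}"

end

theory Submission
  imports Defs
begin

text \<open>Fix a point of E. Let \<gamma> be the value of gam at n, take a subcube of E through the point that consists of
  N^n cells of side \<delta>, where N is about b0 / \<delta>, and pick one point of X in each cell; Y is the set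
  of these points. The interpolant s agrees with f on Y and its norm is at most that of f. The claim is
  reduced to a statement about polynomials in three steps.

  Point evaluation. Testing a function of the native space against bump functions that shrink to
  points gives the native inequality for finite combinations \<mu> of point masses
  (\<open>native_bound_atoms\<close>). If \<mu> has mass 1 at the point x and its other masses on Y, the triangle
  inequality yields a bound of the error by twice the norm of f times the square root of the Gaussian
  quadratic form Q of \<mu> (\<open>native_residual_bound\<close>).

  A good combination. Choose \<mu> such that u, the convolution of \<mu> with the Gaussian, vanishes on Y; then
  Q = u x. Multiplying u by the inverse Gaussian centred at x turns it into a combination of
  exponentials of inner products. The exponential series, cut off at degree k, splits this into a
  polynomial p of degree less than k and a remainder. The tail of the exponential is
  itself a positive semidefinite kernel, so by Cauchy-Schwarz the remainder is at most sqrt Q times an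
  explicit \<eta> of size R^k / sqrt (k!). Hence p is at most sqrt Q * \<eta> in absolute value on Y, while p x = Q. If B bounds p at x in
  terms of its maximum on Y, then Q \<le> B * sqrt Q * \<eta>, so sqrt Q \<le> B * \<eta> (\<open>power_function_bound\<close>).

  The constant B. A polynomial of degree m in n variables, bounded by 1 at one point of each of N^n unit
  cells with N \<ge> 2 * \<gamma> * m, is bounded on the whole cube by a constant that is exponential in m as long as
  N is comparable to m (\<open>norming_grid\<close>). If a cell contains both small and large values of the polynomial,
  some face of the cell carries a critical point of a slight perturbation of its square, or some edge a
  point of a fixed level set of this perturbation; a linear-algebra form of Bezout's bound limits the number of
  these points on each coordinate plane, so that for n \<ge> 2 fewer than (N - m)^n cells are of this kind
  (\<open>card_split_cells_le\<close>). The polynomial is bounded on all other cells, and Lagrange interpolation along one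
  coordinate direction after the other carries the bound to the whole cube (\<open>bound_from_many_cells\<close>).

  Taking k to be b0 / (2 * \<gamma> * \<delta>), rounded up, and comparing constants (\<open>constant_comparison\<close>) gives the
  theorem.\<close>

section \<open>Polynomial functions and a Bezout bound\<close>

lemma homogeneous_system_nontrivial:
  fixes M :: "'a \<Rightarrow> 'b \<Rightarrow> real"
  assumes "finite A" "finite B" "card A < card B"
  shows "\<exists>l. (\<exists>b\<in>B. l b \<noteq> 0) \<and> (\<forall>a\<in>A. (\<Sum>b\<in>B. l b * M a b) = 0)"
  using assms
proof (induction A arbitrary: B M rule: finite_induct)
  case empty
  then obtain b where "b \<in> B" by (metis card.empty card_gt_0_iff ex_in_conv)
  then show ?case by (intro exI[of _ "\<lambda>_. 1"]) auto
next
  case (insert a A)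
  show ?case
  proof (cases "\<forall>b\<in>B. M a b = 0")
    case True
    have "card A < card B" using insert by simp
    from insert.IH[OF insert.prems(1) this, of M] obtain l where
      "\<exists>b\<in>B. l b \<noteq> 0" "\<forall>a\<in>A. (\<Sum>b\<in>B. l b * M a b) = 0" by blast
    moreover have "(\<Sum>b\<in>B. l b * M a b) = 0" using True by (intro sum.neutral) simp
    ultimately show ?thesis by blast
  next
    case False
    then obtain b0 where b0: "b0 \<in> B" "M a b0 \<noteq> 0" by blast
    define B' where "B' = B - {b0}"
    have B': "finite B'" "card A < card B'" "b0 \<notin> B'" "B = insert b0 B'"
      using insert b0 by (auto simp: B'_def)
    obtain l where l: "\<exists>b\<in>B'. l b \<noteq> 0"
      "\<forall>x\<in>A. (\<Sum>b\<in>B'. l b * (M x b - M a b / M a b0 * M x b0)) = 0"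
      using insert.IH[OF B'(1,2), of "\<lambda>x b. M x b - M a b / M a b0 * M x b0"] by blast
    define s where "s = (\<Sum>b\<in>B'. l b * M a b) / M a b0"
    define l' where "l' = l(b0 := - s)"
    have eq: "(\<Sum>b\<in>B. l' b * M x b) = (\<Sum>b\<in>B'. l b * M x b) - s * M x b0" for x
    proof -
      have "(\<Sum>b\<in>B'. l' b * M x b) = (\<Sum>b\<in>B'. l b * M x b)"
        using B'(3) by (intro sum.cong) (auto simp: l'_def)
      then show ?thesis using B' by (simp add: l'_def)
    qed
    have "(\<Sum>b\<in>B. l' b * M x b) = 0" if "x \<in> A" for x
    proof -
      have "0 = (\<Sum>b\<in>B'. l b * (M x b - M a b / M a b0 * M x b0))" using l that by simp
      also have "\<dots> = (\<Sum>b\<in>B'. l b * M x b) - s * M x b0"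
        by (simp add: s_def sum_subtractf right_diff_distrib sum_distrib_right sum_divide_distrib mult.assoc)
      finally show ?thesis using eq by simp
    qed
    moreover have "(\<Sum>b\<in>B. l' b * M a b) = 0"
      unfolding eq s_def using b0(2) by simp
    moreover have "\<exists>b\<in>B. l' b \<noteq> 0" using l(1) B' by (auto simp: l'_def)
    ultimately show ?thesis by blast
  qed
qed

text \<open>Polynomial functions of bounded total degree. With this generation, degree statements about
  products, partial derivatives and restrictions to lines are plain rule inductions.\<close>

inductive total_deg_le :: "nat \<Rightarrow> (real^'n \<Rightarrow> real) \<Rightarrow> bool" where
  const: "total_deg_le d (\<lambda>x. c)"
| coord: "total_deg_le d f \<Longrightarrow> total_deg_le (Suc d) (\<lambda>x. x $ i * f x)"
| add: "total_deg_le d f \<Longrightarrow> total_deg_le d g \<Longrightarrow> total_deg_le d (\<lambda>x. f x + g x)"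

lemma total_deg_le_Suc: "total_deg_le d f \<Longrightarrow> total_deg_le (Suc d) f"
  by (induction rule: total_deg_le.induct) (auto intro: total_deg_le.intros)

lemma total_deg_le_mono: "d \<le> e \<Longrightarrow> total_deg_le d f \<Longrightarrow> total_deg_le e f"
  by (induction e rule: dec_induct) (auto intro: total_deg_le_Suc)

lemma total_deg_le_scale: "total_deg_le d f \<Longrightarrow> total_deg_le d (\<lambda>x. c * f x)"
proof (induction rule: total_deg_le.induct)
  case (coord d f i)
  from total_deg_le.coord[OF coord.IH, of i] show ?case by (simp add: algebra_simps)
next
  case (add d f g)
  from total_deg_le.add[OF add.IH] show ?case by (simp add: algebra_simps)
qed (rule total_deg_le.const)

lemma total_deg_le_mult:
  "total_deg_le d f \<Longrightarrow> total_deg_le e g \<Longrightarrow> total_deg_le (d + e) (\<lambda>x. f x * g x)"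
proof (induction rule: total_deg_le.induct)
  case (const d c)
  show ?case using total_deg_le_mono[of e "d+e"] total_deg_le_scale[OF const] by auto
next
  case (coord d f i)
  from total_deg_le.coord[OF coord.IH[OF coord.prems], of i] show ?case by (simp add: algebra_simps)
next
  case (add d f g')
  from total_deg_le.add[OF add.IH[OF add.prems]] show ?case by (simp add: algebra_simps)
qed

lemma total_deg_le_diff:
  "total_deg_le d f \<Longrightarrow> total_deg_le d g \<Longrightarrow> total_deg_le d (\<lambda>x. f x - g x)"
  using total_deg_le.add[OF _ total_deg_le_scale[of d g "-1"], of f] by simp

lemma total_deg_le_coord: "total_deg_le 1 (\<lambda>x. x $ i)"
  using total_deg_le.coord[OF total_deg_le.const[of 0 1]] by simp

lemma total_deg_le_sum:
  "(\<And>i. i \<in> I \<Longrightarrow> total_deg_le d (f i)) \<Longrightarrow> total_deg_le d (\<lambda>x. \<Sum>i\<in>I. f i x)"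
  by (induction I rule: infinite_finite_induct) (auto intro: total_deg_le.intros)

lemma total_deg_le_power: "total_deg_le d f \<Longrightarrow> total_deg_le (j * d) (\<lambda>x. f x ^ j)"
  by (induction j) (auto intro: total_deg_le.const total_deg_le_mult)

lemma total_deg_le_prod:
  "finite I \<Longrightarrow> (\<And>i. i \<in> I \<Longrightarrow> total_deg_le d (f i)) \<Longrightarrow> total_deg_le (card I * d) (\<lambda>x. \<Prod>i\<in>I. f i x)"
  by (induction I rule: finite_induct) (auto intro: total_deg_le.const total_deg_le_mult)

lemma total_deg_le_continuous: "total_deg_le d f \<Longrightarrow> continuous_on S f"
  by (induction rule: total_deg_le.induct) (auto intro!: continuous_intros)

lemma total_deg_le_line_poly:
  assumes "total_deg_le d f"
  shows "\<exists>q. degree q \<le> d \<and> (\<forall>t. f (\<chi> j. if j = i then t else x $ j) = poly q t)"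
  using assms
proof (induction rule: total_deg_le.induct)
  case (const d c)
  show ?case by (intro exI[of _ "[:c:]"]) auto
next
  case (coord d f l)
  then obtain q where q: "degree q \<le> d" "\<forall>t. f (\<chi> j. if j = i then t else x $ j) = poly q t" by blast
  show ?case
  proof (cases "l = i")
    case True
    show ?thesis using q True degree_pCons_le[of 0 q] by (intro exI[of _ "pCons 0 q"]) auto
  next
    case False
    show ?thesis using q False degree_smult_le[of "x$l" q] by (intro exI[of _ "smult (x$l) q"]) auto
  qed
next
  case (add d f g)
  then obtain q r where "degree q \<le> d" "\<forall>t. f (\<chi> j. if j = i then t else x $ j) = poly q t"
    "degree r \<le> d" "\<forall>t. g (\<chi> j. if j = i then t else x $ j) = poly r t" by blast
  then show ?case by (intro exI[of _ "q + r"]) (auto intro: degree_add_le)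
qed

text \<open>The last conjunct carries the induction through degree 0, where the truncated d - 1 is too
  weak: multiplication by a coordinate must not raise the degree of a vanishing derivative.\<close>

lemma total_deg_le_partial:
  assumes "total_deg_le d f"
  shows "\<exists>g. total_deg_le (d - 1) g \<and>
    (\<forall>x. ((\<lambda>t. f (x + t *\<^sub>R axis i 1)) has_real_derivative g x) (at 0)) \<and> (d = 0 \<longrightarrow> g = (\<lambda>_. 0))"
  using assms
proof (induction rule: total_deg_le.induct)
  case (const d c)
  show ?case by (intro exI[of _ "\<lambda>_. 0"]) (auto intro: total_deg_le.const)
next
  case (coord d f l)
  then obtain g where g: "total_deg_le (d - 1) g"
    "\<And>x. ((\<lambda>t. f (x + t *\<^sub>R axis i 1)) has_real_derivative g x) (at 0)" "d = 0 \<longrightarrow> g = (\<lambda>_. 0)" by blast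
  define c where "c = (axis i 1 :: real^'a) $ l"
  have der: "((\<lambda>t. (x + t *\<^sub>R axis i 1) $ l * f (x + t *\<^sub>R axis i 1)) has_real_derivative
      (c * f x + x $ l * g x)) (at 0)" for x
    by (auto intro!: derivative_eq_intros g simp: c_def)
  have "total_deg_le d (\<lambda>x. c * f x + x $ l * g x)"
  proof (cases d)
    case 0
    then show ?thesis using g coord.hyps by (auto intro: total_deg_le_scale)
  next
    case (Suc d')
    then show ?thesis using g(1) coord.hyps
      by (auto intro!: total_deg_le.add total_deg_le_scale total_deg_le.coord)
  qed
  with der show ?case by (intro exI[of _ "\<lambda>x. c * f x + x $ l * g x"]) auto
next
  case (add d f g)
  then obtain f' g' where "total_deg_le (d - 1) f'" "total_deg_le (d - 1) g'"
    "\<And>x. ((\<lambda>t. f (x + t *\<^sub>R axis i 1)) has_real_derivative f' x) (at 0)"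
    "\<And>x. ((\<lambda>t. g (x + t *\<^sub>R axis i 1)) has_real_derivative g' x) (at 0)"
    "d = 0 \<longrightarrow> f' = (\<lambda>_. 0)" "d = 0 \<longrightarrow> g' = (\<lambda>_. 0)"
    by blast
  then show ?case
    by (intro exI[of _ "\<lambda>x. f' x + g' x"]) (auto intro!: derivative_eq_intros total_deg_le.add)
qed

lemma monomial_raise:
  fixes x :: "'a \<Rightarrow> real"
  assumes "finite J" "j \<in> J"
  shows "(\<Prod>i\<in>J. x i ^ (\<alpha>(j := \<alpha> j + c)) i) = (\<Prod>i\<in>J. x i ^ \<alpha> i) * x j ^ c"
    and "(\<Sum>i\<in>J. (\<alpha>(j := \<alpha> j + c)) i) = (\<Sum>i\<in>J. \<alpha> i) + c"
proof -
  have p: "(\<Prod>i\<in>J-{j}. x i ^ (\<alpha>(j := \<alpha> j + c)) i) = (\<Prod>i\<in>J-{j}. x i ^ \<alpha> i)"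
    by (rule prod.cong) auto
  show "(\<Prod>i\<in>J. x i ^ (\<alpha>(j := \<alpha> j + c)) i) = (\<Prod>i\<in>J. x i ^ \<alpha> i) * x j ^ c"
    unfolding prod.remove[OF assms] p by (simp add: power_add mult_ac)
  have s: "(\<Sum>i\<in>J-{j}. (\<alpha>(j := \<alpha> j + c)) i) = (\<Sum>i\<in>J-{j}. \<alpha> i)"
    by (rule sum.cong) auto
  show "(\<Sum>i\<in>J. (\<alpha>(j := \<alpha> j + c)) i) = (\<Sum>i\<in>J. \<alpha> i) + c"
    unfolding sum.remove[OF assms] s by simp
qed

text \<open>Bezout's bound for systems whose leading forms are pure powers. Modulo the equations every
  monomial reduces to one with all exponents below e, so these e ^ card J monomials span
  all functions on a finite set of solutions. Dually, with more solutions than monomials, some nonzero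
  combination of point evaluations would kill these monomials, hence all polynomials, although
  polynomials separate points.\<close>

lemma card_solutions_le:
  fixes Z :: "(real^'n) set" and J :: "'n set"
  assumes plane: "\<And>z l. z \<in> Z \<Longrightarrow> l \<notin> J \<Longrightarrow> z $ l = v l"
    and r: "\<And>j. j \<in> J \<Longrightarrow> total_deg_le (e - 1) (r j)"
    and eq: "\<And>z j. z \<in> Z \<Longrightarrow> j \<in> J \<Longrightarrow> z $ j ^ e = r j z"
    and e: "e > 0"
  shows "finite Z \<and> card Z \<le> e ^ card J"
proof (rule ccontr)
  assume "\<not> ?thesis"
  then have "\<exists>Z'. Z' \<subseteq> Z \<and> finite Z' \<and> card Z' > e ^ card J"
    using infinite_arbitrarily_large[of Z "Suc (e ^ card J)"] by (metis lessI not_le_imp_less subset_refl)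
  then obtain Z' where Z': "Z' \<subseteq> Z" "finite Z'" "card Z' > e ^ card J" by blast
  define A where "A = PiE J (\<lambda>_. {..<e})"
  define mon where "mon = (\<lambda>\<alpha> z. \<Prod>j\<in>J. (z::real^'n) $ j ^ (\<alpha> j))"
  have A: "finite A" "card A = e ^ card J" by (auto simp: A_def card_PiE finite_PiE)
  obtain lam where lam: "\<exists>z\<in>Z'. lam z \<noteq> 0" "\<And>\<alpha>. \<alpha> \<in> A \<Longrightarrow> (\<Sum>z\<in>Z'. lam z * mon \<alpha> z) = 0"
    using homogeneous_system_nontrivial[of A Z' mon] A Z' by auto
  have finJ: "finite J" by simp
  \<comment> \<open>If the functional kills the monomials of low degree, it kills every low-degree multiple of
    a monomial as well. Off J the coordinates are constant on Z', so they only scale.\<close>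
  have extend: "(\<Sum>z\<in>Z'. lam z * (mon \<alpha> z * f z)) = 0"
    if "total_deg_le d f" "\<And>\<alpha>. (\<Sum>j\<in>J. \<alpha> j) < E \<Longrightarrow> (\<Sum>z\<in>Z'. lam z * mon \<alpha> z) = 0"
      "(\<Sum>j\<in>J. \<alpha> j) + d < E" for d f E \<alpha>
    using that(1,3)
  proof (induction arbitrary: \<alpha> rule: total_deg_le.induct)
    case (const d c)
    then have "c * (\<Sum>z\<in>Z'. lam z * mon \<alpha> z) = 0" using that(2)[of \<alpha>] by simp
    then show ?case by (simp add: sum_distrib_left mult_ac)
  next
    case (coord d f i)
    show ?case
    proof (cases "i \<in> J")
      case True
      define \<alpha>' where "\<alpha>' = \<alpha>(i := \<alpha> i + 1)"
      have m: "mon \<alpha>' z = mon \<alpha> z * z $ i" for z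
        unfolding mon_def \<alpha>'_def using monomial_raise(1)[OF finJ True, of "\<lambda>l. z $ l" \<alpha> 1] by simp
      have "(\<Sum>j\<in>J. \<alpha>' j) = Suc (\<Sum>j\<in>J. \<alpha> j)"
        unfolding \<alpha>'_def using monomial_raise(2)[OF finJ True, of \<alpha> 1] by simp
      then have "(\<Sum>z\<in>Z'. lam z * (mon \<alpha>' z * f z)) = 0" using coord.IH[of \<alpha>'] coord.prems by simp
      then show ?thesis by (simp add: m mult_ac)
    next
      case False
      have "(\<Sum>z\<in>Z'. lam z * (mon \<alpha> z * f z)) = 0" using coord.IH[of \<alpha>] coord.prems by simp
      then have "v i * (\<Sum>z\<in>Z'. lam z * (mon \<alpha> z * f z)) = 0" by simp
      moreover have "v i * (\<Sum>z\<in>Z'. lam z * (mon \<alpha> z * f z)) = (\<Sum>z\<in>Z'. lam z * (mon \<alpha> z * (z $ i * f z)))"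
        unfolding sum_distrib_left using False plane Z' by (intro sum.cong) (auto simp: subset_iff)
      ultimately show ?thesis by simp
    qed
  next
    case (add d f g)
    then show ?case by (simp add: algebra_simps sum.distrib)
  qed
  have mono_zero: "(\<Sum>j\<in>J. \<alpha> j) = D \<Longrightarrow> (\<Sum>z\<in>Z'. lam z * mon \<alpha> z) = 0" for D \<alpha>
  proof (induction D arbitrary: \<alpha> rule: less_induct)
    case (less D)
    show ?case
    proof (cases "\<forall>j\<in>J. \<alpha> j < e")
      case True
      then have "restrict \<alpha> J \<in> A" by (auto simp: A_def)
      moreover have "mon (restrict \<alpha> J) = mon \<alpha>" by (auto simp: mon_def fun_eq_iff)
      ultimately show ?thesis using lam(2)[of "restrict \<alpha> J"] by simp
    next
      case False
      then obtain j where j: "j \<in> J" "\<alpha> j \<ge> e" by (meson not_le)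
      \<comment> \<open>On Z' the factor of exponent e in coordinate j may be replaced by r j, which drops the degree.\<close>
      define \<alpha>' where "\<alpha>' = \<alpha>(j := \<alpha> j - e)"
      have \<alpha>: "\<alpha> = \<alpha>'(j := \<alpha>' j + e)" using j by (auto simp: \<alpha>'_def)
      have m: "mon \<alpha> z = mon \<alpha>' z * z $ j ^ e" for z
        using monomial_raise(1)[OF finJ j(1), of "\<lambda>l. z $ l" \<alpha>' e] \<alpha> by (simp add: mon_def)
      have "(\<Sum>i\<in>J. \<alpha>' i) + e = (\<Sum>i\<in>J. \<alpha> i)"
        using monomial_raise(2)[OF finJ j(1), of \<alpha>' e] \<alpha> by simp
      then have deg: "(\<Sum>i\<in>J. \<alpha>' i) + (e - 1) < D" using less.prems e by simp
      have low: "(\<Sum>z\<in>Z'. lam z * mon \<alpha>'' z) = 0" if "(\<Sum>i\<in>J. \<alpha>'' i) < D" for \<alpha>''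
        using less.IH[OF that refl] .
      have "(\<Sum>z\<in>Z'. lam z * (mon \<alpha>' z * r j z)) = 0"
        by (rule extend[OF r[OF j(1)] low deg])
      also have "(\<Sum>z\<in>Z'. lam z * (mon \<alpha>' z * r j z)) = (\<Sum>z\<in>Z'. lam z * mon \<alpha> z)"
        using eq j Z' by (intro sum.cong) (auto simp: m subset_iff)
      finally show ?thesis .
    qed
  qed
  \<comment> \<open>So the functional kills all polynomials, among them one that separates a single point.\<close>
  obtain z0 where z0: "z0 \<in> Z'" "lam z0 \<noteq> 0" using lam by blast
  define f where "f = (\<lambda>x::real^'n. \<Prod>z\<in>Z'-{z0}. \<Sum>i\<in>UNIV. (x $ i - z $ i)^2)"
  have "total_deg_le (card (Z'-{z0}) * 2) f" unfolding f_def
  proof (rule total_deg_le_prod)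
    fix z :: "real^'n"
    have "total_deg_le 2 (\<lambda>x. (x $ i - z $ i)^2)" for i
      using total_deg_le_power[OF total_deg_le_diff[OF total_deg_le_coord total_deg_le.const], where j=2] by auto
    then show "total_deg_le 2 (\<lambda>x. \<Sum>i\<in>UNIV. (x $ i - z $ i)^2)" by (intro total_deg_le_sum)
  qed (use Z' in auto)
  then have "(\<Sum>z\<in>Z'. lam z * (mon (\<lambda>_. 0) z * f z)) = 0"
    by (rule extend[OF _ mono_zero[OF refl] lessI])
  moreover have "f z = 0" if "z \<in> Z' - {z0}" for z
    using that Z' unfolding f_def by (intro prod_zero) (auto intro!: bexI[of _ z])
  ultimately have "lam z0 * f z0 = 0" using z0 Z'
    by (subst (asm) sum.remove[of _ z0]) (auto simp: mon_def)
  then have "f z0 = 0" using z0 by simp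
  then obtain z where "z \<in> Z'" "z \<noteq> z0" "(\<Sum>i\<in>UNIV. (z0 $ i - z $ i)^2) = 0"
    unfolding f_def using Z' by auto
  then have "z0 = z" by (subst (asm) sum_nonneg_eq_0_iff) (auto simp: vec_eq_iff)
  then show False using \<open>z \<noteq> z0\<close> by simp
qed

section \<open>Counting the cells in which a polynomial crosses a level\<close>

definition lattice_face :: "'n set \<Rightarrow> ('n \<Rightarrow> nat) \<Rightarrow> (real^'n) set" where
  "lattice_face J v = cbox (\<chi> l. real (v l)) (\<chi> l. real (v l) + of_bool (l \<in> J))"

lemma mem_lattice_face:
  "x \<in> lattice_face J v \<longleftrightarrow> (\<forall>l. real (v l) \<le> x $ l \<and> x $ l \<le> real (v l) + of_bool (l \<in> J))"
  by (simp add: lattice_face_def mem_box_cart)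

lemma lattice_face_fixed: "x \<in> lattice_face J v \<Longrightarrow> l \<notin> J \<Longrightarrow> x $ l = real (v l)"
  unfolding mem_lattice_face by (drule spec[of _ l]) auto

definition splits_at :: "real \<Rightarrow> (real^'n \<Rightarrow> real) \<Rightarrow> (real^'n) set \<Rightarrow> bool" where
  "splits_at t F S \<longleftrightarrow> (\<exists>x\<in>S. F x \<le> t) \<and> (\<exists>x\<in>S. F x > t)"

text \<open>Directions in J stay inside the face for a short while, so the one-variable criterion applies.\<close>

lemma interior_extremum_partial_zero:
  fixes F :: "real^'n \<Rightarrow> real"
  assumes J: "j \<in> J" and x: "x \<in> lattice_face J v"
    and int: "real (v j) < x $ j" "x $ j < real (v j) + 1"
    and ext: "(\<forall>y\<in>lattice_face J v. F y \<le> F x) \<or> (\<forall>y\<in>lattice_face J v. F y \<ge> F x)"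
    and der: "((\<lambda>s. F (x + s *\<^sub>R axis j 1)) has_real_derivative D) (at 0)"
  shows "D = 0"
proof -
  define d where "d = min (x $ j - real (v j)) (real (v j) + 1 - x $ j)"
  have d: "d > 0" using int by (simp add: d_def)
  have mem: "x + s *\<^sub>R axis j 1 \<in> lattice_face J v" if "\<bar>0 - s\<bar> < d" for s
    using that x J unfolding mem_lattice_face d_def
    by (auto simp: axis_def abs_less_iff)
  from ext show ?thesis
  proof
    assume "\<forall>y\<in>lattice_face J v. F y \<le> F x"
    then show ?thesis using mem by (intro DERIV_local_max[OF der d]) auto
  next
    assume "\<forall>y\<in>lattice_face J v. F y \<ge> F x"
    then show ?thesis using mem by (intro DERIV_local_min[OF der d]) auto
  qed
qed

text \<open>What a split face of minimal dimension must contain: a point of the level set if it is an edge, a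
  critical point along the face otherwise. In both cases the number of such points on a coordinate
  plane can be bounded by counting solutions of polynomial equations.\<close>

definition face_witness :: "(real^'n \<Rightarrow> real) \<Rightarrow> real \<Rightarrow> 'n set \<Rightarrow> real^'n \<Rightarrow> bool" where
  "face_witness F t J x \<longleftrightarrow>
     (if card J = 1 then F x = t
      else \<forall>j\<in>J. \<forall>D. ((\<lambda>s. F (x + s *\<^sub>R axis j 1)) has_real_derivative D) (at 0) \<longrightarrow> D = 0)"

text \<open>Among the faces of the cell that are split, take one of minimal dimension. An edge contains a
  level point by the intermediate value theorem. In higher dimension no proper subface is split, so
  walking along edges shows that all vertices, and then the whole relative boundary, lie on the same
  side of the level; a point on the other side forces an extremum in the relative interior. The set A
  records in which fixed coordinates the face sits at the upper end of the cell.\<close>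

lemma split_face_has_witness:
  fixes F :: "real^'n \<Rightarrow> real"
  assumes cont: "continuous_on UNIV F"
    and vert: "\<And>v. F (\<chi> l. real (v l)) \<noteq> t"
    and split: "splits_at t F (lattice_face UNIV i)"
  shows "\<exists>J A x. J \<noteq> {} \<and> A \<subseteq> - J \<and> face_witness F t J x \<and>
    (\<forall>l. l \<notin> J \<longrightarrow> x $ l = real (i l + of_bool (l \<in> A))) \<and>
    (\<forall>j\<in>J. real (i j) < x $ j \<and> x $ j < real (i j) + 1)"
proof -
  define P where "P = (\<lambda>(J, A). A \<inter> J = {} \<and> splits_at t F (lattice_face J (\<lambda>l. i l + of_bool (l \<in> A))))"
  have "P (UNIV, {})" using split by (simp add: P_def)
  then obtain JA where JA: "P JA" "\<And>JA'. P JA' \<Longrightarrow> card (fst JA) \<le> card (fst JA')"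
    using ex_has_least_nat[of P "(UNIV, {})" "\<lambda>JA. card (fst JA)"] by blast
  obtain J A where JAeq: "JA = (J, A)" by (cases JA)
  define v where "v = (\<lambda>l. i l + of_bool (l \<in> A) :: nat)"
  have dis: "A \<inter> J = {}" and spl: "splits_at t F (lattice_face J v)"
    using JA(1) by (auto simp: JAeq P_def v_def)
  have min: "\<not> splits_at t F (lattice_face J' (\<lambda>l. v l + of_bool (l \<in> B)))"
    if "J' \<subset> J" "B \<subseteq> J - J'" for J' B
  proof
    assume *: "splits_at t F (lattice_face J' (\<lambda>l. v l + of_bool (l \<in> B)))"
    have "(\<lambda>l. v l + of_bool (l \<in> B)) = (\<lambda>l. i l + of_bool (l \<in> A \<union> B))"
      using dis that by (auto simp: v_def fun_eq_iff)
    then have "P (J', A \<union> B)" using * dis that by (auto simp: P_def)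
    from JA(2)[OF this] have "card J \<le> card J'" by (simp add: JAeq)
    then show False using psubset_card_mono[OF _ that(1)] by simp
  qed
  have corner: "(\<chi> l. real (w l)) \<in> lattice_face K w" for K and w :: "'n \<Rightarrow> nat"
    by (simp add: mem_lattice_face)
  have Jne: "J \<noteq> {}"
  proof
    assume "J = {}"
    then have "lattice_face J v = {\<chi> l. real (v l)}"
      using corner[of v J] by (auto simp: vec_eq_iff lattice_face_fixed)
    then show False using spl by (auto simp: splits_at_def)
  qed
  have bdry: "\<exists>B. B \<subseteq> {j} \<and> y \<in> lattice_face (J - {j}) (\<lambda>l. v l + of_bool (l \<in> B))"
    if "y \<in> lattice_face J v" "j \<in> J" "\<not> (real (v j) < y $ j \<and> y $ j < real (v j) + 1)" for y j
  proof -
    have "y $ j = real (v j) \<or> y $ j = real (v j) + 1"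
      using that(1)[unfolded mem_lattice_face, rule_format, of j] that(2,3) by auto
    then show ?thesis
    proof
      assume "y $ j = real (v j)"
      then have "real (v l) \<le> y $ l \<and> y $ l \<le> real (v l) + of_bool (l \<in> J - {j})" for l
        using that(1)[unfolded mem_lattice_face, rule_format, of l] by (cases "l = j") auto
      then have "y \<in> lattice_face (J - {j}) v" by (simp add: mem_lattice_face)
      then show ?thesis by (intro exI[of _ "{}"]) simp
    next
      assume "y $ j = real (v j) + 1"
      then have "real (v l + of_bool (l \<in> {j})) \<le> y $ l \<and>
          y $ l \<le> real (v l + of_bool (l \<in> {j})) + of_bool (l \<in> J - {j})" for l
        using that(1)[unfolded mem_lattice_face, rule_format, of l] by (cases "l = j") auto
      then show ?thesis by (intro exI[of _ "{j}"]) (simp add: mem_lattice_face)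
    qed
  qed
  have "\<exists>x\<in>lattice_face J v. face_witness F t J x \<and> (\<forall>j\<in>J. real (v j) < x $ j \<and> x $ j < real (v j) + 1)"
  proof (cases "card J = 1")
    case True
    then obtain j where j: "J = {j}" by (auto simp: card_1_singleton_iff)
    have "connected (F ` lattice_face J v)"
      by (intro connected_continuous_image continuous_on_subset[OF cont])
         (auto simp: lattice_face_def convex_connected)
    then have "is_interval (F ` lattice_face J v)" by (simp add: is_interval_connected_1)
    moreover obtain a b where "a \<in> lattice_face J v" "b \<in> lattice_face J v" "F a \<le> t" "t < F b"
      using spl by (auto simp: splits_at_def)
    ultimately have "t \<in> F ` lattice_face J v"
      unfolding is_interval_1 by (meson imageI less_imp_le)
    then obtain x where x: "x \<in> lattice_face J v" "F x = t" by auto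
    have "real (v j) < x $ j \<and> x $ j < real (v j) + 1"
    proof (rule ccontr)
      assume "\<not> ?thesis"
      from bdry[OF x(1) _ this] j obtain B where
        "x \<in> lattice_face {} (\<lambda>l. v l + of_bool (l \<in> B))" by auto
      then have "x = (\<chi> l. real (v l + of_bool (l \<in> B)))"
        by (subst vec_eq_iff) (simp add: lattice_face_fixed del: of_nat_add)
      then show False using vert x(2) by metis
    qed
    then show ?thesis using x j True by (intro bexI[of _ x]) (auto simp: face_witness_def)
  next
    case False
    define c where "c = (\<lambda>B. (\<chi> l. real (v l + of_bool (l \<in> B)) :: real^'n))"
    have status_face: "F y \<le> t \<longleftrightarrow> F y' \<le> t"
      if "J' \<subset> J" "B \<subseteq> J - J'" "y \<in> lattice_face J' (\<lambda>l. v l + of_bool (l \<in> B))"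
        "y' \<in> lattice_face J' (\<lambda>l. v l + of_bool (l \<in> B))" for J' B y y'
      using min[OF that(1,2)] that(3,4) unfolding splits_at_def by (meson not_le)
    have status_vert: "F (c B) \<le> t \<longleftrightarrow> F (c {}) \<le> t" if "B \<subseteq> J" for B
      using finite_subset[OF that finite] that
    proof (induction B rule: finite_induct)
      case (insert b B)
      have "c B \<in> lattice_face {b} (\<lambda>l. v l + of_bool (l \<in> B))"
        "c (insert b B) \<in> lattice_face {b} (\<lambda>l. v l + of_bool (l \<in> B))"
        using insert by (auto simp: c_def mem_lattice_face)
      moreover have "{b} \<subset> J" using insert False by auto
      ultimately have "F (c (insert b B)) \<le> t \<longleftrightarrow> F (c B) \<le> t"
        using insert by (intro status_face[of "{b}" B]) auto
      then show ?case using insert by auto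
    qed simp
    have status: "F y \<le> t \<longleftrightarrow> F (c {}) \<le> t"
      if y: "y \<in> lattice_face J v" and j: "j \<in> J" "\<not> (real (v j) < y $ j \<and> y $ j < real (v j) + 1)" for y j
    proof -
      obtain B where B: "B \<subseteq> {j}" "y \<in> lattice_face (J - {j}) (\<lambda>l. v l + of_bool (l \<in> B))"
        using bdry[OF y j] by blast
      have "c B \<in> lattice_face (J - {j}) (\<lambda>l. v l + of_bool (l \<in> B))"
        unfolding c_def by (rule corner)
      then have "F y \<le> t \<longleftrightarrow> F (c B) \<le> t"
        using B j by (intro status_face[of "J - {j}" B]) auto
      also have "\<dots> \<longleftrightarrow> F (c {}) \<le> t" using B j by (intro status_vert) auto
      finally show ?thesis .
    qed
    have cmp: "compact (lattice_face J v)" "lattice_face J v \<noteq> {}"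
      using corner[of v J] by (auto simp: lattice_face_def compact_cbox)
    have cont': "continuous_on (lattice_face J v) F" by (rule continuous_on_subset[OF cont]) auto
    obtain x where x: "x \<in> lattice_face J v"
      "(\<forall>y\<in>lattice_face J v. F y \<le> F x) \<or> (\<forall>y\<in>lattice_face J v. F y \<ge> F x)"
      "\<not> (F x \<le> t \<longleftrightarrow> F (c {}) \<le> t)"
    proof (cases "F (c {}) \<le> t")
      case True
      obtain x where x: "x \<in> lattice_face J v" "\<forall>y\<in>lattice_face J v. F y \<le> F x"
        using continuous_attains_sup[OF cmp cont'] by blast
      then have "F x > t" using spl by (fastforce simp: splits_at_def)
      then show ?thesis using x True that by auto
    next
      case False
      obtain x where x: "x \<in> lattice_face J v" "\<forall>y\<in>lattice_face J v. F y \<ge> F x"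
        using continuous_attains_inf[OF cmp cont'] by blast
      then have "F x \<le> t" using spl by (fastforce simp: splits_at_def)
      then show ?thesis using x False that by auto
    qed
    have int: "real (v j) < x $ j \<and> x $ j < real (v j) + 1" if "j \<in> J" for j
      using status[OF x(1) that] x(3) by blast
    then have "face_witness F t J x"
      unfolding face_witness_def using False interior_extremum_partial_zero[OF _ x(1) _ _ x(2)] by auto
    then show ?thesis using x int by blast
  qed
  then obtain x where x: "x \<in> lattice_face J v" "face_witness F t J x"
    "\<forall>j\<in>J. real (v j) < x $ j \<and> x $ j < real (v j) + 1" by blast
  have "\<forall>l. l \<notin> J \<longrightarrow> x $ l = real (i l + of_bool (l \<in> A))"
    using lattice_face_fixed[OF x(1)] by (auto simp: v_def)
  moreover have "\<forall>j\<in>J. v j = i j" using dis by (auto simp: v_def)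
  ultimately show ?thesis using x Jne dis by (intro exI[of _ J] exI[of _ A] exI[of _ x]) auto
qed

text \<open>The added odd power exceeds the degree of the square by one. It makes the leading form of every
  partial derivative a pure power of one coordinate, as the Bezout bound requires, and
  so removes degenerate critical sets.\<close>

definition perturbed_square :: "real \<Rightarrow> nat \<Rightarrow> (real^'n \<Rightarrow> real) \<Rightarrow> real^'n \<Rightarrow> real" where
  "perturbed_square \<epsilon> m p x = p x ^ 2 + \<epsilon> * (\<Sum>l\<in>UNIV. x $ l ^ (2 * m + 1))"

lemma card_witnesses_plane:
  fixes p :: "real^'n \<Rightarrow> real" and v :: "'n \<Rightarrow> nat" and t :: real and J :: "'n set"
  assumes p: "total_deg_le m p" and m: "m > 0" and \<epsilon>: "\<epsilon> > 0"
  defines "Z \<equiv> {x. (\<forall>l. l \<notin> J \<longrightarrow> x $ l = real (v l)) \<and> face_witness (perturbed_square \<epsilon> m p) t J x}"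
  shows "finite Z \<and> card Z \<le> (2 * m + 1) ^ card J"
proof -
  have p2: "total_deg_le (2 * m) (\<lambda>x. p x ^ 2)"
    using total_deg_le_power[OF p, of 2] by simp
  show ?thesis
  proof (cases "card J = 1")
    case True
    then obtain j where j: "J = {j}" by (auto simp: card_1_singleton_iff)
    show ?thesis
    proof (rule card_solutions_le[where v="\<lambda>l. real (v l)" and
          r="\<lambda>j x. (1 / \<epsilon>) * (t - \<epsilon> * (\<Sum>l\<in>UNIV-{j}. real (v l) ^ (2 * m + 1)) - p x ^ 2)"])
      fix z k assume z: "z \<in> Z" "k \<in> J"
      have "(\<Sum>l\<in>UNIV. z $ l ^ (2 * m + 1)) = z $ j ^ (2 * m + 1) + (\<Sum>l\<in>UNIV-{j}. z $ l ^ (2 * m + 1))"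
        by (rule sum.remove) auto
      also have "(\<Sum>l\<in>UNIV-{j}. z $ l ^ (2 * m + 1)) = (\<Sum>l\<in>UNIV-{j}. real (v l) ^ (2 * m + 1))"
        using z j by (intro sum.cong) (auto simp: Z_def)
      finally have "p z ^ 2 + \<epsilon> * (z $ j ^ (2 * m + 1) + (\<Sum>l\<in>UNIV-{j}. real (v l) ^ (2 * m + 1))) = t"
        using z j unfolding Z_def perturbed_square_def face_witness_def by simp
      then show "z $ k ^ (2 * m + 1) = (1 / \<epsilon>) * (t - \<epsilon> * (\<Sum>l\<in>UNIV-{k}. real (v l) ^ (2 * m + 1)) - p z ^ 2)"
        using z \<epsilon> j by (simp add: field_simps)
    next
      fix k
      show "total_deg_le (2 * m + 1 - 1) (\<lambda>x. (1 / \<epsilon>) * (t - \<epsilon> * (\<Sum>l\<in>UNIV-{k}. real (v l) ^ (2 * m + 1)) - p x ^ 2))"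
        using p2 by (intro total_deg_le_scale total_deg_le_diff total_deg_le.const) simp
    qed (auto simp: Z_def)
  next
    case False
    obtain g where g: "\<And>j. total_deg_le (2 * m - 1) (g j)"
      "\<And>j x. ((\<lambda>s. p (x + s *\<^sub>R axis j 1) ^ 2) has_real_derivative g j x) (at 0)"
      using total_deg_le_partial[OF p2] by metis
    have "finite Z \<and> card Z \<le> (2 * m) ^ card J"
    proof (rule card_solutions_le[where v="\<lambda>l. real (v l)" and r="\<lambda>j x. (-1 / (\<epsilon> * real (2 * m + 1))) * g j x"])
      fix z j assume z: "z \<in> Z" "j \<in> J"
      have mon_der: "((\<lambda>s. (z + s *\<^sub>R axis j 1) $ l ^ (2 * m + 1)) has_real_derivative
          real (2*m+1) * z $ l ^ (2 * m) * axis j 1 $ l) (at 0)" for l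
        by (auto intro!: derivative_eq_intros simp del: power_Suc)
      have "((\<lambda>s. perturbed_square \<epsilon> m p (z + s *\<^sub>R axis j 1)) has_real_derivative
         g j z + \<epsilon> * (\<Sum>l\<in>UNIV. real (2*m+1) * z $ l ^ (2 * m) * axis j 1 $ l)) (at 0)"
        unfolding perturbed_square_def by (intro DERIV_add g DERIV_cmult DERIV_sum mon_der)
      then have "g j z + \<epsilon> * (\<Sum>l\<in>UNIV. real (2*m+1) * z $ l ^ (2 * m) * axis j 1 $ l) = 0"
        using z False by (auto simp: Z_def face_witness_def)
      also have "(\<Sum>l\<in>UNIV. real (2*m+1) * z $ l ^ (2 * m) * axis j 1 $ l)
          = (\<Sum>l\<in>UNIV. if l = j then real (2*m+1) * z $ j ^ (2 * m) else 0)"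
        by (rule sum.cong) (auto simp: axis_def)
      also have "\<dots> = real (2*m+1) * z $ j ^ (2 * m)" by simp
      finally have "(\<epsilon> * real (2 * m + 1)) * z $ j ^ (2 * m) = - g j z" by (simp add: algebra_simps)
      moreover have "\<epsilon> * real (2 * m + 1) \<noteq> 0" using \<epsilon> by simp
      ultimately have "z $ j ^ (2 * m) = - g j z / (\<epsilon> * real (2 * m + 1))"
        by (metis nonzero_mult_div_cancel_left)
      then show "z $ j ^ (2 * m) = (-1 / (\<epsilon> * real (2 * m + 1))) * g j z" by simp
    next
      fix j
      show "total_deg_le (2 * m - 1) (\<lambda>x. (-1 / (\<epsilon> * real (2 * m + 1))) * g j x)"
        by (intro total_deg_le_scale g)
    qed (use m in \<open>auto simp: Z_def\<close>)
    then show ?thesis using power_mono[of "2*m" "2*m+1" "card J"] by auto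
  qed
qed

text \<open>Each split cell is recovered from J, from A and from a witness point, by rounding down
  the coordinates of the point and correcting those in A. There are 2 ^ card (- J) choices of A,
  (N + 1) ^ card (- J) coordinate planes for J, and at most (2 * m + 1) ^ card J witnesses on each plane.
  The binomial theorem adds this up over the nonempty J; the empty set contributes the summand on the
  left.\<close>

lemma card_split_cells_le:
  fixes p :: "real^'n \<Rightarrow> real"
  assumes p: "total_deg_le m p" and m: "m > 0" and \<epsilon>: "\<epsilon> > 0"
    and vert: "\<And>v. perturbed_square \<epsilon> m p (\<chi> l. real (v l)) \<noteq> t"
  defines "F \<equiv> perturbed_square \<epsilon> m p"
  shows "card {i \<in> PiE UNIV (\<lambda>_. {..<N}). splits_at t F (lattice_face UNIV i)} + (2 * (N + 1)) ^ CARD('n)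
    \<le> (2 * (N + 1) + (2 * m + 1)) ^ CARD('n)"
proof -
  define W where "W = (\<lambda>J. {x. (\<exists>v\<in>PiE (- J) (\<lambda>_. {..N}). \<forall>l. l \<notin> J \<longrightarrow> x $ l = real (v l)) \<and> face_witness F t J x})"
  define g where "g = (\<lambda>(A::'n set) (x::real^'n) l. nat \<lfloor>x $ l\<rfloor> - of_bool (l \<in> A))"
  define C where "C = {i \<in> PiE UNIV (\<lambda>_. {..<N}). splits_at t F (lattice_face UNIV i)}"
  have W: "finite (W J) \<and> card (W J) \<le> (N + 1) ^ card (- J) * (2 * m + 1) ^ card J" for J
  proof -
    define Z where "Z = (\<lambda>v. {x. (\<forall>l. l \<notin> J \<longrightarrow> x $ l = real (v l)) \<and> face_witness F t J x})"
    have Z: "finite (Z v) \<and> card (Z v) \<le> (2 * m + 1) ^ card J" for v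
      unfolding Z_def F_def by (rule card_witnesses_plane[OF p m \<epsilon>])
    have WZ: "W J = (\<Union>v\<in>PiE (- J) (\<lambda>_. {..N}). Z v)" by (auto simp: W_def Z_def)
    have fin: "finite (PiE (- J) (\<lambda>_. {..N}))" by (intro finite_PiE) auto
    have "card (W J) \<le> (\<Sum>v\<in>PiE (- J) (\<lambda>_. {..N}). card (Z v))"
      unfolding WZ by (rule card_UN_le[OF fin])
    also have "\<dots> \<le> of_nat (card (PiE (- J) (\<lambda>_. {..N}))) * (2 * m + 1) ^ card J"
      by (rule sum_bounded_above) (use Z in auto)
    finally show ?thesis using Z fin by (auto simp: WZ card_PiE)
  qed
  have cover: "C \<subseteq> (\<Union>J\<in>Pow UNIV - {{}}. \<Union>A\<in>Pow (- J). g A ` W J)"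
  proof
    fix i assume i: "i \<in> C"
    have cont: "continuous_on UNIV F"
      unfolding F_def perturbed_square_def
      by (intro continuous_intros total_deg_le_continuous[OF p])
    have "splits_at t F (lattice_face UNIV i)" using i by (simp add: C_def)
    from split_face_has_witness[OF cont vert[folded F_def] this]
    obtain J A x where x: "J \<noteq> {}" "A \<subseteq> - J" "face_witness F t J x"
      "\<forall>l. l \<notin> J \<longrightarrow> x $ l = real (i l + of_bool (l \<in> A))"
      "\<forall>j\<in>J. real (i j) < x $ j \<and> x $ j < real (i j) + 1"
      by (elim exE conjE)
    have "i l < N" for l using i by (auto simp: C_def)
    then have "i l + of_bool (l \<in> A) \<le> N" for l by (simp add: Suc_le_eq less_imp_le)
    then have "(\<lambda>l\<in>-J. i l + of_bool (l \<in> A)) \<in> PiE (- J) (\<lambda>_. {..N})" by auto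
    then have "x \<in> W J" using x(3,4) unfolding W_def by (auto intro!: bexI[of _ "\<lambda>l\<in>-J. i l + of_bool (l \<in> A)"])
    moreover have "i = g A x"
    proof
      fix l
      show "i l = g A x l"
      proof (cases "l \<in> J")
        case True
        then have "\<lfloor>x $ l\<rfloor> = int (i l)" using x(5) by (intro floor_unique) auto
        then show ?thesis using True x(2) by (auto simp: g_def)
      next
        case False
        then have "\<lfloor>x $ l\<rfloor> = int (i l + of_bool (l \<in> A))" using x(4)[rule_format, of l] by (metis floor_of_nat)
        then have "nat \<lfloor>x $ l\<rfloor> = i l + of_bool (l \<in> A)" by (simp only: nat_int)
        then show ?thesis by (simp add: g_def)
      qed
    qed
    ultimately show "i \<in> (\<Union>J\<in>Pow UNIV - {{}}. \<Union>A\<in>Pow (- J). g A ` W J)" using x(1,2) by blast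
  qed
  have "card C \<le> card (\<Union>J\<in>Pow UNIV - {{}}. \<Union>A\<in>Pow (- J). g A ` W J)"
    using W by (intro card_mono[OF _ cover]) auto
  also have "\<dots> \<le> (\<Sum>J\<in>Pow UNIV - {{}}. card (\<Union>A\<in>Pow (- J). g A ` W J))"
    by (rule card_UN_le) simp
  also have "\<dots> \<le> (\<Sum>J\<in>Pow (UNIV::'n set) - {{}}. (2 * m + 1) ^ card J * (2 * (N + 1)) ^ card (- J))"
  proof (rule sum_mono)
    fix J :: "'n set"
    have "card (\<Union>A\<in>Pow (- J). g A ` W J) \<le> (\<Sum>A\<in>Pow (- J). card (g A ` W J))"
      by (rule card_UN_le) simp
    also have "\<dots> \<le> of_nat (card (Pow (- J))) * ((N + 1) ^ card (- J) * (2 * m + 1) ^ card J)"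
      by (rule sum_bounded_above) (meson W card_image_le order_trans)
    also have "\<dots> = (2 * m + 1) ^ card J * (2 * (N + 1)) ^ card (- J)"
      unfolding power_mult_distrib of_nat_id card_Pow[OF finite] by (simp only: mult_ac)
    finally show "card (\<Union>A\<in>Pow (- J). g A ` W J) \<le> (2 * m + 1) ^ card J * (2 * (N + 1)) ^ card (- J)" .
  qed
  finally have "card C + (2 * (N + 1)) ^ CARD('n)
      \<le> (2 * (N + 1)) ^ CARD('n) + (\<Sum>J\<in>Pow (UNIV::'n set) - {{}}. (2 * m + 1) ^ card J * (2 * (N + 1)) ^ card (- J))"
    by simp
  also have "\<dots> = (\<Sum>J\<in>Pow (UNIV::'n set). (2 * m + 1) ^ card J * (2 * (N + 1)) ^ card (- J))"
    by (subst (2) sum.remove[of _ "{}"]) auto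
  also have "\<dots> = (\<Prod>x\<in>(UNIV::'n set). (2 * m + 1) + 2 * (N + 1))"
    by (subst prod_add) (simp_all add: Compl_eq_Diff_UNIV)
  also have "\<dots> = (2 * (N + 1) + (2 * m + 1)) ^ CARD('n)" by (simp add: add.commute)
  finally show ?thesis by (simp add: C_def)
qed

section \<open>A norming inequality for scattered points\<close>

lemma prod_abs_diff_nat:
  assumes "i \<le> m"
  shows "(\<Prod>j\<in>{..m}-{i}. \<bar>real i - real j\<bar>) = fact i * fact (m - i)"
proof -
  have split: "{..m} - {i} = {0..<i} \<union> {i+1..m}" using assms by auto
  have "(\<Prod>j\<in>{0..<i}. \<bar>real i - real j\<bar>) = (\<Prod>j\<in>{0..<i}. real (i - j))"
    by (rule prod.cong) auto
  also have "\<dots> = fact i" by (subst fact_prod_rev) simp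
  finally have 1: "(\<Prod>j\<in>{0..<i}. \<bar>real i - real j\<bar>) = fact i" .
  have "(\<Prod>j\<in>{i+1..m}. \<bar>real i - real j\<bar>) = (\<Prod>l\<in>{1..m-i}. real l)"
    using assms by (intro prod.reindex_bij_witness[of _ "\<lambda>l. l + i" "\<lambda>j. j - i"]) auto
  also have "\<dots> = fact (m - i)" by (simp add: fact_prod)
  finally have 2: "(\<Prod>j\<in>{i+1..m}. \<bar>real i - real j\<bar>) = fact (m - i)" .
  show ?thesis unfolding split by (subst prod.union_disjoint) (auto simp: 1[simplified] 2[simplified])
qed

text \<open>Lagrange interpolation at m + 1 nodes that are at least as separated as consecutive integers. The denominators
  are at least i! (m - i)!, and the reciprocals of these products add up to 2^m / m!.\<close>

lemma poly_bound_from_separated_nodes: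
  fixes q :: "real poly" and x :: "nat \<Rightarrow> real"
  assumes deg: "degree q \<le> m"
    and sep: "\<And>i j. i < j \<Longrightarrow> j \<le> m \<Longrightarrow> x j - x i \<ge> real j - real i"
    and range: "\<And>i. i \<le> m \<Longrightarrow> 0 \<le> x i \<and> x i \<le> R"
    and bound: "\<And>i. i \<le> m \<Longrightarrow> \<bar>poly q (x i)\<bar> \<le> M"
    and t: "0 \<le> t" "t \<le> R"
  shows "\<bar>poly q t\<bar> \<le> M * ((2 * R) ^ m / fact m)"
proof -
  define lag where "lag = (\<lambda>i. \<Prod>j\<in>{..m}-{i}. smult (1 / (x i - x j)) [:- x j, 1:])"
  have sep': "\<bar>x i - x j\<bar> \<ge> \<bar>real i - real j\<bar>" if "i \<le> m" "j \<le> m" for i j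
    using sep[of i j] sep[of j i] that by (cases i j rule: linorder_cases) auto
  have ne: "x i \<noteq> x j" if "i \<le> m" "j \<le> m" "i \<noteq> j" for i j
    using sep'[OF that(1,2)] that(3) by auto
  have inj: "inj_on x {..m}" using ne by (auto simp: inj_on_def)
  have lag_eval: "poly (lag i) (x k) = of_bool (i = k)" if "i \<le> m" "k \<le> m" for i k
  proof (cases "i = k")
    case True
    have "poly (lag i) (x k) = (\<Prod>j\<in>{..m}-{i}. 1)"
      unfolding lag_def poly_prod
    proof (intro prod.cong refl)
      fix j assume "j \<in> {..m} - {i}"
      then have "x i - x j \<noteq> 0" using ne that True by auto
      then show "poly (smult (1 / (x i - x j)) [:- x j, 1:]) (x k) = 1"
        using True by (simp flip: diff_divide_distrib)
    qed
    then show ?thesis using True by simp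
  next
    case False
    then have "poly (lag i) (x k) = 0"
      unfolding lag_def poly_prod using that by (intro prod_zero) auto
    then show ?thesis using False by simp
  qed
  have lag_deg: "degree (lag i) \<le> m" if "i \<le> m" for i
  proof -
    have "degree (lag i) \<le> (\<Sum>j\<in>{..m}-{i}. degree (smult (1 / (x i - x j)) [:- x j, 1:]))"
      unfolding lag_def by (rule degree_prod_sum_le[unfolded o_def]) simp
    also have "\<dots> \<le> (\<Sum>j\<in>{..m}-{i}. 1)" by (rule sum_mono) auto
    also have "\<dots> = m" using that by simp
    finally show ?thesis .
  qed
  have "q = (\<Sum>i\<le>m. smult (poly q (x i)) (lag i))"
  proof (rule poly_eqI_degree[of "x ` {..m}"])
    fix y assume "y \<in> x ` {..m}"
    then obtain k where k: "k \<le> m" "y = x k" by auto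
    have "poly (\<Sum>i\<le>m. smult (poly q (x i)) (lag i)) y = (\<Sum>i\<le>m. if i = k then poly q (x k) else 0)"
      unfolding poly_sum using k by (intro sum.cong) (auto simp: lag_eval)
    then show "poly q y = poly (\<Sum>i\<le>m. smult (poly q (x i)) (lag i)) y" using k by simp
  next
    have c: "card (x ` {..m}) = Suc m" using card_image[OF inj] by simp
    then show "degree q < card (x ` {..m})" using deg by simp
    have "degree (\<Sum>i\<le>m. smult (poly q (x i)) (lag i)) \<le> m"
      by (rule degree_sum_le) (auto intro!: order_trans[OF degree_smult_le lag_deg] simp del: degree_smult_eq)
    then show "degree (\<Sum>i\<le>m. smult (poly q (x i)) (lag i)) < card (x ` {..m})" using c by simp
  qed
  then have "poly q t = (\<Sum>i\<le>m. poly q (x i) * poly (lag i) t)"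
    by (metis (no_types, lifting) poly_smult poly_sum sum.cong)
  then have "\<bar>poly q t\<bar> \<le> (\<Sum>i\<le>m. \<bar>poly q (x i)\<bar> * \<bar>poly (lag i) t\<bar>)"
    by (simp add: sum_abs flip: abs_mult)
  also have "\<dots> \<le> (\<Sum>i\<le>m. M * (R ^ m / (fact i * fact (m - i))))"
  proof (intro sum_mono mult_mono bound)
    fix i assume i: "i \<in> {..m}"
    have pos: "(\<Prod>j\<in>{..m}-{i}. \<bar>real i - real j\<bar>) > 0" by (intro prod_pos) auto
    have "\<bar>poly (lag i) t\<bar> = (\<Prod>j\<in>{..m}-{i}. \<bar>t - x j\<bar>) / (\<Prod>j\<in>{..m}-{i}. \<bar>x i - x j\<bar>)"
      by (simp add: lag_def poly_prod abs_prod flip: prod_dividef) (intro prod.cong refl, simp flip: diff_divide_distrib)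
    also have "\<dots> \<le> R ^ m / (\<Prod>j\<in>{..m}-{i}. \<bar>real i - real j\<bar>)"
    proof (intro frac_le pos prod_mono)
      have "(\<Prod>j\<in>{..m}-{i}. \<bar>t - x j\<bar>) \<le> (\<Prod>j\<in>{..m}-{i}. R)"
      proof (intro prod_mono conjI)
        fix j assume "j \<in> {..m} - {i}"
        then show "\<bar>t - x j\<bar> \<le> R" using range[of j] t by (auto simp: abs_le_iff)
      qed simp
      also have "\<dots> = R ^ m" using i by simp
      finally show "(\<Prod>j\<in>{..m}-{i}. \<bar>t - x j\<bar>) \<le> R ^ m" .
    qed (use t i sep' in auto)
    also have "\<dots> = R ^ m / (fact i * fact (m - i))" using i by (subst prod_abs_diff_nat) auto
    finally show "\<bar>poly (lag i) t\<bar> \<le> R ^ m / (fact i * fact (m - i))" .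
  qed (use bound[of 0] in auto)
  also have "\<dots> = M * (R ^ m / fact m * (\<Sum>i\<le>m. real (m choose i)))"
    by (simp add: sum_distrib_left binomial_fact)
  also have "(\<Sum>i\<le>m. real (m choose i)) = 2 ^ m"
    using choose_row_sum[of m] by (simp flip: of_nat_sum)
  finally show ?thesis by (simp add: power_mult_distrib mult_ac)
qed

lemma enumerate_spaced:
  fixes S :: "nat set"
  assumes "finite S" "i \<le> j" "j < card S"
  shows "enumerate S i + (j - i) \<le> enumerate S j"
  using assms(2,3)
proof (induction j)
  case (Suc j)
  have less: "enumerate S j < enumerate S (Suc j)"
    using finite_enumerate_mono[of j "Suc j" S] assms(1) Suc.prems by blast
  show ?case
  proof (cases "i = Suc j")
    case False
    then have "enumerate S i + (j - i) \<le> enumerate S j" using Suc by simp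
    then show ?thesis using less False Suc.prems by linarith
  qed simp
qed simp

text \<open>A Fubini-type argument. On a line of cells, m + 1 cells with the bound suffice to extend it,
  with a factor from Lagrange interpolation, to the whole line. Hence a line with a
  bad cell after the extension had at least N - m bad cells among its N cells before, and each coordinate
  direction enlarges the proportion of bad cells by at most N / (N - m). After all n directions a cell
  is either bad together with all others or good together with all others.\<close>

lemma bound_from_many_cells:
  fixes p :: "real^'n \<Rightarrow> real"
  assumes p: "total_deg_le m p"
    and few: "card {i \<in> PiE UNIV (\<lambda>_. {..<N}). \<exists>x\<in>lattice_face UNIV i. \<bar>p x\<bar> > M} < (N - m) ^ CARD('n)"
    and x: "\<And>l. 0 \<le> x $ l \<and> x $ l \<le> real N"
  shows "\<bar>p x\<bar> \<le> M * ((2 * real N) ^ m / fact m) ^ CARD('n)"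
proof -
  define I where "I = (PiE UNIV (\<lambda>_. {..<N}) :: ('n \<Rightarrow> nat) set)"
  define L where "L = (2 * real N) ^ m / fact m"
  define good where "good = (\<lambda>J i. \<forall>x. (\<forall>l. 0 \<le> x $ l \<and> x $ l \<le> real N) \<and>
     (\<forall>l. l \<notin> J \<longrightarrow> real (i l) \<le> x $ l \<and> x $ l \<le> real (i l) + 1) \<longrightarrow> \<bar>p x\<bar> \<le> M * L ^ card J)"
  define B where "B = (\<lambda>J. {i \<in> I. \<not> good J i})"
  have I: "finite I" "card I = N ^ CARD('n)" by (auto simp: I_def finite_PiE card_PiE)
  have finB: "finite (B J)" for J using I by (simp add: B_def)
  have step: "card (B (insert j J)) * (N - m) \<le> card (B J) * N" if "j \<notin> J" for j J
  proof -
    define S where "S = (\<lambda>i. {s \<in> {..<N}. good J (i(j := s))})"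
    have S: "card (S i) \<le> m" if "i \<in> B (insert j J)" for i
    proof (rule ccontr)
      assume "\<not> ?thesis"
      then have cS: "m < card (S i)" by simp
      have finS: "finite (S i)" by (simp add: S_def)
      have "good (insert j J) i" unfolding good_def
      proof (intro allI impI)
        fix x :: "real^'n"
        assume x: "(\<forall>l. 0 \<le> x $ l \<and> x $ l \<le> real N) \<and>
          (\<forall>l. l \<notin> insert j J \<longrightarrow> real (i l) \<le> x $ l \<and> x $ l \<le> real (i l) + 1)"
        obtain q where q: "degree q \<le> m" "\<And>t. p (\<chi> k. if k = j then t else x $ k) = poly q t"
          using total_deg_le_line_poly[OF p] by blast
        have "\<bar>poly q (x $ j)\<bar> \<le> M * L ^ card J * ((2 * real N) ^ m / fact m)"
        proof (rule poly_bound_from_separated_nodes[OF q(1), where x="\<lambda>l. real (enumerate (S i) l)"])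
          fix l k assume "l < k" "k \<le> m"
          then show "real (enumerate (S i) k) - real (enumerate (S i) l) \<ge> real k - real l"
            using enumerate_spaced[OF finS, of l k] cS by linarith
        next
          fix l assume "l \<le> m"
          then have mem: "enumerate (S i) l \<in> S i" using finite_enumerate_in_set[OF finS] cS by auto
          then show "0 \<le> real (enumerate (S i) l) \<and> real (enumerate (S i) l) \<le> real N"
            by (auto simp: S_def)
          have "good J (i(j := enumerate (S i) l))" "enumerate (S i) l < N" using mem by (auto simp: S_def)
          then show "\<bar>poly q (real (enumerate (S i) l))\<bar> \<le> M * L ^ card J"
            unfolding q(2)[symmetric] good_def using x by auto
        qed (use x in auto)
        moreover have "(\<chi> k. if k = j then x $ j else x $ k) = x" by (simp add: vec_eq_iff)
        ultimately show "\<bar>p x\<bar> \<le> M * L ^ card (insert j J)"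
          using q(2)[of "x $ j"] \<open>j \<notin> J\<close> by (simp add: L_def mult_ac)
      qed
      then show False using that by (simp add: B_def)
    qed
    define P where "P = (SIGMA i:B (insert j J). {..<N} - S i)"
    have "card (B (insert j J)) * (N - m) = (\<Sum>i\<in>B (insert j J). N - m)" by simp
    also have "\<dots> \<le> (\<Sum>i\<in>B (insert j J). card ({..<N} - S i))"
    proof (rule sum_mono)
      fix i assume i: "i \<in> B (insert j J)"
      have "card ({..<N} - S i) = N - card (S i)"
        by (subst card_Diff_subset) (auto simp: S_def)
      then show "N - m \<le> card ({..<N} - S i)" using S[OF i] by simp
    qed
    also have "\<dots> = card P" unfolding P_def using finB by simp
    also have "\<dots> \<le> card (B J \<times> {..<N})"
    proof (rule card_inj_on_le[where f = "\<lambda>(i, s). (i(j := s), i j)"])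
      show "inj_on (\<lambda>(i, s). (i(j := s), i j)) P"
      proof (rule inj_onI, clarify)
        fix i s i' s' assume eq: "i(j := s) = i'(j := s')" "i j = i' j"
        have "i k = i' k" for k using fun_cong[OF eq(1), of k] eq(2) by (cases "k = j") auto
        moreover have "s = s'" using fun_cong[OF eq(1), of j] by simp
        ultimately show "i = i' \<and> s = s'" by auto
      qed
      show "(\<lambda>(i, s). (i(j := s), i j)) ` P \<subseteq> B J \<times> {..<N}"
        by (auto simp: P_def B_def S_def I_def PiE_def Pi_def)
    qed (use finB in auto)
    finally show ?thesis by (simp add: card_cartesian_product)
  qed
  have iter: "card (B J) * (N - m) ^ card J \<le> card (B {}) * N ^ card J" for J
  proof (induction J rule: finite_induct[OF finite])
    case (2 j J)
    have "card (B (insert j J)) * (N - m) ^ card (insert j J) = (card (B (insert j J)) * (N - m)) * (N - m) ^ card J"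
      using 2 by simp
    also have "\<dots> \<le> (card (B J) * N) * (N - m) ^ card J"
      using step[OF 2(2)] by (rule mult_right_mono) simp
    also have "\<dots> \<le> (card (B {}) * N ^ card J) * N"
      using 2(3) by (simp add: mult_ac mult_le_mono)
    finally show ?case using 2 by (simp add: mult_ac)
  qed simp
  have "B {} \<subseteq> {i \<in> I. \<exists>x\<in>lattice_face UNIV i. \<bar>p x\<bar> > M}"
    by (fastforce simp: B_def good_def mem_lattice_face not_le)
  then have "card (B {}) \<le> card {i \<in> I. \<exists>x\<in>lattice_face UNIV i. \<bar>p x\<bar> > M}"
    using I by (intro card_mono) auto
  then have B0: "card (B {}) < (N - m) ^ CARD('n)" using few by (simp add: I_def)
  have pos: "N - m > 0" using B0 by (metis bot_nat_0.not_eq_extremum not_less_zero zero_less_card_finite zero_power)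
  have "card (B UNIV) * (N - m) ^ CARD('n) < (N - m) ^ CARD('n) * N ^ CARD('n)"
    using iter[of UNIV] B0 pos by (meson le_less_trans mult_strict_right_mono zero_less_power diff_le_self less_le_trans)
  then have "card (B UNIV) < card I" using I(2) by (simp add: mult.commute)
  then have "B UNIV \<noteq> I" by auto
  then obtain i where "good UNIV i" by (auto simp: B_def)
  then show ?thesis using x by (simp add: good_def L_def)
qed

lemma total_deg_le_0_const: "total_deg_le d f \<Longrightarrow> d = 0 \<Longrightarrow> \<exists>c. f = (\<lambda>_. c)"
proof (induction rule: total_deg_le.induct)
  case (add d f g)
  then obtain a b where "f = (\<lambda>_. a)" "g = (\<lambda>_. b)" by auto
  then show ?case by auto
qed auto

text \<open>The proofs below use that gam n is an integer, is at least 2 * n, and grows fast enough to absorb the number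
  of split cells.\<close>

lemma gam_bounds:
  shows gam_nat: "\<exists>G. gam n = real G"
    and gam_ge_2n: "n \<ge> 1 \<Longrightarrow> gam n \<ge> 2 * real n"
    and gam_exponential: "n \<ge> 2 \<Longrightarrow> real n * 3 ^ n + 1 < 2 * gam n"
proof -
  show "\<exists>G. gam n = real G"
  proof (induction n rule: gam.induct)
    case (3 k)
    then obtain G where "gam (Suc k) = real G" by blast
    then show ?case by (intro exI[of _ "2 * Suc (Suc k) * (1 + G)"]) (simp add: algebra_simps)
  qed (auto intro: exI[of _ 0] exI[of _ 2])
  show ge: "n \<ge> 1 \<Longrightarrow> gam n \<ge> 2 * real n" for n
  proof (induction n rule: gam.induct)
    case (3 k)
    then have "gam (Suc k) \<ge> 0" by simp
    then have "2 * real (Suc (Suc k)) * 1 \<le> 2 * real (Suc (Suc k)) * (1 + gam (Suc k))"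
      by (intro mult_left_mono) auto
    then show ?case by simp
  qed auto
  show "real n * 3 ^ n + 1 < 2 * gam n" if "n \<ge> 2"
    using that
  proof (induction n rule: dec_induct)
    case base
    then show ?case by (simp add: numeral_2_eq_2)
  next
    case (step n)
    define A where "A = real n * 3 ^ n"
    have n: "real n \<ge> 2" using step by simp
    have A: "A \<ge> 0" by (simp add: A_def)
    have "real (Suc n) * 3 ^ Suc n + 1 = 3 * A + 3 * 3 ^ n + 1" by (simp add: A_def algebra_simps)
    also have "3 * 3 ^ n \<le> 2 * A"
    proof -
      have "3 * 3 ^ n \<le> 2 * real n * (3::real) ^ n" using n by (intro mult_right_mono) auto
      then show ?thesis by (simp add: A_def)
    qed
    also have "3 * A + 2 * A + 1 < 6 * (2 * gam n)" using step.IH A unfolding A_def[symmetric] by simp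
    also have "\<dots> \<le> 2 * gam (Suc n)"
    proof -
      obtain k where k: "n = Suc k" using step by (cases n) auto
      have "3 * (1 + gam n) \<le> real (Suc n) * (1 + gam n)" using n ge[of n] step by (intro mult_right_mono) auto
      then show ?thesis by (simp add: k algebra_simps)
    qed
    finally show ?case by simp
  qed
qed

text \<open>The difference of the two powers is estimated by its derivative, n times the increment times the
  power n - 1; both bases are at most 3 * (N - m), which accounts for the factor 3 ^ n.\<close>

lemma split_count_less:
  assumes n: "n \<ge> 2" and G: "real n * 3 ^ n + 1 < 2 * real G" and N: "2 * G * m \<le> N" and m: "m > 0"
    and c: "c + (2 * (N + 1)) ^ n \<le> (2 * (N + 1) + (2 * m + 1)) ^ n"
  shows "c < (N - m) ^ n"
proof -
  have G8: "2 * G \<ge> 18"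
  proof -
    have "2 * 3 ^ 2 \<le> real n * 3 ^ n" using n by (intro mult_mono power_increasing) auto
    then have "18 < 2 * real G" using G by simp
    then show ?thesis by linarith
  qed
  have mN: "18 * m \<le> N" using order_trans[OF mult_le_mono1[OF G8, of m] N] .
  define M where "M = real N - real m"
  have M: "real (N - m) = M" using mN by (simp add: M_def)
  have M7: "7 * real m \<le> M" using mN by (simp add: M_def)
  have MG: "real n * 3 ^ n * real m < M"
  proof -
    have "(real n * 3 ^ n + 1) * real m < 2 * real G * real m" using G m by (intro mult_strict_right_mono) auto
    also have "\<dots> = real (2 * G * m)" by simp
    also have "\<dots> \<le> real N" using N by (simp only: of_nat_le_iff)
    finally show ?thesis by (simp add: M_def algebra_simps)
  qed
  define a b where "a = 2 * (real N + 1)" and "b = 2 * real m + 1"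
  have ab: "a + b \<le> 3 * M" "b \<le> 3 * real m" "a \<ge> 0" "b \<ge> 0" "M \<ge> 0"
    using m M7 by (auto simp: a_def b_def M_def)
  have "real (c + (2 * (N + 1)) ^ n) \<le> real ((2 * (N + 1) + (2 * m + 1)) ^ n)" using c by (simp only: of_nat_le_iff)
  then have "real c \<le> (a + b) ^ n - a ^ n" by (simp add: a_def b_def algebra_simps)
  also have "(a + b) ^ n - a ^ n = b * (\<Sum>i<n. (a + b) ^ i * a ^ (n - Suc i))"
    using power_diff_sumr2[of "a + b" n a] by (simp add: mult.commute)
  also have "\<dots> \<le> b * (\<Sum>i<n. (a + b) ^ (n - 1))"
  proof (intro mult_left_mono sum_mono ab)
    fix i assume i: "i \<in> {..<n}"
    have "(a + b) ^ i * a ^ (n - Suc i) \<le> (a + b) ^ i * (a + b) ^ (n - Suc i)"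
      using ab by (intro mult_left_mono power_mono) auto
    also have "\<dots> = (a + b) ^ (n - 1)" using i by (simp flip: power_add)
    finally show "(a + b) ^ i * a ^ (n - Suc i) \<le> (a + b) ^ (n - 1)" .
  qed
  also have "\<dots> = b * real n * (a + b) ^ (n - 1)" by simp
  also have "\<dots> \<le> 3 * real m * real n * (3 * M) ^ (n - 1)"
    using ab by (intro mult_mono power_mono) auto
  also have "\<dots> = (real n * 3 ^ n * real m) * M ^ (n - 1)"
    using n by (cases n) (auto simp: power_mult_distrib)
  also have "\<dots> < M * M ^ (n - 1)" using MG M7 m by (intro mult_strict_right_mono zero_less_power) auto
  also have "\<dots> = real ((N - m) ^ n)" using n M by (cases n) auto
  finally show ?thesis by (simp only: of_nat_less_iff)
qed

text \<open>In one variable every second cell supplies a node, and Lagrange interpolation is enough. In more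
  variables, for m > 0, the cells that are not split lie below the level t < 2 of the perturbed square, so
  the polynomial is at most 2 on them, and all but fewer than (N - m)^n cells are of this kind.\<close>

lemma norming_grid:
  fixes p :: "real^'n \<Rightarrow> real"
  assumes p: "total_deg_le m p"
    and G: "gam CARD('n) = real G" and N: "2 * G * m \<le> N" "N > 0"
    and samples: "\<And>i. (\<And>l. i l < N) \<Longrightarrow> \<exists>x\<in>lattice_face UNIV i. \<bar>p x\<bar> \<le> 1"
    and x: "\<And>l. 0 \<le> x $ l \<and> x $ l \<le> real N"
  shows "\<bar>p x\<bar> \<le> 2 * ((2 * real N) ^ m / fact m) ^ CARD('n)"
proof -
  consider "m = 0" | "m > 0" "CARD('n) = 1" | "m > 0" "CARD('n) \<ge> 2"
    using zero_less_card_finite[where 'a='n] by linarith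
  then show ?thesis
  proof cases
    case 1
    then obtain c where c: "p = (\<lambda>_. c)" using total_deg_le_0_const p by blast
    obtain y where "\<bar>p y\<bar> \<le> 1" using samples[of "\<lambda>_. 0"] N by auto
    then show ?thesis using 1 c by simp
  next
    case 2
    then obtain j where j: "(UNIV :: 'n set) = {j}" by (auto simp: card_1_singleton_iff)
    then have only: "l = j" for l :: 'n by auto
    obtain q where q: "degree q \<le> m" "\<And>t. p (\<chi> k. if k = j then t else x $ k) = poly q t"
      using total_deg_le_line_poly[OF p] by blast
    have pq: "p y = poly q (y $ j)" for y
      unfolding q(2)[symmetric] by (rule arg_cong[of _ _ p]) (metis (mono_tags, lifting) only vec_eq_iff vec_lambda_beta)
    have "G = 2" using G 2 by simp
    then have N4: "4 * m \<le> N" using N by simp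
    have "\<exists>y. real (2 * i) \<le> y \<and> y \<le> real (2 * i) + 1 \<and> \<bar>poly q y\<bar> \<le> 1" if "i \<le> m" for i
    proof -
      have "2 * i < N" using that 2 N4 by linarith
      then obtain y where "y \<in> lattice_face UNIV (\<lambda>_. 2 * i)" "\<bar>p y\<bar> \<le> 1" using samples[of "\<lambda>_. 2 * i"] by auto
      then show ?thesis by (intro exI[of _ "y $ j"]) (auto simp: mem_lattice_face pq)
    qed
    then obtain y where y: "\<And>i. i \<le> m \<Longrightarrow> real (2 * i) \<le> y i \<and> y i \<le> real (2 * i) + 1 \<and> \<bar>poly q (y i)\<bar> \<le> 1"
      by metis
    have "\<bar>poly q (x $ j)\<bar> \<le> 1 * ((2 * real N) ^ m / fact m)"
    proof (rule poly_bound_from_separated_nodes[OF q(1), where x=y])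
      fix i k assume "i < k" "k \<le> m"
      then show "y k - y i \<ge> real k - real i" using y[of i] y[of k] by auto
    next
      fix i assume "i \<le> m"
      then show "0 \<le> y i \<and> y i \<le> real N" using y[of i] N4 2 by auto
    qed (use y x in auto)
    also have "\<dots> \<le> 2 * ((2 * real N) ^ m / fact m)" by (intro mult_right_mono) auto
    finally show ?thesis using 2 pq by simp
  next
    case 3
    define n where "n = CARD('n)"
    define D where "D = 2 * m + 1"
    \<comment> \<open>The perturbation stays below 1/2 on the cube, so the samples have value at most 3/2.\<close>
    define \<epsilon> where "\<epsilon> = 1 / (2 * (real n * real N ^ D))"
    have \<epsilon>: "\<epsilon> > 0" using N by (simp add: \<epsilon>_def n_def)
    define F where "F = perturbed_square \<epsilon> m p"
    have F: "F y \<le> p y ^ 2 + 1 / 2 \<and> F y \<ge> p y ^ 2" if "\<And>l. 0 \<le> y $ l \<and> y $ l \<le> real N" for y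
    proof -
      have "(\<Sum>l\<in>UNIV. y $ l ^ D) \<le> (\<Sum>l\<in>(UNIV::'n set). real N ^ D)"
        using that by (intro sum_mono power_mono) auto
      then have "\<epsilon> * (\<Sum>l\<in>UNIV. y $ l ^ D) \<le> \<epsilon> * (real n * real N ^ D)"
        using \<epsilon> by (intro mult_left_mono) (auto simp: n_def)
      also have "\<dots> = 1 / 2" using N by (simp add: \<epsilon>_def n_def)
      finally have "\<epsilon> * (\<Sum>l\<in>UNIV. y $ l ^ D) \<le> 1 / 2" .
      moreover have "\<epsilon> * (\<Sum>l\<in>UNIV. y $ l ^ D) \<ge> 0"
        using \<epsilon> that by (intro mult_nonneg_nonneg sum_nonneg) auto
      ultimately show ?thesis by (simp add: F_def perturbed_square_def D_def)
    qed
    \<comment> \<open>A level that avoids all lattice points, so that edge witnesses are interior to their edges.\<close>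
    have "countable (range (\<lambda>v::'n \<Rightarrow> nat. F (\<chi> l. real (v l))))" by simp
    moreover have "uncountable {3/2<..<2::real}" by (simp add: uncountable_open_interval)
    ultimately have "\<not> {3/2<..<2} \<subseteq> range (\<lambda>v::'n \<Rightarrow> nat. F (\<chi> l. real (v l)))"
      using countable_subset by blast
    then obtain t where t: "3/2 < t" "t < 2" "\<And>v::'n \<Rightarrow> nat. F (\<chi> l. real (v l)) \<noteq> t"
      by (metis greaterThanLessThan_iff rangeI subsetI)
    define C where "C = {i \<in> PiE (UNIV::'n set) (\<lambda>_. {..<N}). splits_at t F (lattice_face UNIV i)}"
    have "card C + (2 * (N + 1)) ^ n \<le> (2 * (N + 1) + (2 * m + 1)) ^ n"
      unfolding C_def F_def n_def
      by (rule card_split_cells_le[OF p 3(1) \<epsilon>]) (use t F_def in auto)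
    then have C: "card C < (N - m) ^ n"
      using 3 N gam_exponential[of n] G by (intro split_count_less[of n G m N]) (auto simp: n_def)
    have "{i \<in> PiE UNIV (\<lambda>_. {..<N}). \<exists>y\<in>lattice_face UNIV i. \<bar>p y\<bar> > 2} \<subseteq> C"
    proof clarify
      fix i y assume i: "i \<in> PiE (UNIV::'n set) (\<lambda>_. {..<N})" and y: "y \<in> lattice_face UNIV i" "\<bar>p y\<bar> > 2"
      have iN: "i l < N" for l using i by auto
      have box: "0 \<le> z $ l \<and> z $ l \<le> real N" if "z \<in> lattice_face UNIV i" for z l
        using that iN[of l] unfolding mem_lattice_face by (auto dest!: spec[of _ l])
      obtain z where z: "z \<in> lattice_face UNIV i" "\<bar>p z\<bar> \<le> 1" using samples[of i] iN by blast
      have "p z ^ 2 \<le> 1" using z(2) by (simp add: abs_square_le_1)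
      then have "F z \<le> t" using F[OF box[OF z(1)]] t by linarith
      moreover have "2 ^ 2 < \<bar>p y\<bar> ^ 2" using y(2) by (intro power_strict_mono) auto
      then have "F y > t" using F[OF box[OF y(1)]] t by simp
      ultimately show "i \<in> C" using i y(1) z(1) by (auto simp: C_def splits_at_def)
    qed
    then have "card {i \<in> PiE (UNIV::'n set) (\<lambda>_. {..<N}). \<exists>y\<in>lattice_face UNIV i. \<bar>p y\<bar> > 2} \<le> card C"
      by (intro card_mono) (auto simp: C_def finite_PiE)
    then show ?thesis using C x by (intro bound_from_many_cells[OF p]) (auto simp: n_def)
  qed
qed

section \<open>Smooth bump functions\<close>

lemma power_div_fact_le_exp:
  fixes s :: real
  assumes "s \<ge> 0"
  shows "s ^ m / fact m \<le> exp s"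
proof -
  have "s ^ m /\<^sub>R fact m \<le> exp s"
    unfolding exp_def using assms
    by (intro order_trans[OF _ sum_le_suminf[OF summable_exp_generic, of "{m}"]]) auto
  then show ?thesis by (simp add: divide_inverse mult.commute)
qed

text \<open>The standard flat function exp (-1/t), divided by powers of t so that the family is closed under
  differentiation up to linear combinations.\<close>

definition flat_exp :: "nat \<Rightarrow> real \<Rightarrow> real" where
  "flat_exp m t = (if t \<le> 0 then 0 else exp (- 1 / t) / t ^ m)"

lemma flat_exp_nonneg: "flat_exp m t \<ge> 0"
  by (simp add: flat_exp_def)

lemma flat_exp_le: "flat_exp m t \<le> fact (m + 1) * \<bar>t\<bar>"
proof (cases "t \<le> 0")
  case False
  define s where "s = 1 / t"
  have s: "s > 0" using False by (simp add: s_def)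
  have "s ^ (m + 1) \<le> fact (m + 1) * exp s"
    using power_div_fact_le_exp[of s "m + 1"] s by (simp add: field_simps del: fact_Suc)
  then have "s ^ (m + 1) * (exp (- s) * t) \<le> fact (m + 1) * exp s * (exp (- s) * t)"
    using False by (intro mult_right_mono) auto
  also have "\<dots> = fact (m + 1) * t" by (simp add: exp_minus field_simps)
  also have "s ^ (m + 1) * (exp (- s) * t) = flat_exp m t"
    using False by (simp add: s_def flat_exp_def power_divide)
  finally show ?thesis using False by simp
next
  case True
  then have "flat_exp m t = 0" by (simp add: flat_exp_def)
  then show ?thesis by (simp only:) (intro mult_nonneg_nonneg, auto)
qed

lemma flat_exp_deriv:
  "(flat_exp m has_real_derivative (flat_exp (m + 2) t - real m * flat_exp (m + 1) t)) (at t)"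
proof -
  consider "t < 0" | "t = 0" | "t > 0" by linarith
  then show ?thesis
  proof cases
    case 1
    have "((\<lambda>_. 0) has_real_derivative (flat_exp (m + 2) t - real m * flat_exp (m + 1) t)) (at t)"
      using 1 by (simp add: flat_exp_def)
    then show ?thesis
      by (rule has_field_derivative_transform_within_open[of _ _ _ "{..<0}"]) (use 1 in \<open>auto simp: flat_exp_def\<close>)
  next
    case 3
    define E where "E = exp (- 1 / t)"
    have "((\<lambda>t. exp (- 1 / t) / t ^ m) has_real_derivative
        ((E * (1 / t\<^sup>2)) * t ^ m - E * (real m * t ^ (m - 1))) / (t ^ m * t ^ m)) (at t)"
      unfolding E_def using 3 by (auto intro!: derivative_eq_intros simp: power2_eq_square)
    moreover have "real m * t ^ (m - 1) = real m * t ^ m / t" using 3 by (cases m) auto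
    ultimately have "((\<lambda>t. exp (- 1 / t) / t ^ m) has_real_derivative
        ((E * (1 / t\<^sup>2)) * t ^ m - E * (real m * t ^ m / t)) / (t ^ m * t ^ m)) (at t)" by simp
    also have "((E * (1 / t\<^sup>2)) * t ^ m - E * (real m * t ^ m / t)) / (t ^ m * t ^ m)
        = flat_exp (m + 2) t - real m * flat_exp (m + 1) t"
      using 3 by (simp add: flat_exp_def E_def field_simps power_add power2_eq_square)
    finally have "((\<lambda>t. exp (- 1 / t) / t ^ m) has_real_derivative
        (flat_exp (m + 2) t - real m * flat_exp (m + 1) t)) (at t)" .
    then show ?thesis
      by (rule has_field_derivative_transform_within_open[of _ _ _ "{0<..}"]) (use 3 in \<open>auto simp: flat_exp_def\<close>)
  next
    case 2
    \<comment> \<open>The difference quotient at 0 is the next member of the family, which is at most linear.\<close>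
    have "((\<lambda>h. flat_exp m h / h) \<longlongrightarrow> 0) (at 0)"
    proof (rule Lim_null_comparison)
      have "norm (flat_exp m h / h) \<le> fact (m + 2) * \<bar>h\<bar>" for h
      proof -
        have "norm (flat_exp m h / h) = flat_exp (m + 1) h"
          by (simp add: flat_exp_def field_simps)
        then show ?thesis using flat_exp_le[of "m + 1" h] by simp
      qed
      then show "\<forall>\<^sub>F h in at 0. norm (flat_exp m h / h) \<le> fact (m + 2) * \<bar>h\<bar>" by simp
      show "((\<lambda>h. fact (m + 2) * \<bar>h\<bar>) \<longlongrightarrow> 0) (at (0::real))"
        by (auto intro!: tendsto_eq_intros)
    qed
    then show ?thesis using 2 by (simp add: has_field_derivative_iff flat_exp_def)
  qed
qed

text \<open>A class of functions that contains the bumps and is closed under directional derivatives; every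
  member is therefore of class C^k for all k.\<close>

inductive smooth_expr :: "(real^'n \<Rightarrow> complex) \<Rightarrow> bool" where
  const: "smooth_expr (\<lambda>x. c)"
| coord: "smooth_expr (\<lambda>x. of_real (x $ i))"
| add: "smooth_expr f \<Longrightarrow> smooth_expr g \<Longrightarrow> smooth_expr (\<lambda>x. f x + g x)"
| mult: "smooth_expr f \<Longrightarrow> smooth_expr g \<Longrightarrow> smooth_expr (\<lambda>x. f x * g x)"
| flat: "smooth_expr (\<lambda>x. of_real (flat_exp m (r\<^sup>2 - (x - z) \<bullet> (x - z))))"

lemma smooth_expr_sum: "(\<And>i. i \<in> I \<Longrightarrow> smooth_expr (f i)) \<Longrightarrow> smooth_expr (\<lambda>x. \<Sum>i\<in>I. f i x)"
  by (induction I rule: infinite_finite_induct) (auto intro: smooth_expr.intros)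

lemma smooth_expr_derivative:
  assumes "smooth_expr f"
  shows "\<exists>f'. (\<forall>x. (f has_derivative f' x) (at x)) \<and> (\<forall>v. smooth_expr (\<lambda>x. f' x v))"
  using assms
proof (induction rule: smooth_expr.induct)
  case (const c)
  show ?case by (intro exI[of _ "\<lambda>_ _. 0"]) (auto intro: smooth_expr.const)
next
  case (coord i)
  have "((\<lambda>x. complex_of_real (x $ i)) has_derivative (\<lambda>v. of_real (v $ i))) (at x)" for x :: "real^'a"
    by (intro has_derivative_of_real bounded_linear.has_derivative[OF bounded_linear_vec_nth] has_derivative_ident)
  then show ?case by (intro exI[of _ "\<lambda>_ v. of_real (v $ i)"]) (auto intro: smooth_expr.const)
next
  case (add f g)
  then obtain f' g' where "\<forall>x. (f has_derivative f' x) (at x)" "\<forall>v. smooth_expr (\<lambda>x. f' x v)"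
    "\<forall>x. (g has_derivative g' x) (at x)" "\<forall>v. smooth_expr (\<lambda>x. g' x v)" by blast
  then show ?case
    by (intro exI[of _ "\<lambda>x v. f' x v + g' x v"]) (auto intro: smooth_expr.add has_derivative_add)
next
  case (mult f g)
  then obtain f' g' where "\<forall>x. (f has_derivative f' x) (at x)" "\<forall>v. smooth_expr (\<lambda>x. f' x v)"
    "\<forall>x. (g has_derivative g' x) (at x)" "\<forall>v. smooth_expr (\<lambda>x. g' x v)" by blast
  with mult.hyps show ?case
    by (intro exI[of _ "\<lambda>x v. f x * g' x v + f' x v * g x"])
       (auto intro!: smooth_expr.add smooth_expr.mult has_derivative_mult)
next
  case (flat m r z)
  define q where "q = (\<lambda>x::real^'a. r\<^sup>2 - (x - z) \<bullet> (x - z))"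
  define f' where "f' = (\<lambda>x v. complex_of_real (- 2 * ((x - z) \<bullet> v)) *
      of_real (flat_exp (m + 2) (q x) - real m * flat_exp (m + 1) (q x)))"
  have qd: "(q has_derivative (\<lambda>v. - 2 * ((x - z) \<bullet> v))) (at x)" for x
    unfolding q_def by (auto intro!: derivative_eq_intros simp: inner_commute)
  have "((\<lambda>x. flat_exp m (q x)) has_derivative (\<lambda>v. - 2 * ((x - z) \<bullet> v) *
      (flat_exp (m + 2) (q x) - real m * flat_exp (m + 1) (q x)))) (at x)" for x
    using has_derivative_compose[OF qd flat_exp_deriv[of m, unfolded has_field_derivative_def], of x]
    by (simp add: mult.commute)
  then have "((\<lambda>x. complex_of_real (flat_exp m (q x))) has_derivative f' x) (at x)" for x
    unfolding f'_def of_real_mult[symmetric] by (intro has_derivative_of_real)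
  moreover have "smooth_expr (\<lambda>x. f' x v)" for v
  proof -
    have "f' x v = (-2 * (\<Sum>i\<in>UNIV. (of_real (x $ i) + of_real (- z $ i)) * of_real (v $ i))) *
      (of_real (flat_exp (m + 2) (r\<^sup>2 - (x - z) \<bullet> (x - z))) +
       of_real (- real m) * of_real (flat_exp (m + 1) (r\<^sup>2 - (x - z) \<bullet> (x - z))))" for x
      by (simp add: f'_def q_def inner_vec_def)
    then show ?thesis by (simp only:) (intro smooth_expr.intros smooth_expr_sum)
  qed
  ultimately show ?case unfolding q_def by blast
qed

lemma smooth_expr_C_class: "smooth_expr f \<Longrightarrow> C_class k f"
proof (induction k arbitrary: f)
  case 0
  obtain f' where f': "\<And>x. (f has_derivative f' x) (at x)" using smooth_expr_derivative[OF 0] by blast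
  have "isCont f x" for x using has_derivative_continuous[OF f'] .
  then show ?case by (simp add: continuous_at_imp_continuous_on)
next
  case (Suc k)
  obtain f' where f': "\<And>x. (f has_derivative f' x) (at x)" "\<And>v. smooth_expr (\<lambda>x. f' x v)"
    using smooth_expr_derivative[OF Suc.prems] by blast
  have "frechet_derivative f (at x) = f' x" for x using frechet_derivative_at[OF f'(1)] by simp
  then show ?case using f' Suc.IH by (auto simp: differentiable_on_def differentiable_def intro: has_derivative_at_withinI)
qed

definition bump :: "real \<Rightarrow> real^'n \<Rightarrow> real^'n \<Rightarrow> real" where
  "bump r z x = flat_exp 0 (r\<^sup>2 - (x - z) \<bullet> (x - z))"

lemma bump_nonneg: "bump r z x \<ge> 0"
  by (simp add: bump_def flat_exp_nonneg)

lemma bump_support: "r > 0 \<Longrightarrow> x \<notin> ball z r \<Longrightarrow> bump r z x = 0"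
proof -
  assume "r > 0" "x \<notin> ball z r"
  then have "r ^ 2 \<le> norm (x - z) ^ 2" by (intro power_mono) (auto simp: dist_norm norm_minus_commute)
  then show ?thesis by (simp add: bump_def flat_exp_def power2_norm_eq_inner)
qed

lemma bump_continuous: "continuous_on S (bump r z)"
proof -
  have "continuous_on UNIV (flat_exp 0)"
    using flat_exp_deriv DERIV_isCont by (intro continuous_at_imp_continuous_on) blast
  moreover have "continuous_on S (\<lambda>x. r\<^sup>2 - (x - z) \<bullet> (x - z))" by (intro continuous_intros)
  ultimately show ?thesis unfolding bump_def by (rule continuous_on_compose2) auto
qed

lemma bump_integrable: "r > 0 \<Longrightarrow> integrable lborel (bump r z)"
proof -
  assume r: "r > 0"
  have "bump r z = (\<lambda>x. indicator (cball z r) x *\<^sub>R bump r z x)"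
  proof
    fix x
    show "bump r z x = indicator (cball z r) x *\<^sub>R bump r z x"
      using bump_support[OF r, of x z] ball_subset_cball[of z r] by (cases "x \<in> cball z r") auto
  qed
  then show ?thesis using borel_integrable_compact[OF compact_cball bump_continuous] by metis
qed

lemma bump_integral_pos: "r > 0 \<Longrightarrow> integral\<^sup>L lborel (bump r z) > 0"
proof -
  assume r: "r > 0"
  \<comment> \<open>The value of the bump at distance r / 2 from its centre.\<close>
  define e where "e = exp (- 4 / (r\<^sup>2 * 3))"
  have "e * indicator (ball z (r / 2)) x \<le> bump r z x" for x
  proof (cases "x \<in> ball z (r / 2)")
    case True
    then have "norm (x - z) ^ 2 \<le> (r / 2) ^ 2" by (intro power_mono) (auto simp: dist_norm norm_minus_commute)
    then have d: "r\<^sup>2 - (x - z) \<bullet> (x - z) \<ge> r\<^sup>2 * 3 / 4" by (simp add: power2_norm_eq_inner power_divide)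
    have p: "r\<^sup>2 * 3 / 4 > 0" using r by simp
    have "- 1 / (r\<^sup>2 * 3 / 4) \<le> - 1 / (r\<^sup>2 - (x - z) \<bullet> (x - z))"
      using d p by (intro divide_left_mono_neg mult_pos_pos) linarith+
    then have "e \<le> exp (- 1 / (r\<^sup>2 - (x - z) \<bullet> (x - z)))" unfolding e_def by simp
    moreover have "r\<^sup>2 - (x - z) \<bullet> (x - z) > 0" using d p by linarith
    ultimately show ?thesis using True by (simp add: bump_def flat_exp_def)
  qed (simp add: bump_nonneg)
  then have "(\<integral>x. e * indicator (ball z (r / 2)) x \<partial>lborel) \<le> integral\<^sup>L lborel (bump r z)"
    using bump_integrable[OF r] emeasure_lborel_ball_finite[of z "r / 2"]
    by (intro integral_mono integrable_mult_right integrable_real_indicator) auto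
  moreover have "(\<integral>x. e * indicator (ball z (r / 2)) x \<partial>lborel) = e * measure lborel (ball z (r / 2))" by simp
  moreover have "e * measure lborel (ball z (r / 2)) > 0"
    using r content_ball_pos[of "r / 2" z] by (simp add: e_def)
  ultimately show ?thesis by linarith
qed

section \<open>The native space inequality for point masses\<close>

definition mollifier :: "real \<Rightarrow> real^'n \<Rightarrow> real^'n \<Rightarrow> real" where
  "mollifier r z x = bump r z x / integral\<^sup>L lborel (bump r z)"

lemma mollifier_basic:
  assumes "r > 0"
  shows "mollifier r z x \<ge> 0" "x \<notin> ball z r \<Longrightarrow> mollifier r z x = 0"
    "integrable lborel (mollifier r z)" "integral\<^sup>L lborel (mollifier r z) = 1"
    "mollifier r z \<in> borel_measurable borel"
  using bump_nonneg[of r z x] bump_support[OF assms] bump_integrable[OF assms, of z] bump_integral_pos[OF assms, of z]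
    borel_measurable_continuous_onI[OF bump_continuous[of UNIV r z]]
  unfolding mollifier_def by auto

lemma mollifier_average:
  fixes H :: "real^'n \<Rightarrow> 'b::{banach, second_countable_topology}"
  assumes r: "r > 0" and H: "H \<in> borel_measurable borel"
    and close: "\<And>x. x \<in> ball z r \<Longrightarrow> norm (H x - c) \<le> e"
  shows "integrable lborel (\<lambda>x. mollifier r z x *\<^sub>R H x)"
    and "norm ((\<integral>x. mollifier r z x *\<^sub>R H x \<partial>lborel) - c) \<le> e"
proof -
  note mol = mollifier_basic[OF r]
  have meas[measurable]: "mollifier r z \<in> borel_measurable borel" "H \<in> borel_measurable borel" using mol H by auto
  have int: "integrable lborel (\<lambda>x. mollifier r z x *\<^sub>R (H x - c))"
  proof (rule Bochner_Integration.integrable_bound[of _ "\<lambda>x. mollifier r z x * e"])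
    show "AE x in lborel. norm (mollifier r z x *\<^sub>R (H x - c)) \<le> norm (mollifier r z x * e)"
    proof (rule AE_I2)
      fix x
      show "norm (mollifier r z x *\<^sub>R (H x - c)) \<le> norm (mollifier r z x * e)"
        using close[of x] mol(1)[of z x] mol(2)[of x z] by (cases "x \<in> ball z r") (auto simp: abs_mult intro!: mult_left_mono)
    qed
  next
    show "integrable lborel (\<lambda>x. mollifier r z x * e)" by (intro integrable_mult_left mol)
    show "(\<lambda>x. mollifier r z x *\<^sub>R (H x - c)) \<in> borel_measurable lborel" by measurable
  qed
  have intc: "integrable lborel (\<lambda>x. mollifier r z x *\<^sub>R c)" by (intro integrable_scaleR_left mol)
  have eq: "(\<lambda>x. mollifier r z x *\<^sub>R H x) = (\<lambda>x. mollifier r z x *\<^sub>R (H x - c) + mollifier r z x *\<^sub>R c)"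
    by (simp add: scaleR_diff_right)
  show "integrable lborel (\<lambda>x. mollifier r z x *\<^sub>R H x)" unfolding eq using int intc by simp
  have "(\<integral>x. mollifier r z x *\<^sub>R H x \<partial>lborel) - c = (\<integral>x. mollifier r z x *\<^sub>R (H x - c) \<partial>lborel)"
    unfolding eq using int intc mol(3,4)[of z] by (simp add: Bochner_Integration.integral_add integral_scaleR_left)
  also have "norm \<dots> \<le> (\<integral>x. mollifier r z x * e \<partial>lborel)"
  proof (rule Bochner_Integration.integral_norm_bound_integral[OF int])
    fix x
    show "norm (mollifier r z x *\<^sub>R (H x - c)) \<le> mollifier r z x * e"
      using close[of x] mol(1)[of z x] mol(2)[of x z] by (cases "x \<in> ball z r") (auto intro!: mult_left_mono)
  next
    show "integrable lborel (\<lambda>x. mollifier r z x * e)" by (intro integrable_mult_left mol)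
  qed
  also have "\<dots> = e" using mol(4)[of z] by simp
  finally show "norm ((\<integral>x. mollifier r z x *\<^sub>R H x \<partial>lborel) - c) \<le> e" .
qed

lemma mollifier_integrable_continuous:
  fixes H :: "real^'n \<Rightarrow> 'b::{banach, second_countable_topology}"
  assumes r: "r > 0" and H: "continuous_on UNIV H"
  shows "integrable lborel (\<lambda>x. mollifier r z x *\<^sub>R H x)"
proof -
  have "bounded (H ` cball z r)"
    by (intro compact_imp_bounded compact_continuous_image continuous_on_subset[OF H]) auto
  then obtain B where "\<forall>x\<in>cball z r. norm (H x) \<le> B" by (auto simp: bounded_iff)
  then show ?thesis
    using borel_measurable_continuous_onI[OF H] by (intro mollifier_average(1)[OF r, where c=0 and e=B]) auto
qed

lemma mollifier_combination_test_function:
  assumes r: "r > 0" and "finite Z"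
  shows "(\<lambda>x. \<Sum>z\<in>Z. complex_of_real (a z * mollifier r z x)) \<in> test_functions"
proof -
  define \<phi> where "\<phi> = (\<lambda>x. \<Sum>z\<in>Z. complex_of_real (a z * mollifier r z x))"
  have "\<phi> = (\<lambda>x. \<Sum>z\<in>Z. of_real (a z / integral\<^sup>L lborel (bump r z)) * of_real (flat_exp 0 (r\<^sup>2 - (x - z) \<bullet> (x - z))))"
    by (simp add: \<phi>_def mollifier_def bump_def)
  then have "smooth_expr \<phi>" by (simp only:) (intro smooth_expr_sum smooth_expr.mult smooth_expr.const smooth_expr.flat)
  have "{x. \<phi> x \<noteq> 0} \<subseteq> (\<Union>z\<in>Z. ball z r)"
  proof
    fix x assume "x \<in> {x. \<phi> x \<noteq> 0}"
    then obtain z where "z \<in> Z" "mollifier r z x \<noteq> 0" unfolding \<phi>_def by (auto elim!: sum.not_neutral_contains_not_neutral)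
    then show "x \<in> (\<Union>z\<in>Z. ball z r)" using mollifier_basic(2)[OF r] by blast
  qed
  moreover have "bounded (\<Union>z\<in>Z. ball z r)" using assms(2) by auto
  ultimately have "bounded {x. \<phi> x \<noteq> 0}" using bounded_subset by blast
  with \<open>smooth_expr \<phi>\<close> show ?thesis unfolding \<phi>_def[symmetric] test_functions_def
    by (auto simp: smooth_expr_C_class compact_closure)
qed

text \<open>The test function is the combination of mollifiers with the given masses, with a radius so small
  that f and h vary by at most e over the supports. The radius is a minimum over finitely many
  points and pairs of points.\<close>

lemma test_function_approximates_atoms:
  fixes f :: "real^'n \<Rightarrow> complex" and h :: "real^'n \<Rightarrow> real" and a :: "real^'n \<Rightarrow> real"
  assumes f: "continuous_on UNIV f" and h: "continuous_on UNIV h" and Z: "finite Z" and e: "e > 0"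
  shows "\<exists>\<phi>\<in>test_functions.
    cmod ((LINT x|lborel. f x * \<phi> x) - (\<Sum>z\<in>Z. of_real (a z) * f z)) \<le> e * (\<Sum>z\<in>Z. \<bar>a z\<bar>) \<and>
    \<bar>Re (quad_form h \<phi>) - (\<Sum>z\<in>Z. \<Sum>w\<in>Z. a z * a w * h (z - w))\<bar> \<le> e * (\<Sum>z\<in>Z. \<bar>a z\<bar>)\<^sup>2"
proof -
  have "\<exists>r>0. \<forall>x\<in>ball z r. cmod (f x - f z) \<le> e" for z
  proof -
    have "isCont f z" using f by (simp add: continuous_on_eq_continuous_at)
    then obtain r where "r > 0" "\<And>x. dist x z < r \<Longrightarrow> dist (f x) (f z) < e"
      using e unfolding continuous_at_eps_delta by blast
    then show ?thesis by (intro exI[of _ r]) (auto simp: dist_norm norm_minus_commute less_imp_le)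
  qed
  then obtain r1 where r1: "\<And>z. r1 z > 0" "\<And>z x. x \<in> ball z (r1 z) \<Longrightarrow> cmod (f x - f z) \<le> e" by metis
  have "\<exists>r>0. \<forall>x\<in>ball z r. \<forall>y\<in>ball w r. \<bar>h (x - y) - h (z - w)\<bar> \<le> e" for z w
  proof -
    have "isCont h (z - w)" using h by (simp add: continuous_on_eq_continuous_at)
    then obtain r where r: "r > 0" "\<And>x. dist x (z - w) < r \<Longrightarrow> dist (h x) (h (z - w)) < e"
      using e unfolding continuous_at_eps_delta by blast
    have "\<bar>h (x - y) - h (z - w)\<bar> \<le> e" if "x \<in> ball z (r / 2)" "y \<in> ball w (r / 2)" for x y
    proof -
      have "dist (x - y) (z - w) \<le> norm (z - x) + norm (w - y)"
        using norm_triangle_ineq4[of "x - z" "y - w"] by (simp add: dist_norm norm_minus_commute algebra_simps)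
      also have "\<dots> < r" using that by (simp add: dist_norm)
      finally show ?thesis using r(2)[of "x - y"] by (simp add: dist_real_def)
    qed
    then show ?thesis using r(1) by (intro exI[of _ "r / 2"]) auto
  qed
  then obtain r2 where r2: "\<And>z w. r2 z w > 0"
    "\<And>z w x y. x \<in> ball z (r2 z w) \<Longrightarrow> y \<in> ball w (r2 z w) \<Longrightarrow> \<bar>h (x - y) - h (z - w)\<bar> \<le> e" by metis
  define R where "R = insert 1 (r1 ` Z \<union> case_prod r2 ` (Z \<times> Z))"
  define r where "r = Min R"
  have R: "finite R" "R \<noteq> {}" using Z by (auto simp: R_def)
  have r: "r > 0" unfolding r_def using R r1(1) r2(1) by (subst Min_gr_iff) (auto simp: R_def)
  have le1: "r \<le> r1 z" if "z \<in> Z" for z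
    unfolding r_def using that by (intro Min_le R) (auto simp: R_def)
  have le2: "r \<le> r2 z w" if "z \<in> Z" "w \<in> Z" for z w
    unfolding r_def using that by (intro Min_le R) (force simp: R_def)
  have cf: "cmod (f x - f z) \<le> e" if "z \<in> Z" "x \<in> ball z r" for x z
    using r1(2)[of x z] le1[OF that(1)] that(2) by auto
  have ch: "\<bar>h (x - y) - h (z - w)\<bar> \<le> e" if "z \<in> Z" "w \<in> Z" "x \<in> ball z r" "y \<in> ball w r" for x y z w
    using r2(2)[of x z w y] le2[OF that(1,2)] that(3,4) by auto
  define \<phi> where "\<phi> = (\<lambda>x. \<Sum>z\<in>Z. complex_of_real (a z * mollifier r z x))"
  have \<phi>: "\<phi> \<in> test_functions" unfolding \<phi>_def by (rule mollifier_combination_test_function[OF r Z])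
  have fm[measurable]: "f \<in> borel_measurable borel" using f by (rule borel_measurable_continuous_onI)
  have hm[measurable]: "h \<in> borel_measurable borel" using h by (rule borel_measurable_continuous_onI)
  have mm[measurable]: "mollifier r z \<in> borel_measurable borel" for z using mollifier_basic(5)[OF r] .
  have avg_f: "integrable lborel (\<lambda>x. mollifier r z x *\<^sub>R f x)"
    "cmod ((LINT x|lborel. mollifier r z x *\<^sub>R f x) - f z) \<le> e" if "z \<in> Z" for z
    using mollifier_average[OF r fm, of z "f z" e] cf[OF that] by auto
  have "(LINT x|lborel. f x * \<phi> x) = (LINT x|lborel. (\<Sum>z\<in>Z. of_real (a z) * (mollifier r z x *\<^sub>R f x)))"
    by (intro Bochner_Integration.integral_cong) (auto simp: \<phi>_def sum_distrib_left scaleR_conv_of_real mult_ac)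
  also have "\<dots> = (\<Sum>z\<in>Z. of_real (a z) * (LINT x|lborel. mollifier r z x *\<^sub>R f x))"
    using avg_f(1) by (subst Bochner_Integration.integral_sum) (auto simp del: mult_scaleR_right)
  finally have "(LINT x|lborel. f x * \<phi> x) - (\<Sum>z\<in>Z. of_real (a z) * f z)
      = (\<Sum>z\<in>Z. of_real (a z) * ((LINT x|lborel. mollifier r z x *\<^sub>R f x) - f z))"
    by (simp add: sum_subtractf right_diff_distrib)
  also have "cmod \<dots> \<le> (\<Sum>z\<in>Z. \<bar>a z\<bar> * e)"
    by (rule order_trans[OF norm_sum]) (intro sum_mono, auto simp: norm_mult intro!: mult_left_mono avg_f(2))
  finally have part1: "cmod ((LINT x|lborel. f x * \<phi> x) - (\<Sum>z\<in>Z. of_real (a z) * f z)) \<le> e * (\<Sum>z\<in>Z. \<bar>a z\<bar>)"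
    by (simp add: sum_distrib_left mult.commute)
  define H where "H = (\<lambda>z y. LINT x|lborel. mollifier r z x *\<^sub>R h (x - y))"
  have Hm[measurable]: "H z \<in> borel_measurable borel" for z
    unfolding H_def by measurable
  have shm: "(\<lambda>x. h (x - y)) \<in> borel_measurable borel" for y by measurable
  have H: "\<bar>H z y - h (z - w)\<bar> \<le> e" if "z \<in> Z" "w \<in> Z" "y \<in> ball w r" for z w y
    using mollifier_average(2)[OF r shm, of z y "h (z - w)" e] ch[OF that(1,2) _ that(3)] by (simp add: H_def)
  have int_h: "integrable lborel (\<lambda>x. mollifier r z x *\<^sub>R h (x - y))" for z y
  proof (rule mollifier_integrable_continuous[OF r])
    show "continuous_on UNIV (\<lambda>x. h (x - y))"
      by (rule continuous_on_compose2[OF h]) (auto intro!: continuous_intros)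
  qed
  have inner: "(LINT x|lborel. complex_of_real (h (x - y)) * \<phi> x * cnj (\<phi> y))
      = complex_of_real (\<Sum>z\<in>Z. \<Sum>w\<in>Z. a z * a w * (mollifier r w y *\<^sub>R H z y))" for y
  proof -
    have "(LINT x|lborel. complex_of_real (h (x - y)) * \<phi> x * cnj (\<phi> y))
        = (LINT x|lborel. complex_of_real (\<Sum>z\<in>Z. (\<Sum>w\<in>Z. a w * mollifier r w y) * a z * (mollifier r z x *\<^sub>R h (x - y))))"
      by (intro Bochner_Integration.integral_cong)
         (auto simp: \<phi>_def sum_distrib_left sum_distrib_right mult_ac)
    also have "\<dots> = complex_of_real (LINT x|lborel. (\<Sum>z\<in>Z. (\<Sum>w\<in>Z. a w * mollifier r w y) * a z * (mollifier r z x *\<^sub>R h (x - y))))"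
      by (rule integral_complex_of_real)
    also have "(LINT x|lborel. (\<Sum>z\<in>Z. (\<Sum>w\<in>Z. a w * mollifier r w y) * a z * (mollifier r z x *\<^sub>R h (x - y))))
        = (\<Sum>z\<in>Z. (\<Sum>w\<in>Z. a w * mollifier r w y) * a z * H z y)"
      using int_h unfolding H_def by (subst Bochner_Integration.integral_sum) auto
    also have "\<dots> = (\<Sum>z\<in>Z. \<Sum>w\<in>Z. a z * a w * (mollifier r w y *\<^sub>R H z y))"
      by (intro sum.cong refl) (simp add: sum_distrib_left sum_distrib_right mult_ac)
    finally show ?thesis .
  qed
  have avg_H: "integrable lborel (\<lambda>y. mollifier r w y *\<^sub>R H z y)"
    "\<bar>(LINT y|lborel. mollifier r w y *\<^sub>R H z y) - h (z - w)\<bar> \<le> e" if "z \<in> Z" "w \<in> Z" for z w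
    using mollifier_average[OF r Hm, of w z "h (z - w)" e] H[OF that] by auto
  have "quad_form h \<phi> = complex_of_real (\<Sum>z\<in>Z. \<Sum>w\<in>Z. a z * a w * (LINT y|lborel. mollifier r w y *\<^sub>R H z y))"
    unfolding quad_form_def inner integral_complex_of_real
    using avg_H(1) by (simp add: Bochner_Integration.integral_sum)
  then have "Re (quad_form h \<phi>) - (\<Sum>z\<in>Z. \<Sum>w\<in>Z. a z * a w * h (z - w))
      = (\<Sum>z\<in>Z. \<Sum>w\<in>Z. a z * a w * ((LINT y|lborel. mollifier r w y *\<^sub>R H z y) - h (z - w)))"
    by (simp add: sum_subtractf right_diff_distrib)
  also have "\<bar>\<dots>\<bar> \<le> (\<Sum>z\<in>Z. \<Sum>w\<in>Z. \<bar>a z\<bar> * \<bar>a w\<bar> * e)"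
    by (intro order_trans[OF sum_abs] sum_mono) (auto simp: abs_mult simp del: real_scaleR_def intro!: mult_left_mono avg_H(2) order_trans[OF sum_abs] sum_mono)
  also have "\<dots> = e * (\<Sum>z\<in>Z. \<bar>a z\<bar>)\<^sup>2"
    by (simp add: power2_eq_square sum_product sum_distrib_left mult_ac)
  finally show ?thesis using \<phi> part1 by blast
qed

lemma gaussian_continuous: "continuous_on S (gaussian \<beta>)"
  unfolding gaussian_def by (intro continuous_intros)

text \<open>The bound for test functions passes to the limit of vanishing mollifier radius.\<close>

lemma native_bound_atoms:
  fixes f :: "real^'n \<Rightarrow> complex" and h :: "real^'n \<Rightarrow> real"
  assumes f: "continuous_on UNIV f" and h: "continuous_on UNIV h"
    and bound: "native_bound h f c" and Z: "finite Z"
  shows "cmod (\<Sum>z\<in>Z. of_real (a z) * f z) \<le> c * sqrt (\<Sum>z\<in>Z. \<Sum>w\<in>Z. a z * a w * h (z - w))"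
proof -
  define A where "A = (\<Sum>z\<in>Z. \<bar>a z\<bar>)"
  define Q where "Q = (\<Sum>z\<in>Z. \<Sum>w\<in>Z. a z * a w * h (z - w))"
  define S where "S = (\<Sum>z\<in>Z. of_real (a z) * f z)"
  have "\<exists>q. cmod S \<le> c * sqrt q + e * A \<and> \<bar>q - Q\<bar> \<le> e * A\<^sup>2" if e: "e > 0" for e
  proof -
    obtain \<phi> where \<phi>: "\<phi> \<in> test_functions" "cmod ((LINT x|lborel. f x * \<phi> x) - S) \<le> e * A"
      "\<bar>Re (quad_form h \<phi>) - Q\<bar> \<le> e * A\<^sup>2"
      using test_function_approximates_atoms[OF f h Z e, of a] unfolding A_def Q_def S_def by blast
    have "cmod S \<le> cmod (LINT x|lborel. f x * \<phi> x) + cmod ((LINT x|lborel. f x * \<phi> x) - S)"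
      by (metis norm_minus_commute norm_triangle_sub)
    also have "\<dots> \<le> c * sqrt (Re (quad_form h \<phi>)) + e * A"
      using \<phi> bound unfolding native_bound_def by (intro add_mono) auto
    finally show ?thesis using \<phi>(3) by blast
  qed
  then have "\<forall>n. \<exists>q. cmod S \<le> c * sqrt q + inverse (real (Suc n)) * A \<and> \<bar>q - Q\<bar> \<le> inverse (real (Suc n)) * A\<^sup>2"
    by simp
  then obtain q where q: "\<And>n. cmod S \<le> c * sqrt (q n) + inverse (real (Suc n)) * A"
    "\<And>n. \<bar>q n - Q\<bar> \<le> inverse (real (Suc n)) * A\<^sup>2" by metis
  have lim0: "(\<lambda>n. inverse (real (Suc n)) * B) \<longlonglongrightarrow> 0" for B
    using tendsto_mult_left_zero[OF LIMSEQ_inverse_real_of_nat] .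
  have "(\<lambda>n. q n - Q) \<longlonglongrightarrow> 0"
    by (rule Lim_null_comparison[OF _ lim0[of "A\<^sup>2"]]) (use q(2) in auto)
  then have "q \<longlonglongrightarrow> Q" by (simp add: LIM_zero_iff)
  then have "(\<lambda>n. c * sqrt (q n) + inverse (real (Suc n)) * A) \<longlonglongrightarrow> c * sqrt Q + 0"
    by (intro tendsto_intros lim0)
  then have "cmod S \<le> c * sqrt Q + 0"
    by (rule LIMSEQ_le_const) (use q(1) in auto)
  then show ?thesis by (simp add: S_def Q_def)
qed

text \<open>The admissible constants form a closed set, and it is bounded below because some test function
  has a positive quadratic form. So their infimum is admissible and is the least one.\<close>

lemma native_norm_attained:
  fixes f :: "real^'n \<Rightarrow> complex"
  assumes f: "f \<in> native_space (gaussian \<beta>)"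
  shows "native_bound (gaussian \<beta>) f (native_norm (gaussian \<beta>) f)"
proof -
  define S where "S = {c. native_bound (gaussian \<beta>) f c}"
  have "\<exists>\<phi>\<in>test_functions. Re (quad_form (gaussian \<beta> :: real^'n \<Rightarrow> real) \<phi>) > 0"
  proof -
    obtain \<phi> where "\<phi> \<in> test_functions" "\<bar>Re (quad_form (gaussian \<beta> :: real^'n \<Rightarrow> real) \<phi>) - 1\<bar> \<le> 1/2"
      using test_function_approximates_atoms[of "\<lambda>_. 0" "gaussian \<beta>" "{0 :: real^'n}" "1/2" "\<lambda>_. 1"]
      by (auto simp: gaussian_continuous) (auto simp: gaussian_def)
    then show ?thesis by (intro bexI[of _ \<phi>]) linarith+
  qed
  then obtain \<phi>0 where \<phi>0: "\<phi>0 \<in> test_functions" "Re (quad_form (gaussian \<beta> :: real^'n \<Rightarrow> real) \<phi>0) > 0" by blast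
  have nonneg: "c \<ge> 0" if "c \<in> S" for c
  proof -
    have "0 \<le> c * sqrt (Re (quad_form (gaussian \<beta> :: real^'n \<Rightarrow> real) \<phi>0))"
      using that \<phi>0(1) order_trans[OF norm_ge_zero] unfolding S_def native_bound_def by blast
    then show ?thesis using \<phi>0(2) by (simp add: zero_le_mult_iff)
  qed
  have ne: "S \<noteq> {}" using f by (auto simp: S_def native_space_def)
  have bdd: "bdd_below S" using nonneg by (auto intro: bdd_belowI[of _ 0])
  have "native_bound (gaussian \<beta>) f (Inf S)"
    unfolding native_bound_def
  proof
    fix \<phi> :: "real^'n \<Rightarrow> complex" assume \<phi>: "\<phi> \<in> test_functions"
    define q where "q = sqrt (Re (quad_form (gaussian \<beta> :: real^'n \<Rightarrow> real) \<phi>))"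
    define I where "I = cmod (LINT x|lborel. f x * \<phi> x)"
    have le: "I \<le> c * q" if "c \<in> S" for c
      using that \<phi> by (auto simp: S_def native_bound_def I_def q_def)
    have "I \<le> Inf S * q"
    proof (cases "q > 0")
      case True
      have "I / q \<le> Inf S" using le True by (intro cInf_greatest[OF ne]) (simp add: field_simps)
      then show ?thesis using True by (simp add: field_simps)
    next
      case False
      obtain c where c: "c \<in> S" using ne by blast
      have "c * q \<le> Inf S * q" using False cInf_lower[OF c bdd] by (intro mult_right_mono_neg) auto
      then show ?thesis using le[OF c] by simp
    qed
    then show "cmod (LINT x|lborel. f x * \<phi> x) \<le> Inf S * sqrt (Re (quad_form (gaussian \<beta>) \<phi>))" by (simp add: I_def q_def)
  qed
  moreover from this have "(LEAST c. native_bound (gaussian \<beta>) f c) = Inf S"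
    using cInf_lower[OF _ bdd] by (intro Least_equality) (auto simp: S_def)
  ultimately show ?thesis by (simp add: native_norm_def S_def)
qed

section \<open>Positive semidefinite kernels and the power function\<close>

definition psd_kernel :: "('a \<Rightarrow> 'a \<Rightarrow> real) \<Rightarrow> bool" where
  "psd_kernel K \<longleftrightarrow> (\<forall>u v. K u v = K v u) \<and>
     (\<forall>Z w. finite Z \<longrightarrow> (\<Sum>u\<in>Z. \<Sum>v\<in>Z. w u * w v * K u v) \<ge> 0)"

lemma psd_kernelD:
  assumes "psd_kernel K"
  shows "K u v = K v u" and "finite Z \<Longrightarrow> (\<Sum>u\<in>Z. \<Sum>v\<in>Z. w u * w v * K u v) \<ge> 0"
  using assms unfolding psd_kernel_def by blast+

lemma psd_kernel_Cauchy_Schwarz: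
  assumes K: "psd_kernel K" and Z: "finite Z"
  shows "(\<Sum>u\<in>Z. \<Sum>v\<in>Z. w u * w' v * K u v)\<^sup>2
    \<le> (\<Sum>u\<in>Z. \<Sum>v\<in>Z. w u * w v * K u v) * (\<Sum>u\<in>Z. \<Sum>v\<in>Z. w' u * w' v * K u v)"
proof -
  define a where "a = (\<Sum>u\<in>Z. \<Sum>v\<in>Z. w u * w v * K u v)"
  define b where "b = (\<Sum>u\<in>Z. \<Sum>v\<in>Z. w u * w' v * K u v)"
  define c where "c = (\<Sum>u\<in>Z. \<Sum>v\<in>Z. w' u * w' v * K u v)"
  have sym: "(\<Sum>u\<in>Z. \<Sum>v\<in>Z. w' u * w v * K u v) = b"
    unfolding b_def by (subst sum.swap) (use K in \<open>simp add: psd_kernel_def mult_ac\<close>)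
  have quad: "a + 2 * t * b + t\<^sup>2 * c \<ge> 0" for t
  proof -
    have "0 \<le> (\<Sum>u\<in>Z. \<Sum>v\<in>Z. (w u + t * w' u) * (w v + t * w' v) * K u v)"
      by (rule psd_kernelD(2)[OF K Z])
    also have "\<dots> = a + t * b + t * (\<Sum>u\<in>Z. \<Sum>v\<in>Z. w' u * w v * K u v) + t\<^sup>2 * c"
      unfolding a_def b_def c_def
      by (simp add: sum_distrib_left sum.distrib[symmetric] algebra_simps power2_eq_square)
    finally show ?thesis using sym by (simp add: algebra_simps)
  qed
  have c0: "c \<ge> 0" using K Z unfolding c_def psd_kernel_def by blast
  have "b\<^sup>2 \<le> a * c"
  proof (cases "c = 0")
    case True
    have "b = 0"
    proof (rule ccontr)
      assume "b \<noteq> 0"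
      \<comment> \<open>At this t the quadratic, which is linear here, takes the value -1.\<close>
      then show False using quad[of "- (a + 1) / (2 * b)"] True by (simp add: field_simps)
    qed
    then show ?thesis using True by simp
  next
    case False
    then have "0 \<le> (a + 2 * (- b / c) * b + (- b / c)\<^sup>2 * c) * c"
      using quad[of "- b / c"] c0 by (intro mult_nonneg_nonneg)
    also have "\<dots> = a * c - b\<^sup>2" using False by (simp add: field_simps power2_eq_square)
    finally show ?thesis by simp
  qed
  then show ?thesis by (simp add: a_def b_def c_def)
qed

text \<open>Gram-Schmidt for a kernel that may be degenerate. When a new point y0 is added, the residual of
  the section at x is corrected by a multiple of the residual at y0. If the latter vanishes at
  y0, it has norm zero, and Cauchy-Schwarz shows that the residual at x vanishes there as
  well.\<close>

lemma psd_kernel_section_in_span: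
  assumes K: "psd_kernel K" and Y: "finite Y"
  shows "\<exists>c. \<forall>v\<in>Y. K v x = (\<Sum>y\<in>Y. c y * K v y)"
  using Y
proof (induction Y arbitrary: x rule: finite_induct)
  case (insert y0 Y)
  show ?case
  proof (cases "x \<in> insert y0 Y")
    case True
    have "(\<Sum>y\<in>insert y0 Y. (if y = x then 1 else 0) * K v y) = K v x" for v
    proof -
      have "(\<Sum>y\<in>insert y0 Y. (if y = x then 1 else 0) * K v y) = (\<Sum>y\<in>insert y0 Y. if y = x then K v x else 0)"
        by (rule sum.cong) auto
      then show ?thesis using True insert.hyps by (simp add: sum.delta)
    qed
    then show ?thesis by (intro exI[of _ "\<lambda>y. if y = x then 1 else 0"]) simp
  next
    case False
    obtain cx where cx: "\<And>v. v \<in> Y \<Longrightarrow> K v x = (\<Sum>y\<in>Y. cx y * K v y)" using insert.IH by blast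
    obtain c0 where c0: "\<And>v. v \<in> Y \<Longrightarrow> K v y0 = (\<Sum>y\<in>Y. c0 y * K v y)" using insert.IH by blast
    define ux where "ux = (\<lambda>v. K v x - (\<Sum>y\<in>Y. cx y * K v y))"
    define u0 where "u0 = (\<lambda>v. K v y0 - (\<Sum>y\<in>Y. c0 y * K v y))"
    have ux0: "ux v = 0" and u00: "u0 v = 0" if "v \<in> Y" for v using cx[OF that] c0[OF that] by (auto simp: ux_def u0_def)
    have degenerate: "ux y0 = 0" if "u0 y0 = 0"
    proof -
      define Z where "Z = insert x (insert y0 Y)"
      define w where "w = (\<lambda>z. if z = x then 1 else if z = y0 then 0 else - cx z)"
      define w' where "w' = (\<lambda>z. if z = x then 0 else if z = y0 then 1 else - c0 z)"
      have Z: "finite Z" using insert.hyps by (simp add: Z_def)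
      have dist: "x \<notin> insert y0 Y" "y0 \<notin> Y" "x \<noteq> y0" "x \<notin> Y" using False insert.hyps by auto
      have sumw: "(\<Sum>u\<in>Z. w u * g u) = g x - (\<Sum>y\<in>Y. cx y * g y)" for g
      proof -
        have "(\<Sum>y\<in>Y. w y * g y) = - (\<Sum>y\<in>Y. cx y * g y)"
          unfolding sum_negf[symmetric] using dist by (intro sum.cong) (auto simp: w_def)
        then show ?thesis using insert.hyps dist by (simp add: Z_def w_def)
      qed
      have sumw': "(\<Sum>u\<in>Z. w' u * g u) = g y0 - (\<Sum>y\<in>Y. c0 y * g y)" for g
      proof -
        have "(\<Sum>y\<in>Y. w' y * g y) = - (\<Sum>y\<in>Y. c0 y * g y)"
          unfolding sum_negf[symmetric] using dist by (intro sum.cong) (auto simp: w'_def)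
        then show ?thesis using insert.hyps dist by (simp add: Z_def w'_def)
      qed
      have symK: "K u v = K v u" for u v by (rule psd_kernelD(1)[OF K])
      have inner_w: "(\<Sum>u\<in>Z. w u * K u v) = ux v" for v unfolding sumw ux_def by (simp add: symK[of _ v])
      have inner_w': "(\<Sum>u\<in>Z. w' u * K u v) = u0 v" for v unfolding sumw' u0_def by (simp add: symK[of _ v])
      have "(\<Sum>u\<in>Z. \<Sum>v\<in>Z. w u * w' v * K u v) = (\<Sum>v\<in>Z. w' v * (\<Sum>u\<in>Z. w u * K u v))"
        by (subst sum.swap) (simp add: sum_distrib_left mult_ac)
      also have "\<dots> = ux y0" unfolding inner_w sumw' using ux0 by simp
      finally have B1: "(\<Sum>u\<in>Z. \<Sum>v\<in>Z. w u * w' v * K u v) = ux y0" .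
      have "(\<Sum>u\<in>Z. \<Sum>v\<in>Z. w' u * w' v * K u v) = (\<Sum>v\<in>Z. w' v * (\<Sum>u\<in>Z. w' u * K u v))"
        by (subst sum.swap) (simp add: sum_distrib_left mult_ac)
      also have "\<dots> = 0" unfolding inner_w' sumw' using u00 that by simp
      finally have B2: "(\<Sum>u\<in>Z. \<Sum>v\<in>Z. w' u * w' v * K u v) = 0" .
      from psd_kernel_Cauchy_Schwarz[OF K Z, of w w'] show ?thesis by (simp add: B1 B2)
    qed
    define s where "s = ux y0 / u0 y0"
    define c where "c = (\<lambda>y. if y = y0 then s else cx y - s * c0 y)"
    have "(\<Sum>y\<in>Y. c y * K v y) = (\<Sum>y\<in>Y. cx y * K v y) - s * (\<Sum>y\<in>Y. c0 y * K v y)" for v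
      unfolding sum_distrib_left sum_subtractf[symmetric]
      using insert.hyps by (intro sum.cong) (auto simp: c_def algebra_simps)
    then have sum_c: "(\<Sum>y\<in>insert y0 Y. c y * K v y) = K v x - ux v + s * u0 v" for v
      using insert.hyps by (simp add: c_def ux_def u0_def algebra_simps)
    show ?thesis
    proof (intro exI[of _ c] ballI)
      fix v assume "v \<in> insert y0 Y"
      then show "K v x = (\<Sum>y\<in>insert y0 Y. c y * K v y)"
        unfolding sum_c using ux0 u00 degenerate by (cases "u0 y0 = 0") (auto simp: s_def)
    qed
  qed
qed simp

text \<open>The power j + 1 is a sum over the coordinates of powers j with weights multiplied by that
  coordinate.\<close>

lemma inner_power_psd:
  fixes g :: "'a \<Rightarrow> real^'n"
  shows "(\<Sum>u\<in>Z. \<Sum>v\<in>Z. w u * w v * (g u \<bullet> g v) ^ j) \<ge> 0"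
proof (induction j arbitrary: w)
  case 0
  have "(\<Sum>u\<in>Z. \<Sum>v\<in>Z. w u * w v * (g u \<bullet> g v) ^ 0) = (\<Sum>u\<in>Z. w u)\<^sup>2"
    by (simp add: power2_eq_square sum_product)
  then show ?case by simp
next
  case (Suc j)
  have "(\<Sum>u\<in>Z. \<Sum>v\<in>Z. w u * w v * (g u \<bullet> g v) ^ Suc j)
      = (\<Sum>u\<in>Z. \<Sum>v\<in>Z. \<Sum>i\<in>UNIV. (w u * g u $ i) * (w v * g v $ i) * (g u \<bullet> g v) ^ j)"
    by (intro sum.cong refl) (simp add: inner_vec_def[of _ _] sum_distrib_left sum_distrib_right mult_ac)
  also have "\<dots> = (\<Sum>i\<in>UNIV. \<Sum>u\<in>Z. \<Sum>v\<in>Z. (w u * g u $ i) * (w v * g v $ i) * (g u \<bullet> g v) ^ j)"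
    by (subst sum.swap[of _ _ Z], subst sum.swap[of _ _ Z]) simp
  also have "\<dots> \<ge> 0" by (intro sum_nonneg Suc.IH)
  finally show ?case .
qed

definition exp_tail :: "nat \<Rightarrow> real \<Rightarrow> real" where
  "exp_tail k s = exp s - (\<Sum>j<k. s ^ j / fact j)"

lemma exp_tail_sums: "(\<lambda>j. s ^ (j + k) / fact (j + k)) sums exp_tail k s"
proof -
  have "(\<lambda>j. s ^ j / fact j) sums exp s" using exp_converges[of s] by (simp add: divide_inverse mult.commute)
  from sums_split_initial_segment[OF this, of k] show ?thesis by (simp add: exp_tail_def)
qed

lemma exp_tail_le:
  assumes "s \<ge> 0"
  shows "exp_tail k s \<le> s ^ k / fact k * exp s"
proof -
  have "(\<lambda>j. s ^ k / fact k * (s ^ j / fact j)) sums (s ^ k / fact k * exp s)"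
    using exp_converges[of s] by (intro sums_mult) (simp add: divide_inverse mult.commute)
  moreover have "s ^ (j + k) / fact (j + k) \<le> s ^ k / fact k * (s ^ j / fact j)" for j
  proof -
    have "fact j * fact k \<le> (fact (j + k) :: nat)"
      using fact_fact_dvd_fact[of j k] by (intro dvd_imp_le) auto
    then have "(fact j * fact k :: real) \<le> fact (j + k)"
      by (metis of_nat_fact of_nat_le_iff of_nat_mult)
    then have "s ^ (j + k) / fact (j + k) \<le> s ^ (j + k) / (fact j * fact k)"
      using assms by (intro divide_left_mono) auto
    then show ?thesis by (simp add: power_add mult_ac)
  qed
  ultimately show ?thesis by (rule sums_le[rotated, OF exp_tail_sums])
qed

lemma exp_tail_kernel_psd:
  fixes g :: "'a \<Rightarrow> real^'n"
  assumes "\<gamma> \<ge> 0"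
  shows "psd_kernel (\<lambda>u v. exp_tail k (\<gamma> * (g u \<bullet> g v)))"
  unfolding psd_kernel_def
proof (intro conjI allI impI)
  fix Z :: "'a set" and w :: "'a \<Rightarrow> real"
  have "(\<lambda>j. \<Sum>u\<in>Z. \<Sum>v\<in>Z. w u * w v * ((\<gamma> * (g u \<bullet> g v)) ^ (j + k) / fact (j + k)))
      sums (\<Sum>u\<in>Z. \<Sum>v\<in>Z. w u * w v * exp_tail k (\<gamma> * (g u \<bullet> g v)))"
    by (intro sums_sum sums_mult exp_tail_sums)
  moreover have "0 \<le> (\<Sum>u\<in>Z. \<Sum>v\<in>Z. w u * w v * ((\<gamma> * (g u \<bullet> g v)) ^ (j + k) / fact (j + k)))" for j
  proof -
    have "(\<Sum>u\<in>Z. \<Sum>v\<in>Z. w u * w v * ((\<gamma> * (g u \<bullet> g v)) ^ (j + k) / fact (j + k)))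
        = \<gamma> ^ (j + k) / fact (j + k) * (\<Sum>u\<in>Z. \<Sum>v\<in>Z. w u * w v * (g u \<bullet> g v) ^ (j + k))"
      by (simp add: sum_distrib_left power_mult_distrib mult_ac)
    then show ?thesis using assms inner_power_psd[of w g "j + k" Z] by simp
  qed
  ultimately show "0 \<le> (\<Sum>u\<in>Z. \<Sum>v\<in>Z. w u * w v * exp_tail k (\<gamma> * (g u \<bullet> g v)))"
    by (rule sums_le[OF _ sums_zero, rotated])
qed (simp add: inner_commute)

lemma exp_tail_kernel_le_exp:
  fixes g :: "'a \<Rightarrow> real^'n"
  assumes "\<gamma> \<ge> 0"
  shows "(\<Sum>u\<in>Z. \<Sum>v\<in>Z. w u * w v * exp_tail k (\<gamma> * (g u \<bullet> g v)))
    \<le> (\<Sum>u\<in>Z. \<Sum>v\<in>Z. w u * w v * exp (\<gamma> * (g u \<bullet> g v)))"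
proof -
  have "(\<Sum>u\<in>Z. \<Sum>v\<in>Z. w u * w v * exp (\<gamma> * (g u \<bullet> g v))) - (\<Sum>u\<in>Z. \<Sum>v\<in>Z. w u * w v * exp_tail k (\<gamma> * (g u \<bullet> g v)))
      = (\<Sum>u\<in>Z. \<Sum>v\<in>Z. \<Sum>j<k. \<gamma> ^ j / fact j * (w u * w v * (g u \<bullet> g v) ^ j))"
    unfolding sum_subtractf[symmetric]
    by (intro sum.cong refl) (simp add: exp_tail_def algebra_simps sum_distrib_left power_mult_distrib)
  also have "\<dots> = (\<Sum>j<k. \<gamma> ^ j / fact j * (\<Sum>u\<in>Z. \<Sum>v\<in>Z. w u * w v * (g u \<bullet> g v) ^ j))"
    unfolding sum_distrib_left by (subst sum.swap[of _ _ Z], subst sum.swap[of _ _ Z]) simp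
  also have "\<dots> \<ge> 0" using assms by (intro sum_nonneg mult_nonneg_nonneg inner_power_psd) auto
  finally show ?thesis by simp
qed

text \<open>Up to a rescaling of the point masses, the Gaussian kernel is an exponential of inner products
  centred at an arbitrary point x. Centred at the evaluation point, the rescaling is trivial there, and
  the Taylor polynomials of the exponential turn zeros of a Gaussian sum into near-zeros of a
  polynomial.\<close>

lemma gaussian_factor:
  "gaussian \<beta> (u - v) = exp (- \<beta> * norm (u - x) ^ 2) * exp (- \<beta> * norm (v - x) ^ 2) * exp (2 * \<beta> * ((u - x) \<bullet> (v - x)))"
proof -
  have "norm (u - v) ^ 2 = norm (u - x) ^ 2 + norm (v - x) ^ 2 - 2 * ((u - x) \<bullet> (v - x))"
    by (simp add: power2_norm_eq_inner inner_diff algebra_simps inner_commute)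
  then have "- \<beta> * norm (u - v) ^ 2 = - \<beta> * norm (u - x) ^ 2 + - \<beta> * norm (v - x) ^ 2 + 2 * \<beta> * ((u - x) \<bullet> (v - x))"
    by (simp only: right_diff_distrib distrib_left)
  then show ?thesis by (simp only: gaussian_def exp_add)
qed

lemma gaussian_kernel_psd:
  assumes "\<beta> > 0"
  shows "psd_kernel (\<lambda>u v :: real^'n. gaussian \<beta> (u - v))"
  unfolding psd_kernel_def
proof (intro conjI allI impI)
  fix Z :: "(real^'n) set" and w :: "real^'n \<Rightarrow> real" assume Z: "finite Z"
  define w' where "w' = (\<lambda>u. w u * exp (- \<beta> * norm u ^ 2))"
  have "(\<Sum>u\<in>Z. \<Sum>v\<in>Z. w u * w v * gaussian \<beta> (u - v)) = (\<Sum>u\<in>Z. \<Sum>v\<in>Z. w' u * w' v * exp_tail 0 (2 * \<beta> * (u \<bullet> v)))"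
    by (intro sum.cong refl) (subst gaussian_factor[where x=0], simp add: w'_def exp_tail_def mult_ac)
  also have "\<dots> \<ge> 0" by (rule psd_kernelD(2)[OF exp_tail_kernel_psd Z]) (use assms in simp)
  finally show "(\<Sum>u\<in>Z. \<Sum>v\<in>Z. w u * w v * gaussian \<beta> (u - v)) \<ge> 0" .
qed (simp add: gaussian_def norm_minus_commute)

text \<open>With \<mu> orthogonal to the sections at Y, the quadratic form Q of \<mu> equals the value at x of
  U, the convolution of \<mu> with the Gaussian. After rescaling, U splits into a polynomial p and a tail. At x the
  tail vanishes, so p x = Q; on Y the sum vanishes, so p equals minus the tail, and
  Cauchy-Schwarz for the tail kernel bounds it by sqrt Q * \<eta>. The norming hypothesis then gives
  Q \<le> B * sqrt Q * \<eta>.\<close>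

lemma power_function_bound:
  fixes x :: "real^'n" and Y :: "(real^'n) set"
  assumes \<beta>: "\<beta> > 0" and Y: "finite Y" "x \<notin> Y" and R: "\<And>y. y \<in> Y \<Longrightarrow> norm (y - x) \<le> R" and k: "k > 0" and B: "B \<ge> 0"
    and norming: "\<And>p. total_deg_le (k - 1) p \<Longrightarrow> (\<And>y. y \<in> Y \<Longrightarrow> \<bar>p y\<bar> \<le> 1) \<Longrightarrow> \<bar>p x\<bar> \<le> B"
  shows "\<exists>\<mu>. \<mu> x = 1 \<and> sqrt (\<Sum>u\<in>insert x Y. \<Sum>v\<in>insert x Y. \<mu> u * \<mu> v * gaussian \<beta> (u - v))
    \<le> B * sqrt ((2 * \<beta> * R\<^sup>2) ^ k / fact k * exp (2 * \<beta> * R\<^sup>2))"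
proof -
  define Z where "Z = insert x Y"
  have Z: "finite Z" "x \<in> Z" using Y by (auto simp: Z_def)
  obtain c where c: "\<And>v. v \<in> Y \<Longrightarrow> gaussian \<beta> (v - x) = (\<Sum>y\<in>Y. c y * gaussian \<beta> (v - y))"
    using psd_kernel_section_in_span[OF gaussian_kernel_psd[OF \<beta>] Y(1), of x] by blast
  define \<mu> where "\<mu> = (\<lambda>z. if z = x then 1 else - c z)"
  define U where "U = (\<lambda>v. \<Sum>z\<in>Z. \<mu> z * gaussian \<beta> (v - z))"
  have U_eq: "U v = gaussian \<beta> (v - x) - (\<Sum>y\<in>Y. c y * gaussian \<beta> (v - y))" for v
  proof -
    have "(\<Sum>y\<in>Y. \<mu> y * gaussian \<beta> (v - y)) = - (\<Sum>y\<in>Y. c y * gaussian \<beta> (v - y))"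
      unfolding sum_negf[symmetric] using Y by (intro sum.cong) (auto simp: \<mu>_def)
    then show ?thesis using Y by (simp add: U_def Z_def \<mu>_def)
  qed
  have U0: "U v = 0" if "v \<in> Y" for v using c[OF that] by (simp add: U_eq)
  define Q where "Q = (\<Sum>u\<in>Z. \<Sum>v\<in>Z. \<mu> u * \<mu> v * gaussian \<beta> (u - v))"
  have Q_U: "Q = U x"
  proof -
    have "Q = (\<Sum>u\<in>Z. \<mu> u * U u)" by (simp add: Q_def U_def sum_distrib_left mult_ac)
    also have "\<dots> = \<mu> x * U x + (\<Sum>u\<in>Y. \<mu> u * U u)" unfolding Z_def using Y by simp
    also have "(\<Sum>u\<in>Y. \<mu> u * U u) = 0" using U0 by (intro sum.neutral) auto
    finally show ?thesis by (simp add: \<mu>_def)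
  qed
  have Q0: "Q \<ge> 0" unfolding Q_def by (rule psd_kernelD(2)[OF gaussian_kernel_psd[OF \<beta>] Z(1)])
  define w where "w = (\<lambda>z. \<mu> z * exp (- \<beta> * norm (z - x) ^ 2))"
  have U_w: "U v = exp (- \<beta> * norm (v - x) ^ 2) * (\<Sum>z\<in>Z. w z * exp (2 * \<beta> * ((z - x) \<bullet> (v - x))))" for v
    unfolding U_def sum_distrib_left
    by (intro sum.cong refl) (subst gaussian_factor[where x=x], simp add: w_def mult_ac inner_commute)
  have Q_w: "Q = (\<Sum>u\<in>Z. \<Sum>v\<in>Z. w u * w v * exp (2 * \<beta> * ((u - x) \<bullet> (v - x))))"
    unfolding Q_def by (intro sum.cong refl) (subst gaussian_factor[where x=x], simp add: w_def mult_ac)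
  define p where "p = (\<lambda>v. \<Sum>z\<in>Z. w z * (\<Sum>j<k. (2 * \<beta> * ((z - x) \<bullet> (v - x))) ^ j / fact j))"
  have p_deg: "total_deg_le (k - 1) p"
  proof -
    have lin: "total_deg_le 1 (\<lambda>v. 2 * \<beta> * ((z - x) \<bullet> (v - x)))" for z
    proof -
      have "total_deg_le 1 (\<lambda>v. 2 * \<beta> * (\<Sum>i\<in>UNIV. (z $ i - x $ i) * (v $ i - x $ i)))"
        by (intro total_deg_le_scale total_deg_le_sum total_deg_le_diff total_deg_le_coord total_deg_le.const)
      then show ?thesis by (simp add: inner_vec_def)
    qed
    have summand: "total_deg_le (k - 1) (\<lambda>v. (1 / fact j) * (2 * \<beta> * ((z - x) \<bullet> (v - x))) ^ j)" if "j < k" for j z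
    proof (rule total_deg_le_mono)
      show "total_deg_le (j * 1) (\<lambda>v. (1 / fact j) * (2 * \<beta> * ((z - x) \<bullet> (v - x))) ^ j)"
        by (rule total_deg_le_scale[OF total_deg_le_power[OF lin]])
    qed (use that in auto)
    have "total_deg_le (k - 1) (\<lambda>v. \<Sum>z\<in>Z. w z * (\<Sum>j<k. (1 / fact j) * (2 * \<beta> * ((z - x) \<bullet> (v - x))) ^ j))"
      by (rule total_deg_le_sum, rule total_deg_le_scale, rule total_deg_le_sum, rule summand) simp
    then show ?thesis by (simp add: p_def)
  qed
  have p_x: "p x = Q"
  proof -
    have "(\<Sum>j<k. (0::real) ^ j / fact j) = 1"
      using k by (cases k) (simp_all add: lessThan_Suc_eq_insert_0 sum.reindex)
    then show ?thesis unfolding Q_U U_w p_def by simp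
  qed
  define \<eta> where "\<eta> = sqrt ((2 * \<beta> * R\<^sup>2) ^ k / fact k * exp (2 * \<beta> * R\<^sup>2))"
  have \<eta>0: "\<eta> \<ge> 0" using \<beta> by (simp add: \<eta>_def)
  have p_Y: "\<bar>p v\<bar> \<le> sqrt Q * \<eta>" if v: "v \<in> Y" for v
  proof -
    define T where "T = (\<lambda>u v. exp_tail k (2 * \<beta> * ((u - x) \<bullet> (v - x))))"
    have vZ: "v \<in> Z" using v by (simp add: Z_def)
    have "(\<Sum>z\<in>Z. w z * exp (2 * \<beta> * ((z - x) \<bullet> (v - x)))) = 0" using U0[OF v] U_w[of v] by simp
    then have p_err: "p v = - (\<Sum>z\<in>Z. w z * T z v)"
      by (simp add: p_def T_def exp_tail_def right_diff_distrib sum_subtractf)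
    have ind: "(\<Sum>u\<in>Z. g u * (if u = v then 1 else 0)) = g v" for g :: "real^'n \<Rightarrow> real"
    proof -
      have "(\<Sum>u\<in>Z. g u * (if u = v then 1 else 0)) = (\<Sum>u\<in>Z. if u = v then g v else 0)"
        by (rule sum.cong) auto
      then show ?thesis using vZ Z(1) by (simp add: sum.delta)
    qed
    have "(\<Sum>u\<in>Z. \<Sum>v'\<in>Z. w u * (if v' = v then 1 else 0) * T u v')\<^sup>2
      \<le> (\<Sum>u\<in>Z. \<Sum>v'\<in>Z. w u * w v' * T u v') * (\<Sum>u\<in>Z. \<Sum>v'\<in>Z. (if u = v then 1 else 0) * (if v' = v then 1 else 0) * T u v')"
      unfolding T_def by (rule psd_kernel_Cauchy_Schwarz[OF exp_tail_kernel_psd Z(1)]) (use \<beta> in simp)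
    also have "(\<Sum>u\<in>Z. \<Sum>v'\<in>Z. w u * (if v' = v then 1 else 0) * T u v') = (\<Sum>u\<in>Z. w u * T u v)"
      using ind[of "\<lambda>v'. w u * T u v'" for u] by (simp add: mult_ac)
    also have "(\<Sum>u\<in>Z. \<Sum>v'\<in>Z. (if u = v then 1 else 0) * (if v' = v then 1 else 0) * T u v') = T v v"
    proof -
      have "(\<Sum>v'\<in>Z. (if u = v then 1 else 0) * (if v' = v then 1 else 0) * T u v') = T u v * (if u = v then 1 else 0)" for u
        using ind[of "\<lambda>v'. (if u = v then 1 else 0) * T u v'"] by (simp add: mult_ac)
      then show ?thesis using ind[of "\<lambda>u. T u v"] by simp
    qed
    finally have "(p v)\<^sup>2 \<le> (\<Sum>u\<in>Z. \<Sum>v'\<in>Z. w u * w v' * T u v') * T v v" by (simp add: p_err)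
    also have "\<dots> \<le> Q * \<eta>\<^sup>2"
    proof (rule mult_mono)
      show "(\<Sum>u\<in>Z. \<Sum>v'\<in>Z. w u * w v' * T u v') \<le> Q"
        unfolding Q_w T_def by (rule exp_tail_kernel_le_exp) (use \<beta> in auto)
      have r: "norm (v - x) ^ 2 \<le> R\<^sup>2" using R[OF v] by (intro power_mono) auto
      define s where "s = 2 * \<beta> * norm (v - x) ^ 2"
      have s: "0 \<le> s" "s \<le> 2 * \<beta> * R\<^sup>2" using r \<beta> by (auto simp: s_def)
      have "T v v = exp_tail k s" by (simp add: T_def s_def power2_norm_eq_inner)
      also have "\<dots> \<le> s ^ k / fact k * exp s" by (rule exp_tail_le[OF s(1)])
      also have "\<dots> \<le> (2 * \<beta> * R\<^sup>2) ^ k / fact k * exp (2 * \<beta> * R\<^sup>2)"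
        using s by (intro mult_mono divide_right_mono power_mono) auto
      also have "\<dots> = \<eta>\<^sup>2" using \<beta> by (simp add: \<eta>_def)
      finally show "T v v \<le> \<eta>\<^sup>2" .
      have "0 \<le> (\<Sum>u\<in>{v}. \<Sum>v'\<in>{v}. 1 * 1 * T u v')"
        unfolding T_def by (rule psd_kernelD(2)[OF exp_tail_kernel_psd]) (use \<beta> in auto)
      then show "0 \<le> T v v" by simp
    qed (use Q0 in auto)
    also have "\<dots> = (sqrt Q * \<eta>)\<^sup>2" using Q0 by (simp add: power_mult_distrib)
    finally have "\<bar>p v\<bar>\<^sup>2 \<le> (sqrt Q * \<eta>)\<^sup>2" by simp
    then show ?thesis by (rule power2_le_imp_le) (use Q0 \<eta>0 in simp)
  qed
  \<comment> \<open>The slack \<epsilon> makes the scaling factor of p positive even if p vanishes on Y.\<close>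
  have Q_eps: "Q \<le> B * (sqrt Q * \<eta> + \<epsilon>)" if "\<epsilon> > 0" for \<epsilon>
  proof -
    define M where "M = sqrt Q * \<eta> + \<epsilon>"
    have M: "M > 0" using that Q0 \<eta>0 by (simp add: M_def add_nonneg_pos)
    have "\<bar>(1 / M) * p x\<bar> \<le> B"
    proof (rule norming[of "\<lambda>v. (1 / M) * p v", OF total_deg_le_scale[OF p_deg]])
      fix y assume "y \<in> Y"
      then show "\<bar>(1 / M) * p y\<bar> \<le> 1" using p_Y[of y] that M by (simp add: abs_mult M_def)
    qed
    then have "Q \<le> B * M" using M Q0 p_x by (simp add: abs_mult field_simps)
    then show ?thesis by (simp only: M_def)
  qed
  have "Q \<le> B * (sqrt Q * \<eta>) + \<epsilon>" if "\<epsilon> > 0" for \<epsilon>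
  proof (cases "B = 0")
    case True
    then show ?thesis using Q_eps[of 1] that by simp
  next
    case False
    then have "Q \<le> B * (sqrt Q * \<eta> + \<epsilon> / B)" using Q_eps[of "\<epsilon> / B"] B that by simp
    then show ?thesis using False by (simp add: distrib_left)
  qed
  then have Qle: "Q \<le> B * (sqrt Q * \<eta>)" by (rule field_le_epsilon)
  have "sqrt Q \<le> B * \<eta>"
  proof (cases "Q = 0")
    case False
    then have pos: "sqrt Q > 0" using Q0 by simp
    have "sqrt Q * sqrt Q \<le> (B * \<eta>) * sqrt Q" using Qle Q0 by (simp add: mult_ac)
    then show ?thesis using pos by (rule mult_right_le_imp_le)
  qed (use B \<eta>0 in auto)
  then show ?thesis unfolding Q_def \<eta>_def Z_def by (intro exI[of _ \<mu>]) (simp add: \<mu>_def)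
qed

section \<open>Comparison of constants\<close>

text \<open>Here \<tau>^2 = 2 * \<beta> * R^2 for R = sqrt n * b0, and a is the fourth root of K * b0 / \<gamma>. The base a^4 / L of the right-hand side is at most
  1 and L / 8 \<le> k / 4, so it suffices to compare with the exponent k / 4, that is with
  a^k / L^(k/4). Stirling's k^k \<le> e^k * k! shows that L^(k/4) costs less than the
  sqrt (k!) that the tail provides, and a contains the factor exp (2 * n * \<gamma>), whose k-th power
  dominates the norming constant (4 * exp \<gamma>)^(k * n) with enough room for the lower bound
  n^(-n) of the prefactor.\<close>

lemma constant_comparison:
  fixes n k N :: nat and \<gamma> L \<tau> a \<Delta> :: real
  assumes n: "n \<ge> 1" and \<gamma>: "\<gamma> \<ge> 2 * real n" and k: "k \<ge> 1" and L: "0 < L" "L \<le> 2 * real k"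
    and \<tau>: "\<tau> > 0" and a: "a = 3 * exp (1/2) * exp (2 * real n * \<gamma>) * \<tau>" and aL: "a ^ 4 \<le> L"
    and N: "real N \<le> 2 * \<gamma> * real k" and \<Delta>: "\<Delta> * real n ^ n \<ge> 1"
  shows "4 * ((2 * real N) ^ (k - 1) / fact (k - 1)) ^ n * sqrt ((\<tau>\<^sup>2) ^ k / fact k * exp (\<tau>\<^sup>2))
    \<le> \<Delta> * (a ^ 4 / L) powr (L / 8)"
proof -
  have a0: "a > 0" using \<tau> by (simp add: a)
  have \<Delta>0: "\<Delta> \<ge> 0"
  proof (rule ccontr)
    assume "\<not> \<Delta> \<ge> 0"
    then have "\<Delta> * real n ^ n \<le> 0" by (intro mult_nonpos_nonneg) auto
    then show False using \<Delta> by simp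
  qed
  have g2: "\<gamma> \<ge> 2" using \<gamma> n by simp
  have kk: "real k ^ k \<le> exp (real k) * fact k"
    using power_div_fact_le_exp[of "real k" k] by (simp add: field_simps)
  define D where "D = (2 * real N) ^ (k - 1) / fact (k - 1)"
  have "D \<le> (4 * \<gamma> * real k) ^ (k - 1) / fact (k - 1)"
    unfolding D_def using N by (intro divide_right_mono power_mono) auto
  also have "\<dots> = (4 * \<gamma>) ^ (k - 1) * (real k ^ (k - 1) / fact (k - 1))"
    by (simp add: power_mult_distrib)
  also have "real k ^ (k - 1) / fact (k - 1) = real k ^ k / fact k"
  proof -
    have "real k ^ k = real k * real k ^ (k - 1)" "fact k = real k * fact (k - 1)"
      using k power_minus_mult[of k "real k"] fact_reduce[of k] by (auto simp: mult.commute)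
    then show ?thesis using k by simp
  qed
  also have "(4 * \<gamma>) ^ (k - 1) * (real k ^ k / fact k) \<le> (4 * \<gamma>) ^ (k - 1) * exp (real k)"
    using g2 by (intro mult_left_mono power_div_fact_le_exp) auto
  finally have D1: "D \<le> (4 * \<gamma>) ^ (k - 1) * exp (real k)" .
  have "4 * D \<le> (4 * exp \<gamma>) ^ k"
  proof -
    have "4 * D \<le> (4 * \<gamma>) * ((4 * \<gamma>) ^ (k - 1) * exp (real k))"
      using D1 g2 by (intro mult_mono) (auto simp: D_def)
    also have "\<dots> = (4 * (\<gamma> * exp 1)) ^ k"
    proof -
      have "exp (real k) = exp 1 ^ k" by (simp flip: exp_of_nat_mult)
      moreover have "(4 * \<gamma>) * (4 * \<gamma>) ^ (k - 1) = (4 * \<gamma>) ^ k" using k by (cases k) auto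
      ultimately have "(4 * \<gamma>) * ((4 * \<gamma>) ^ (k - 1) * exp (real k)) = (4 * \<gamma>) ^ k * exp 1 ^ k"
        by (metis mult.assoc)
      also have "\<dots> = (4 * \<gamma> * exp 1) ^ k" by (simp only: power_mult_distrib)
      finally show ?thesis by (simp only: mult.assoc)
    qed
    also have "\<dots> \<le> (4 * exp \<gamma>) ^ k"
    proof (intro power_mono mult_left_mono)
      have "\<gamma> * exp 1 \<le> exp (\<gamma> - 1) * exp 1"
        using exp_ge_add_one_self[of "\<gamma> - 1"] by (intro mult_right_mono) auto
      then show "\<gamma> * exp 1 \<le> exp \<gamma>" by (simp flip: exp_add)
    qed (use g2 in auto)
    finally show ?thesis .
  qed
  have D0: "D \<ge> 0" by (simp add: D_def)
  have "4 * D ^ n \<le> (4 * D) ^ n"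
    using D0 n self_le_power[of "4::real" n] by (auto simp: power_mult_distrib intro!: mult_right_mono)
  also have "\<dots> \<le> ((4 * exp \<gamma>) ^ k) ^ n"
    using \<open>4 * D \<le> (4 * exp \<gamma>) ^ k\<close> D0 by (intro power_mono) auto
  also have "\<dots> \<le> \<Delta> * exp (2 * real n * \<gamma>) ^ k"
  proof -
    have "exp 1 * exp (\<gamma> - 1) \<ge> 2 * \<gamma>"
      using exp_ge_add_one_self[of 1] exp_ge_add_one_self[of "\<gamma> - 1"] g2 by (intro mult_mono) auto
    then have "exp \<gamma> \<ge> 2 * \<gamma>" by (simp flip: exp_add)
    then have e4: "exp \<gamma> / 4 \<ge> real n" using \<gamma> by simp
    have "real n ^ n \<le> (exp \<gamma> / 4) ^ n" using e4 by (intro power_mono) auto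
    also have "\<dots> \<le> (exp \<gamma> / 4) ^ (k * n)" using e4 n k by (intro power_increasing) auto
    finally have "1 \<le> \<Delta> * (exp \<gamma> / 4) ^ (k * n)"
      using \<Delta> mult_left_mono[OF _ \<Delta>0] order_trans by blast
    then have "1 * (4 * exp \<gamma>) ^ (k * n) \<le> \<Delta> * (exp \<gamma> / 4) ^ (k * n) * (4 * exp \<gamma>) ^ (k * n)"
      by (intro mult_right_mono) auto
    also have "\<dots> = \<Delta> * ((exp \<gamma> / 4) * (4 * exp \<gamma>)) ^ (k * n)" by (simp only: power_mult_distrib mult.assoc)
    also have "(exp \<gamma> / 4) * (4 * exp \<gamma>) = exp (2 * \<gamma>)" by (simp flip: exp_add)
    also have "exp (2 * \<gamma>) ^ (k * n) = exp (2 * real n * \<gamma>) ^ k"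
      by (simp flip: exp_of_nat_mult add: mult_ac)
    finally show ?thesis by (simp add: power_mult)
  qed
  finally have norm_const: "4 * D ^ n \<le> \<Delta> * exp (2 * real n * \<gamma>) ^ k" .
  have "(81 * \<tau> ^ 4 :: real) \<le> a ^ 4"
  proof -
    have "1 * 1 \<le> exp (1/2) * exp (2 * real n * \<gamma>)"
      using g2 by (intro mult_mono) auto
    then have "3 * \<tau> * 1 \<le> 3 * \<tau> * (exp (1/2) * exp (2 * real n * \<gamma>))" using \<tau> by (intro mult_left_mono) auto
    then have "3 * \<tau> \<le> a" by (simp add: a mult_ac)
    then have "(3 * \<tau>) ^ 4 \<le> a ^ 4" using \<tau> by (intro power_mono) auto
    then show ?thesis by (simp add: power_mult_distrib)
  qed
  then have "(\<tau>\<^sup>2)\<^sup>2 \<le> real k" using aL L k by simp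
  also have "\<dots> \<le> (real k)\<^sup>2" using k by (simp add: power2_eq_square)
  finally have \<tau>k: "\<tau>\<^sup>2 \<le> real k" by (rule power2_le_imp_le) simp
  have tail: "sqrt ((\<tau>\<^sup>2) ^ k / fact k * exp (\<tau>\<^sup>2)) \<le> \<tau> ^ k / sqrt (fact k) * sqrt 3 ^ k"
  proof -
    have "exp (\<tau>\<^sup>2) \<le> exp (real k)" using \<tau>k by simp
    also have "\<dots> = exp 1 ^ k" by (simp flip: exp_of_nat_mult)
    also have "\<dots> \<le> 3 ^ k" using exp_le by (intro power_mono) auto
    finally have "sqrt ((\<tau>\<^sup>2) ^ k / fact k * exp (\<tau>\<^sup>2)) \<le> sqrt ((\<tau>\<^sup>2) ^ k / fact k * 3 ^ k)"
      by (intro real_sqrt_le_mono mult_left_mono) auto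
    also have "\<dots> = \<tau> ^ k / sqrt (fact k) * sqrt 3 ^ k"
      using \<tau> by (simp add: real_sqrt_mult real_sqrt_divide real_sqrt_power)
    finally show ?thesis .
  qed
  have "L powr (k / 4) \<le> sqrt 2 ^ k * exp (1/2) ^ k * sqrt (fact k)"
  proof -
    have "L powr (k / 4) \<le> (2 * real k) powr (k / 4)" using L by (intro powr_mono2) auto
    also have "\<dots> \<le> (2 * real k) powr (k / 2)" using k by (intro powr_mono) auto
    also have "\<dots> = sqrt ((2 * real k) ^ k)"
    proof -
      have "y powr (k / 2) = sqrt (y ^ k)" if "y > 0" for y :: real
        using that by (simp add: powr_half_sqrt[symmetric] powr_powr flip: powr_realpow)
      then show ?thesis using k by simp
    qed
    also have "\<dots> \<le> sqrt (2 ^ k * (exp 1 ^ k * fact k))"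
      using kk by (intro real_sqrt_le_mono) (simp add: power_mult_distrib flip: exp_of_nat_mult)
    also have "\<dots> = sqrt 2 ^ k * sqrt (exp 1) ^ k * sqrt (fact k)"
      by (simp add: real_sqrt_mult real_sqrt_power)
    also have "sqrt (exp 1) = exp (1/2 :: real)"
      by (rule real_sqrt_unique) (simp_all add: power2_eq_square flip: exp_add)
    finally show ?thesis .
  qed
  then have "a ^ k / (sqrt 2 ^ k * exp (1/2) ^ k * sqrt (fact k)) \<le> a ^ k / L powr (k / 4)"
    using a0 L by (intro divide_left_mono) auto
  also have "\<dots> = (a ^ 4 / L) powr (k / 4)"
  proof -
    have "a ^ 4 = a powr 4" using a0 by (simp add: powr_numeral)
    then have "(a ^ 4) powr (k / 4) = a powr (4 * (k / 4))" by (simp only: powr_powr)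
    also have "\<dots> = a ^ k" using a0 by (simp add: powr_realpow)
    finally have "(a ^ 4) powr (k / 4) = a ^ k" .
    then show ?thesis using a0 L by (simp add: powr_divide)
  qed
  also have "\<dots> \<le> (a ^ 4 / L) powr (L / 8)"
    using a0 L aL by (intro powr_mono') auto
  finally have rhs: "a ^ k / (sqrt 2 ^ k * exp (1/2) ^ k * sqrt (fact k)) \<le> (a ^ 4 / L) powr (L / 8)" .
  have "4 * D ^ n * sqrt ((\<tau>\<^sup>2) ^ k / fact k * exp (\<tau>\<^sup>2))
      \<le> (\<Delta> * exp (2 * real n * \<gamma>) ^ k) * (\<tau> ^ k / sqrt (fact k) * sqrt 3 ^ k)"
    by (rule mult_mono[OF norm_const tail]) (use \<Delta>0 in auto)
  also have "\<dots> \<le> \<Delta> * (a ^ k / (sqrt 2 ^ k * exp (1/2) ^ k * sqrt (fact k)))"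
  proof -
    have "sqrt 3 * sqrt 2 \<le> (3::real)"
      by (simp add: real_le_lsqrt flip: real_sqrt_mult)
    then have "(sqrt 3 * sqrt 2) ^ k \<le> (3::real) ^ k" by (intro power_mono) auto
    then have s: "sqrt 3 ^ k \<le> 3 ^ k / sqrt 2 ^ k" by (simp add: power_mult_distrib field_simps)
    have "a ^ k = 3 ^ k * exp (1/2) ^ k * exp (2 * real n * \<gamma>) ^ k * \<tau> ^ k"
      by (simp only: a power_mult_distrib)
    then have "a ^ k / (sqrt 2 ^ k * exp (1/2) ^ k * sqrt (fact k))
        = exp (2 * real n * \<gamma>) ^ k * (\<tau> ^ k / sqrt (fact k)) * (3 ^ k / sqrt 2 ^ k)"
      by (simp add: mult_ac)
    moreover have "\<dots> \<ge> exp (2 * real n * \<gamma>) ^ k * (\<tau> ^ k / sqrt (fact k)) * sqrt 3 ^ k"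
      using \<tau> s by (intro mult_left_mono) auto
    ultimately have "exp (2 * real n * \<gamma>) ^ k * (\<tau> ^ k / sqrt (fact k)) * sqrt 3 ^ k
        \<le> a ^ k / (sqrt 2 ^ k * exp (1/2) ^ k * sqrt (fact k))" by linarith
    from mult_left_mono[OF this \<Delta>0] show ?thesis by (simp only: mult.assoc)
  qed
  also have "\<dots> \<le> \<Delta> * (a ^ 4 / L) powr (L / 8)" using rhs \<Delta>0 by (intro mult_left_mono)
  finally show ?thesis by (simp add: D_def)
qed

text \<open>The unit ball contains the cube of side 1 / n around its centre.\<close>

lemma unit_ball_measure_ge:
  "measure lborel (ball (0 :: real^'n) 1) \<ge> (1 / real CARD('n)) ^ CARD('n)"
proof -
  define n where "n = CARD('n)"
  have n: "n > 0" by (simp add: n_def)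
  define B :: "(real^'n) set" where "B = cbox (\<chi> i. - 1 / (2 * real n)) (\<chi> i. 1 / (2 * real n))"
  have "B \<subseteq> ball 0 1"
  proof
    fix x assume "x \<in> B"
    then have "\<bar>x $ i\<bar> \<le> 1 / (2 * real n)" for i
      by (auto simp: B_def mem_box_cart abs_le_iff minus_le_iff)
    then have "(\<Sum>i\<in>UNIV. \<bar>x $ i\<bar>) \<le> (\<Sum>i\<in>(UNIV::'n set). 1 / (2 * real n))" by (intro sum_mono)
    then have "norm x \<le> 1 / 2" using norm_le_l1_cart[of x] n by (simp add: n_def)
    then show "x \<in> ball 0 1" by simp
  qed
  then have "measure lborel B \<le> measure lborel (ball (0 :: real^'n) 1)"
    by (intro measure_mono_fmeasurable fmeasurableI emeasure_lborel_ball_finite) (auto simp: B_def)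
  moreover have "measure lborel B = (1 / real n) ^ n"
  proof -
    have "B \<noteq> {}" using n by (auto simp: B_def interval_ne_empty_cart)
    then have "measure lborel B = (\<Prod>i\<in>(UNIV::'n set). 1 / (2 * real n) - - 1 / (2 * real n))"
      unfolding B_def by (subst content_cbox_cart) auto
    also have "\<dots> = (1 / real n) ^ n" by (simp add: n_def)
    finally show ?thesis .
  qed
  ultimately show ?thesis by (simp add: n_def)
qed

lemma powr_two_sqrt3_e_ge_1:
  assumes "0 \<le> q" "q \<le> r"
  shows "2 powr r * (sqrt 3 / exp 1) powr q \<ge> 1"
proof -
  have "sqrt 3 \<ge> 3/2" by (rule real_le_rsqrt) (simp add: power2_eq_square)
  then have "sqrt 3 / exp 1 \<ge> (3/2) / 3" using exp_le by (intro frac_le) auto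
  then have "(sqrt 3 / exp 1) powr q \<ge> (1 / 2) powr q" using assms by (intro powr_mono2) auto
  then have "2 powr r * (sqrt 3 / exp 1) powr q \<ge> 2 powr r * (1 / 2) powr q" by (intro mult_left_mono) auto
  also have "2 powr r * (1 / 2) powr q = 2 powr (r - q)" by (simp add: powr_diff powr_divide)
  finally have "2 powr r * (sqrt 3 / exp 1) powr q \<ge> 2 powr (r - q)" .
  moreover have "2 powr (r - q) \<ge> (1::real)" using assms by (intro ge_one_powr_ge_zero) auto
  ultimately show ?thesis by linarith
qed

text \<open>A crude bound is enough, since the norming estimate leaves room for a factor exponential in n.\<close>

lemma prefactor_ge:
  assumes n: "n \<ge> 1" and \<alpha>: "\<alpha> \<ge> (1 / real n) ^ n"
    and \<Delta>: "\<Delta> = (if even n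
                 then pi powr ((real n - 1) / 4) * sqrt (real n * \<alpha>) * 2 powr ((real n + 1) / 4)
                      * (sqrt 3 / exp 1) powr ((real n - 2) / 4)
                 else pi powr ((real n - 1) / 4) * sqrt (real n * \<alpha>) * sqrt (2 + 1 / exp 1)
                      * 2 powr (real n / 4) * (sqrt 3 / exp 1) powr ((real n - 1) / 4))"
  shows "\<Delta> * real n ^ n \<ge> 1"
proof -
  define x where "x = (1 / real n) ^ n"
  have x: "0 < x" "x \<le> 1" using n by (auto simp: x_def intro!: power_le_one)
  have "1 * x \<le> real n * \<alpha>" using n \<alpha> x by (intro mult_mono) (auto simp: x_def)
  moreover have "x ^ 2 \<le> x" using x by (simp add: power2_eq_square mult_left_le_one_le)
  ultimately have s: "sqrt (real n * \<alpha>) \<ge> x" by (intro real_le_rsqrt) linarith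
  have s0: "0 \<le> real n * \<alpha>" using \<open>1 * x \<le> real n * \<alpha>\<close> x by linarith
  have p: "pi powr ((real n - 1) / 4) \<ge> 1" using n pi_ge_two by (intro ge_one_powr_ge_zero) auto
  have "\<Delta> \<ge> x"
  proof (cases "even n")
    case True
    then have "n \<ge> 2" using n by (cases "n = 1") auto
    then have q: "2 powr ((real n + 1) / 4) * (sqrt 3 / exp 1) powr ((real n - 2) / 4) \<ge> 1"
      by (intro powr_two_sqrt3_e_ge_1) auto
    have "1 * x * 1 \<le> pi powr ((real n - 1) / 4) * sqrt (real n * \<alpha>) *
        (2 powr ((real n + 1) / 4) * (sqrt 3 / exp 1) powr ((real n - 2) / 4))"
      using p s s0 q x by (intro mult_mono) auto
    then show ?thesis using True by (simp add: \<Delta> mult.assoc)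
  next
    case False
    have q: "2 powr (real n / 4) * (sqrt 3 / exp 1) powr ((real n - 1) / 4) \<ge> 1"
      using n by (intro powr_two_sqrt3_e_ge_1) auto
    have r: "sqrt (2 + 1 / exp 1) \<ge> 1" by simp
    have "1 * x * 1 * 1 \<le> pi powr ((real n - 1) / 4) * sqrt (real n * \<alpha>) * sqrt (2 + 1 / exp 1) *
        (2 powr (real n / 4) * (sqrt 3 / exp 1) powr ((real n - 1) / 4))"
      using p s s0 q r x by (intro mult_mono) auto
    then show ?thesis using False by (simp add: \<Delta> mult.assoc)
  qed
  then have "\<Delta> * real n ^ n \<ge> x * real n ^ n" by (intro mult_right_mono) auto
  moreover have "x * real n ^ n = 1" using n by (simp add: x_def power_divide)
  ultimately show ?thesis by simp
qed

text \<open>The powers of 3 and of e collect: 3^(3/4) * 3^(1/4) = 3, and e / sqrt e = sqrt e.\<close>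

lemma constant_normalization:
  assumes "\<beta> > 0"
  shows "3 powr (3/4) * exp 1 * sqrt (2 * (sqrt 3 / exp 1) * \<beta>) * sqrt (real n) * e * b0
    = 3 * exp (1/2) * e * (sqrt (2 * \<beta> * real n) * b0)"
proof -
  have s3: "sqrt (sqrt 3) = 3 powr (1/4 :: real)"
    by (simp add: powr_half_sqrt[symmetric] powr_powr)
  have se: "sqrt (exp 1) = exp (1/2 :: real)"
    by (rule real_sqrt_unique) (simp_all add: power2_eq_square flip: exp_add)
  have A: "3 powr (3/4) * sqrt (sqrt 3) = (3::real)" unfolding s3 by (simp flip: powr_add)
  have E: "exp 1 / sqrt (exp 1) = (exp (1/2) :: real)" unfolding se by (simp flip: exp_diff)
  have S: "sqrt (2 * (sqrt 3 / exp 1) * \<beta>) * sqrt (real n) = sqrt (sqrt 3) / sqrt (exp 1) * sqrt (2 * \<beta> * real n)"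
    by (simp add: real_sqrt_mult real_sqrt_divide)
  have rearrange: "u * v * w * z * e * b0 = u * v * (w * z) * e * b0"
    "u * v * (w' / v' * z') * e * b0 = (u * w') * (v / v') * e * (z' * b0)" for u v w z w' v' z' :: real
    by (simp_all add: mult_ac)
  show ?thesis unfolding rearrange(1) S unfolding rearrange(2) A E ..
qed

section \<open>The error estimate\<close>

lemma total_deg_le_affine:
  assumes "total_deg_le d p"
  shows "total_deg_le d (\<lambda>t. p (q + \<delta> *\<^sub>R t))"
  using assms
proof (induction rule: total_deg_le.induct)
  case (coord d f i)
  have "total_deg_le (Suc d) (\<lambda>t. q $ i * f (q + \<delta> *\<^sub>R t) + \<delta> * (t $ i * f (q + \<delta> *\<^sub>R t)))"
    by (intro total_deg_le.add total_deg_le_scale total_deg_le.coord total_deg_le_Suc coord.IH)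
  then show ?case by (simp add: algebra_simps)
qed (auto intro: total_deg_le.intros)

text \<open>Evaluating f and s separately against the same masses, on whose Y-part they agree, leaves f - s at
  x. The isometry A transports the masses, and with them the coordinates of the grid, to the cube.\<close>

lemma native_residual_bound:
  fixes f s :: "real^'n \<Rightarrow> complex" and A :: "real^'n \<Rightarrow> real^'n"
  assumes \<beta>: "\<beta> > 0" and f: "f \<in> native_space (gaussian \<beta>)" and s: "is_spline_interpolant (gaussian \<beta>) X f s"
    and A: "\<And>u v. norm (A u - A v) = norm (u - v)"
    and Z: "finite Y" "x \<notin> Y" "\<And>y. y \<in> Y \<Longrightarrow> A y \<in> X" and \<mu>: "\<mu> x = 1"
  shows "cmod (f (A x) - s (A x)) \<le> 2 * native_norm (gaussian \<beta>) f *
    sqrt (\<Sum>u\<in>insert x Y. \<Sum>v\<in>insert x Y. \<mu> u * \<mu> v * gaussian \<beta> (u - v))"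
proof -
  define Q where "Q = (\<Sum>u\<in>insert x Y. \<Sum>v\<in>insert x Y. \<mu> u * \<mu> v * gaussian \<beta> (u - v))"
  have inj: "inj A" using A by (metis eq_iff_diff_eq_0 injI norm_eq_zero)
  have val: "cmod (\<Sum>z\<in>insert x Y. of_real (\<mu> z) * g (A z)) \<le> native_norm (gaussian \<beta>) g * sqrt Q"
    if g: "g \<in> native_space (gaussian \<beta>)" for g
  proof -
    have "continuous_on UNIV g" using g by (simp add: native_space_def)
    from native_bound_atoms[OF this gaussian_continuous native_norm_attained[OF g],
        of "A ` insert x Y" "\<lambda>z. \<mu> (inv A z)"]
    have "cmod (\<Sum>z\<in>A ` insert x Y. of_real (\<mu> (inv A z)) * g z) \<le> native_norm (gaussian \<beta>) g *
        sqrt (\<Sum>z\<in>A ` insert x Y. \<Sum>w\<in>A ` insert x Y. \<mu> (inv A z) * \<mu> (inv A w) * gaussian \<beta> (z - w))"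
      using Z by simp
    moreover have "gaussian \<beta> (A u - A v) = gaussian \<beta> (u - v)" for u v by (simp add: gaussian_def A)
    ultimately show ?thesis
      unfolding Q_def by (simp only: sum.reindex[OF inj_on_subset[OF inj subset_UNIV]] o_def inv_f_f[OF inj])
  qed
  have sn: "s \<in> native_space (gaussian \<beta>)" "native_norm (gaussian \<beta>) s \<le> native_norm (gaussian \<beta>) f"
    "\<And>x. x \<in> X \<Longrightarrow> s x = f x"
    using s f unfolding is_spline_interpolant_def by auto
  have "Q \<ge> 0"
    unfolding Q_def by (rule psd_kernelD(2)[OF gaussian_kernel_psd[OF \<beta>]]) (use Z in simp)
  then have s_le: "native_norm (gaussian \<beta>) s * sqrt Q \<le> native_norm (gaussian \<beta>) f * sqrt Q"
    using sn(2) by (intro mult_right_mono) auto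
  have "(\<Sum>z\<in>Y. of_real (\<mu> z) * s (A z)) = (\<Sum>z\<in>Y. of_real (\<mu> z) * f (A z))"
    using Z(3) sn(3) by (intro sum.cong) auto
  then have "f (A x) - s (A x) = (\<Sum>z\<in>insert x Y. of_real (\<mu> z) * f (A z)) - (\<Sum>z\<in>insert x Y. of_real (\<mu> z) * s (A z))"
    using Z(1,2) \<mu> by simp
  also have "cmod \<dots> \<le> native_norm (gaussian \<beta>) f * sqrt Q + native_norm (gaussian \<beta>) s * sqrt Q"
    by (rule order_trans[OF norm_triangle_ineq4 add_mono[OF val[OF f] val[OF sn(1)]]])
  also have "\<dots> \<le> 2 * native_norm (gaussian \<beta>) f * sqrt Q" using s_le by linarith
  finally show ?thesis by (simp add: Q_def)
qed

lemma native_norm_nonneg: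
  fixes f :: "real^'n \<Rightarrow> complex"
  assumes f: "f \<in> native_space (gaussian \<beta>)"
  shows "native_norm (gaussian \<beta>) f \<ge> 0"
proof -
  have "continuous_on UNIV f" using f by (simp add: native_space_def)
  from native_bound_atoms[OF this gaussian_continuous native_norm_attained[OF f], of "{0}" "\<lambda>_. 1"]
  have "cmod (f 0) \<le> native_norm (gaussian \<beta>) f" by (simp add: gaussian_def)
  then show ?thesis using norm_ge_zero order_trans by blast
qed

theorem theorem1:
  fixes \<beta> b0 \<rho> \<alpha> K c C \<delta>n \<delta>0 \<Delta> b \<delta> :: real
    and n :: nat
    and f s :: "real^'n \<Rightarrow> complex"
    and X E :: "(real^'n) set"
    and T :: "real^'n \<Rightarrow> real^'n" and p :: "real^'n"
  assumes n: "n = CARD('n)"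
    and \<beta>: "\<beta> > 0"
    and b0: "b0 > 0"
    and \<rho>: "\<rho> = sqrt 3 / exp 1"
    and \<alpha>: "\<alpha> = measure lborel (ball (0 :: real^'n) 1)"
    and K: "K = (3 powr (3/4) * exp 1 * sqrt (2 * \<rho> * \<beta>) * sqrt (real n)
                 * exp (2 * real n * gam n)) ^ 4 * b0 ^ 3 * gam n"
    and c: "c = b0 / (8 * gam n)"
    and C: "C = K"
    and \<delta>n: "\<delta>n = (if n = 1 \<or> n = 2 then b0 / (2 * gam n)
                    else if odd n then b0 / (2 * gam n * (real n - 1))
                    else b0 / (2 * gam n * (real n - 2)))"
    and \<delta>0: "\<delta>0 = min (1 / K) \<delta>n"
    and \<Delta>: "\<Delta> = (if even n
                 then pi powr ((real n - 1) / 4) * sqrt (real n * \<alpha>) * 2 powr ((real n + 1) / 4)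
                      * (sqrt 3 / exp 1) powr ((real n - 2) / 4)
                 else pi powr ((real n - 1) / 4) * sqrt (real n * \<alpha>) * sqrt (2 + 1 / exp 1)
                      * 2 powr (real n / 4) * (sqrt 3 / exp 1) powr ((real n - 1) / 4))"
    and f: "f \<in> native_space (gaussian \<beta>)"
    and s: "is_spline_interpolant (gaussian \<beta>) X f s"
    and T: "orthogonal_transformation T"
    and E: "E = cube T p b"
    and b: "b \<ge> b0"
    and \<delta>: "0 < \<delta>" "\<delta> \<le> \<delta>0"
    and X: "\<And>q. cube T q \<delta> \<subseteq> E \<Longrightarrow> \<exists>x\<in>X. x \<in> cube T q \<delta>"
  shows "\<forall>x\<in>E. cmod (f x - s x) \<le> \<Delta> * (C * \<delta>) powr (c / \<delta>) * native_norm (gaussian \<beta>) f"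
proof
  fix x0 assume x0: "x0 \<in> E"
  define \<gamma> where "\<gamma> = gam n"
  have n1: "n \<ge> 1" by (simp add: n Suc_le_eq)
  obtain G where G: "gam n = real G" using gam_nat by blast
  have \<gamma>2n: "\<gamma> \<ge> 2 * real n" using gam_ge_2n[OF n1] by (simp add: \<gamma>_def)
  then have \<gamma>2: "\<gamma> \<ge> 2" using n1 by simp
  define \<tau> where "\<tau> = sqrt (2 * \<beta> * real n) * b0"
  define a where "a = 3 * exp (1/2) * exp (2 * real n * \<gamma>) * \<tau>"
  have \<tau>: "\<tau> > 0" using \<beta> b0 n1 by (simp add: \<tau>_def)
  have a0: "a > 0" using \<tau> by (simp add: a_def)
  \<comment> \<open>In terms of L the claimed bound has base a^4 / L and exponent L / 8.\<close>
  define L where "L = b0 / (\<gamma> * \<delta>)"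
  have L0: "L > 0" using b0 \<gamma>2 \<delta> by (simp add: L_def)
  have "a = 3 powr (3/4) * exp 1 * sqrt (2 * \<rho> * \<beta>) * sqrt (real n) * exp (2 * real n * gam n) * b0"
    unfolding \<rho> constant_normalization[OF \<beta>] by (simp add: a_def \<tau>_def \<gamma>_def)
  then have K_a: "K * b0 = a ^ 4 * \<gamma>"
    by (simp add: K \<gamma>_def power_mult_distrib power4_eq_xxxx power3_eq_cube mult_ac)
  have K0: "K > 0" using K_a a0 \<gamma>2 b0 by (metis zero_less_mult_pos2 mult_pos_pos zero_less_power less_le_trans zero_less_numeral)
  have CL: "C * \<delta> = a ^ 4 / L"
  proof -
    have "a ^ 4 / L = (a ^ 4 * \<gamma>) * \<delta> / b0" by (simp add: L_def)
    also have "\<dots> = K * \<delta>" unfolding K_a[symmetric] using b0 by simp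
    finally show ?thesis by (simp add: C)
  qed
  have aL: "a ^ 4 \<le> L"
  proof -
    have "\<delta> \<le> 1 / K" using \<delta> by (simp add: \<delta>0)
    then have "K * \<delta> \<le> 1" using K0 by (simp add: field_simps)
    then have "a ^ 4 / L \<le> 1" unfolding CL[symmetric] C .
    then show ?thesis using L0 by (simp add: divide_le_eq)
  qed
  have cL: "c / \<delta> = L / 8" by (simp add: c L_def \<gamma>_def)
  have "\<delta> \<le> b0 / (2 * \<gamma>)"
  proof -
    have div: "b0 / (2 * \<gamma> * y) \<le> b0 / (2 * \<gamma>)" if "y \<ge> 1" for y
      using that b0 \<gamma>2 by (intro divide_left_mono) auto
    have "\<delta>n \<le> b0 / (2 * \<gamma>)"
    proof -
      consider "n = 1 \<or> n = 2" | "n > 2" using n1 by linarith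
      then show ?thesis
      proof cases
        case 1
        then show ?thesis by (simp add: \<delta>n \<gamma>_def)
      next
        case 2
        then show ?thesis using div[of "real n - 1"] div[of "real n - 2"] by (auto simp: \<delta>n \<gamma>_def)
      qed
    qed
    then show ?thesis using \<delta> by (simp add: \<delta>0)
  qed
  then have L2: "L \<ge> 2" using \<gamma>2 \<delta> by (simp add: L_def field_simps)
  have b0L: "b0 / \<delta> = \<gamma> * L" using \<gamma>2 by (simp add: L_def)
  \<comment> \<open>The smallest k with L \<le> 2 * k: the degree k - 1 is then below L / 2, so that 2 * gam n * (k - 1) \<le> b0 / \<delta>.\<close>
  define k where "k = nat \<lceil>L / 2\<rceil>"
  have k: "real k \<ge> L / 2" "real k < L / 2 + 1" using L2 by (auto simp: k_def) linarith
  then have k1: "k \<ge> 1" using L2 by linarith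
  define m where "m = k - 1"
  have m: "real m < L / 2" using k k1 by (simp add: m_def)
  define N where "N = nat \<lfloor>b0 / \<delta>\<rfloor>"
  have N_le: "real N \<le> b0 / \<delta>" unfolding N_def using b0 \<delta> by simp
  have N_GM: "2 * G * m \<le> N"
  proof -
    have "real (2 * G * m) = 2 * \<gamma> * real m" by (simp add: \<gamma>_def G)
    also have "\<dots> \<le> \<gamma> * L" using m \<gamma>2 by simp
    finally show ?thesis unfolding N_def b0L by (rule le_nat_floor)
  qed
  have N0: "N > 0"
  proof -
    have "1 * 1 \<le> \<gamma> * L" using \<gamma>2 L2 by (intro mult_mono) auto
    then have "1 \<le> N" unfolding N_def b0L by (intro le_nat_floor) simp
    then show ?thesis by simp
  qed
  have N_k: "real N \<le> 2 * \<gamma> * real k"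
  proof -
    have "\<gamma> * L \<le> \<gamma> * (2 * real k)" using k \<gamma>2 by (intro mult_left_mono) auto
    then show ?thesis using N_le b0L by simp
  qed
  have side: "real N * \<delta> \<le> b0" using N_le \<delta> by (simp add: field_simps)
  define A where "A = (\<lambda>y. p + T y)"
  have A_norm: "norm (A u - A v) = norm (u - v)" for u v
    using T by (metis A_def add_diff_cancel_left linear_diff orthogonal_transformation_linear orthogonal_transformation_norm)
  obtain y0 where y0: "x0 = A y0" "\<And>i. 0 \<le> y0 $ i \<and> y0 $ i \<le> b"
    using x0 by (auto simp: E cube_def A_def)
  \<comment> \<open>The lower corner of a cube of side N * \<delta> that contains y0 and fits into the cube of side b.\<close>
  define q where "q = (\<chi> i. min (y0 $ i) (b - real N * \<delta>))"
  have q: "0 \<le> q $ i" "q $ i + real N * \<delta> \<le> b" "q $ i \<le> y0 $ i" "y0 $ i \<le> q $ i + real N * \<delta>" for i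
    using y0(2)[of i] side b \<delta> by (auto simp: q_def min_def)
  have "\<exists>t\<in>lattice_face UNIV i. A (q + \<delta> *\<^sub>R t) \<in> X" if i: "\<And>l. i l < N" for i
  proof -
    define r where "r = q + \<delta> *\<^sub>R (\<chi> l. real (i l))"
    have r: "0 \<le> r $ l" "r $ l + \<delta> \<le> b" for l
    proof -
      show "0 \<le> r $ l" using q(1)[of l] \<delta> by (simp add: r_def)
      have "(real (i l) + 1) * \<delta> \<le> real N * \<delta>" using i[of l] \<delta> by (intro mult_right_mono) auto
      then show "r $ l + \<delta> \<le> b" using q(2)[of l] by (simp add: r_def algebra_simps)
    qed
    have lin: "linear T" using T by (rule orthogonal_transformation_linear)
    have cube_r: "cube T (A r) \<delta> = {A (r + y) | y. \<forall>l. 0 \<le> y $ l \<and> y $ l \<le> \<delta>}"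
      by (auto simp: cube_def A_def linear_add[OF lin] add.assoc image_def)
    have "cube T (A r) \<delta> \<subseteq> E"
    proof
      fix z assume "z \<in> cube T (A r) \<delta>"
      then obtain y where y: "z = A (r + y)" "\<And>l. 0 \<le> y $ l \<and> y $ l \<le> \<delta>" by (auto simp: cube_r)
      have "0 \<le> (r + y) $ l \<and> (r + y) $ l \<le> b" for l using r[of l] y(2)[of l] by auto
      then show "z \<in> E" unfolding E cube_def y(1) A_def by blast
    qed
    from X[OF this] obtain y where y: "A (r + y) \<in> X" "\<And>l. 0 \<le> y $ l \<and> y $ l \<le> \<delta>" by (auto simp: cube_r)
    define t where "t = (\<chi> l. real (i l) + y $ l / \<delta>)"
    have "t \<in> lattice_face UNIV i" using y(2) \<delta> by (auto simp: t_def mem_lattice_face)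
    moreover have "q + \<delta> *\<^sub>R t = r + y" using \<delta> by (simp add: t_def r_def vec_eq_iff distrib_left)
    ultimately show ?thesis using y(1) by metis
  qed
  then obtain smp where smp: "\<And>i. (\<And>l. i l < N) \<Longrightarrow> smp i \<in> lattice_face UNIV i \<and> A (q + \<delta> *\<^sub>R smp i) \<in> X"
    by metis
  define Y where "Y = (\<lambda>i. q + \<delta> *\<^sub>R smp i) ` PiE (UNIV :: 'n set) (\<lambda>_. {..<N})"
  have finY: "finite Y" by (simp add: Y_def finite_PiE)
  have YX: "A y \<in> X" if "y \<in> Y" for y using that smp by (auto simp: Y_def)
  have norm_f: "native_norm (gaussian \<beta>) f \<ge> 0" by (rule native_norm_nonneg[OF f])
  have \<Delta>n: "\<Delta> * real n ^ n \<ge> 1"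
    by (rule prefactor_ge[OF n1 _ \<Delta>]) (use unit_ball_measure_ge[where 'n='n] in \<open>simp add: \<alpha> n\<close>)
  then have \<Delta>0: "\<Delta> \<ge> 0" by (metis linorder_not_less mult_nonpos_nonneg not_one_le_zero of_nat_0_le_iff order_less_imp_le order_trans zero_le_power)
  show "cmod (f x0 - s x0) \<le> \<Delta> * (C * \<delta>) powr (c / \<delta>) * native_norm (gaussian \<beta>) f"
  proof (cases "y0 \<in> Y")
    case True
    then have "s x0 = f x0" using s YX y0(1) by (auto simp: is_spline_interpolant_def)
    then show ?thesis using \<Delta>0 norm_f by simp
  next
    case False
    define B where "B = 2 * ((2 * real N) ^ m / fact m) ^ n"
    define R where "R = sqrt (real n) * b0"
    have bounds: "\<exists>\<mu>. \<mu> y0 = 1 \<and> sqrt (\<Sum>u\<in>insert y0 Y. \<Sum>v\<in>insert y0 Y. \<mu> u * \<mu> v * gaussian \<beta> (u - v))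
      \<le> B * sqrt ((2 * \<beta> * R\<^sup>2) ^ k / fact k * exp (2 * \<beta> * R\<^sup>2))"
    proof (rule power_function_bound[OF \<beta> finY False])
      fix y assume "y \<in> Y"
      then obtain i where "i \<in> PiE (UNIV :: 'n set) (\<lambda>_. {..<N})" and y: "y = q + \<delta> *\<^sub>R smp i"
        unfolding Y_def by blast
      then have i: "i l < N" for l by auto
      have "\<bar>(y - y0) $ l\<bar> \<le> b0" for l
      proof -
        have "real (i l) \<le> smp i $ l \<and> smp i $ l \<le> real (i l) + 1"
          using smp[of i] i by (auto simp: mem_lattice_face)
        then have "0 \<le> smp i $ l" "smp i $ l \<le> real N" using i[of l] by linarith+
        then have "0 \<le> \<delta> * smp i $ l" "\<delta> * smp i $ l \<le> \<delta> * real N" using \<delta> by (auto intro: mult_left_mono)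
        then show ?thesis using q(3)[of l] q(4)[of l] side by (simp add: y abs_le_iff mult.commute)
      qed
      then have "(\<Sum>l\<in>UNIV. ((y - y0) $ l)\<^sup>2) \<le> (\<Sum>l\<in>(UNIV :: 'n set). b0\<^sup>2)"
        using b0 by (intro sum_mono) (metis abs_le_square_iff abs_of_pos)
      then have "norm (y - y0) \<le> sqrt (real n * b0\<^sup>2)"
        by (simp add: norm_vec_def L2_set_def n)
      then show "norm (y - y0) \<le> R" using b0 by (simp add: R_def real_sqrt_mult)
    next
      show "k > 0" using k1 by simp
      show "B \<ge> 0" by (simp add: B_def)
    next
      fix P :: "real^'n \<Rightarrow> real"
      assume P: "total_deg_le (k - 1) P" "\<And>y. y \<in> Y \<Longrightarrow> \<bar>P y\<bar> \<le> 1"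
      define t0 where "t0 = (\<chi> l. (y0 $ l - q $ l) / \<delta>)"
      have "\<bar>P (q + \<delta> *\<^sub>R t0)\<bar> \<le> 2 * ((2 * real N) ^ m / fact m) ^ CARD('n)"
      proof (rule norming_grid[where G = G and p = "\<lambda>t. P (q + \<delta> *\<^sub>R t)" and x = t0])
        show "total_deg_le m (\<lambda>t. P (q + \<delta> *\<^sub>R t))" using total_deg_le_affine P(1) by (simp add: m_def)
        show "gam CARD('n) = real G" using G n by simp
        fix i :: "'n \<Rightarrow> nat" assume i: "\<And>l. i l < N"
        then have "\<bar>P (q + \<delta> *\<^sub>R smp i)\<bar> \<le> 1" by (intro P(2)) (auto simp: Y_def)
        moreover have "smp i \<in> lattice_face UNIV i" using smp[of i] i by simp
        ultimately show "\<exists>t\<in>lattice_face UNIV i. \<bar>P (q + \<delta> *\<^sub>R t)\<bar> \<le> 1" by (rule bexI)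
      next
        fix l
        show "0 \<le> t0 $ l \<and> t0 $ l \<le> real N" using q(3)[of l] q(4)[of l] \<delta> by (simp add: t0_def field_simps)
      qed (use N_GM N0 in auto)
      moreover have "q + \<delta> *\<^sub>R t0 = y0" using \<delta> by (simp add: t0_def vec_eq_iff)
      ultimately show "\<bar>P y0\<bar> \<le> B" by (simp add: B_def n)
    qed
    then obtain \<mu> where \<mu>: "\<mu> y0 = 1" "sqrt (\<Sum>u\<in>insert y0 Y. \<Sum>v\<in>insert y0 Y. \<mu> u * \<mu> v * gaussian \<beta> (u - v))
      \<le> B * sqrt ((2 * \<beta> * R\<^sup>2) ^ k / fact k * exp (2 * \<beta> * R\<^sup>2))" by blast
    have R\<tau>: "2 * \<beta> * R\<^sup>2 = \<tau>\<^sup>2" using \<beta> by (simp add: R_def \<tau>_def power_mult_distrib)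
    have "2 * (B * sqrt ((\<tau>\<^sup>2) ^ k / fact k * exp (\<tau>\<^sup>2))) \<le> \<Delta> * (a ^ 4 / L) powr (L / 8)"
      using constant_comparison[OF n1 \<gamma>2n k1 L0 _ \<tau> a_def aL N_k \<Delta>n] k by (simp add: B_def m_def)
    then have bd: "2 * sqrt (\<Sum>u\<in>insert y0 Y. \<Sum>v\<in>insert y0 Y. \<mu> u * \<mu> v * gaussian \<beta> (u - v))
        \<le> \<Delta> * (C * \<delta>) powr (c / \<delta>)"
      using \<mu>(2) unfolding R\<tau> CL cL by linarith
    have "cmod (f x0 - s x0) \<le> 2 * native_norm (gaussian \<beta>) f *
        sqrt (\<Sum>u\<in>insert y0 Y. \<Sum>v\<in>insert y0 Y. \<mu> u * \<mu> v * gaussian \<beta> (u - v))"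
      unfolding y0(1) by (rule native_residual_bound[where A = A, OF \<beta> f s A_norm finY False YX, where \<mu> = \<mu>]) (use \<mu>(1) in simp_all)
    also have "\<dots> \<le> \<Delta> * (C * \<delta>) powr (c / \<delta>) * native_norm (gaussian \<beta>) f"
      using mult_right_mono[OF bd norm_f] by (simp add: mult_ac)
    finally show ?thesis .
  qed
qed

end
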